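(* Let $0<p<1$. Suppose that $X=(X_t)_{t\ge 0}$ is an adapted supermartingale with only nonnegative jumps (i.e. $\Delta X_t\ge 0$ for all $t$), satisfying $X_0=0$ almost surely. Then $$\|M\|_p\le \mathfrak c_p\,\|M^-\|_p ,$$ where $$\mathfrak c_p=\begin{cases}\displaystyle\left(\left(\frac1p-1\right)^p+\int_{p^{-1}-1}^\infty \frac{s^{p-1}}{s+1}\,\mathrm ds\right)^{1/p} & \text{if } 0<p\le 1/2,\\[2ex] \displaystyle\left(1+\int_1^\infty \frac{s^{p-1}}{s+1}\,\mathrm ds\right)^{1/p} & \text{if } 1/2<p<1,\end{cases}$$ and the constant $\mathfrak c_p$ is the best possible (it cannot be replaced by any smaller constant valid for all such $X$). It is already the best possible if $X$ is assumed to be a stopped Brownian motion, i.e. $X=(B_{\eta\wedge t})_{t\ge 0}$ for a standard one-dimensional Brownian motion $B$ started at $0$ and a stopping time $\eta$ of $B$.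
   Context: Setting: $(\Omega,\mathcal F,\mathbb P)$ is a complete probability space with a filtration $(\mathcal F_t)_{t\ge 0}$ (a nondecreasing family of sub-$\sigma$-algebras of $\mathcal F$) such that $\mathcal F_0$ contains all events of probability $0$. All processes $X$ considered are adapted to this filtration and have right-continuous trajectories with left limits. $\Delta X_t=X_t-X_{t-}$ is the jump of $X$ at time $t$, with the convention $X_{0-}=0$. Infimum process and two-sided maximal process: $M^-_t=\left(\inf_{0\le s\le t}X_s\right)\wedge 0$ and $M_t=\sup_{0\le s\le t}|X_s|$, where $a\wedge b=\min\{a,b\}$. For a process $Y=(Y_t)_{t\ge0}$, $\|Y\|_p=\sup_{t\ge 0}\left(\mathbb E|Y_t|^p\right)^{1/p}$. *)

theory Defs
  imports "HOL-Probability.Probability"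
begin

text \<open>Time is the half-line \<open>{0..}\<close> of type \<^typ>\<open>real\<close>. A process is a function
  \<open>X :: real \<Rightarrow> 'a \<Rightarrow> real\<close> (and a filtration a function \<open>F :: real \<Rightarrow> 'a measure\<close>) whose values at
  negative times are irrelevant; every condition below is therefore restricted to times \<open>t \<ge> 0\<close>.\<close>

definition filtered_prob_space :: "'a measure \<Rightarrow> (real \<Rightarrow> 'a measure) \<Rightarrow> bool" where
  "filtered_prob_space M F \<longleftrightarrow>
     prob_space M \<and> complete_measure M \<and>
     (\<forall>t\<ge>0. subalgebra M (F t)) \<and>
     (\<forall>s t. 0 \<le> s \<and> s \<le> t \<longrightarrow> sets (F s) \<subseteq> sets (F t)) \<and>
     null_sets M \<subseteq> sets (F 0)"

definition adapted :: "(real \<Rightarrow> 'a measure) \<Rightarrow> (real \<Rightarrow> 'a \<Rightarrow> real) \<Rightarrow> bool" where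
  "adapted F X \<longleftrightarrow> (\<forall>t\<ge>0. X t \<in> borel_measurable (F t))"

definition supermartingale ::
    "'a measure \<Rightarrow> (real \<Rightarrow> 'a measure) \<Rightarrow> (real \<Rightarrow> 'a \<Rightarrow> real) \<Rightarrow> bool" where
  "supermartingale M F X \<longleftrightarrow>
     adapted F X \<and> (\<forall>t\<ge>0. integrable M (X t)) \<and>
     (\<forall>s t. 0 \<le> s \<and> s \<le> t \<longrightarrow> (AE \<omega> in M. real_cond_exp M (F s) (X t) \<omega> \<le> X s \<omega>))"

definition right_cont_left_lims :: "(real \<Rightarrow> real) \<Rightarrow> bool" where
  "right_cont_left_lims f \<longleftrightarrow>
     (\<forall>t\<ge>0. (f \<longlongrightarrow> f t) (at_right t)) \<and> (\<forall>t>0. \<exists>l. (f \<longlongrightarrow> l) (at_left t))"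

text \<open>The convention \<open>f(0-) = 0\<close> makes the jump at time \<open>0\<close> equal to \<open>f 0\<close>.\<close>

definition jump :: "(real \<Rightarrow> real) \<Rightarrow> real \<Rightarrow> real" where
  "jump f t = f t - (if t = 0 then 0 else Lim (at_left t) f)"

definition inf_process :: "(real \<Rightarrow> 'a \<Rightarrow> real) \<Rightarrow> real \<Rightarrow> 'a \<Rightarrow> real" where
  "inf_process X t \<omega> = min (INF s\<in>{0..t}. X s \<omega>) 0"

definition max_process :: "(real \<Rightarrow> 'a \<Rightarrow> real) \<Rightarrow> real \<Rightarrow> 'a \<Rightarrow> real" where
  "max_process X t \<omega> = (SUP s\<in>{0..t}. \<bar>X s \<omega>\<bar>)"

text \<open>The \<open>p\<close>-norm of a process takes values in \<open>[0,\<infinity>]\<close>. The real power \<open>powr\<close> is extended by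
  \<open>\<infinity> powr a = \<infinity>\<close>; it is only used with exponents \<open>a > 0\<close>, for which also \<open>0 powr a = 0\<close>.\<close>

definition ennreal_powr :: "ennreal \<Rightarrow> real \<Rightarrow> ennreal" where
  "ennreal_powr x a = (if x = \<infinity> then \<infinity> else ennreal (enn2real x powr a))"

definition process_norm :: "'a measure \<Rightarrow> real \<Rightarrow> (real \<Rightarrow> 'a \<Rightarrow> real) \<Rightarrow> ennreal" where
  "process_norm M p Y =
     (SUP t\<in>{0..}. ennreal_powr (\<integral>\<^sup>+\<omega>. ennreal (\<bar>Y t \<omega>\<bar> powr p) \<partial>M) (1 / p))"

text \<open>The nonnegativity of the jumps is required almost surely, simultaneously for all times.\<close>

definition admissible_process ::
    "'a measure \<Rightarrow> (real \<Rightarrow> 'a measure) \<Rightarrow> (real \<Rightarrow> 'a \<Rightarrow> real) \<Rightarrow> bool" where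
  "admissible_process M F X \<longleftrightarrow>
     filtered_prob_space M F \<and>
     supermartingale M F X \<and>
     (\<forall>\<omega>\<in>space M. right_cont_left_lims (\<lambda>t. X t \<omega>)) \<and>
     (AE \<omega> in M. \<forall>t\<ge>0. jump (\<lambda>t. X t \<omega>) t \<ge> 0) \<and>
     (AE \<omega> in M. X 0 \<omega> = 0)"

definition brownian_motion :: "'a measure \<Rightarrow> (real \<Rightarrow> 'a \<Rightarrow> real) \<Rightarrow> bool" where
  "brownian_motion M B \<longleftrightarrow>
     prob_space M \<and>
     (\<forall>t\<ge>0. B t \<in> borel_measurable M) \<and>
     (AE \<omega> in M. B 0 \<omega> = 0) \<and>
     (\<forall>s t. 0 \<le> s \<and> s < t \<longrightarrow>
        distributed M lborel (\<lambda>\<omega>. B t \<omega> - B s \<omega>) (\<lambda>x. ennreal (normal_density 0 (sqrt (t - s)) x))) \<and>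
     (\<forall>(n::nat) (\<tau>::nat \<Rightarrow> real). 0 \<le> \<tau> 0 \<and> mono \<tau> \<longrightarrow>
        prob_space.indep_vars M (\<lambda>_. borel) (\<lambda>i \<omega>. B (\<tau> (Suc i)) \<omega> - B (\<tau> i) \<omega>) {..<n}) \<and>
     (\<forall>\<omega>\<in>space M. continuous_on {0..} (\<lambda>t. B t \<omega>))"

text \<open>The filtration generated by \<open>B\<close>, augmented by the null sets of \<open>M\<close>.\<close>

definition natural_filtration ::
    "'a measure \<Rightarrow> (real \<Rightarrow> 'a \<Rightarrow> real) \<Rightarrow> real \<Rightarrow> 'a measure" where
  "natural_filtration M B t =
     sigma (space M)
       ({B s -` A \<inter> space M | s A. 0 \<le> s \<and> s \<le> t \<and> A \<in> sets borel} \<union> null_sets M)"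

text \<open>Stopping times take values in \<open>[0,\<infinity>]\<close>. The library's \<open>stopping_time\<close> is not usable here,
  since there a stopping time has the type of the time index and cannot be infinite.\<close>

definition ext_stopping_time ::
    "'a measure \<Rightarrow> (real \<Rightarrow> 'a measure) \<Rightarrow> ('a \<Rightarrow> ennreal) \<Rightarrow> bool" where
  "ext_stopping_time M F \<eta> \<longleftrightarrow> (\<forall>t\<ge>0. {\<omega> \<in> space M. \<eta> \<omega> \<le> ennreal t} \<in> sets (F t))"

definition stopped_process ::
    "(real \<Rightarrow> 'a \<Rightarrow> real) \<Rightarrow> ('a \<Rightarrow> ennreal) \<Rightarrow> real \<Rightarrow> 'a \<Rightarrow> real" where
  "stopped_process B \<eta> t \<omega> = B (enn2real (min (\<eta> \<omega>) (ennreal t))) \<omega>"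

definition best_const :: "real \<Rightarrow> real" where
  "best_const p =
     (if p \<le> 1 / 2
      then ((1 / p - 1) powr p
            + (LBINT s:{1 / p - 1..}. s powr (p - 1) / (s + 1))) powr (1 / p)
      else (1 + (LBINT s:{1..}. s powr (p - 1) / (s + 1))) powr (1 / p))"

end

theory Submission
  imports Defs "HOL-Real_Asymp.Real_Asymp"
begin

text \<open>Upper bound. Write \<open>m = - inf X\<close> (cut off at \<open>0\<close>) and \<open>S = sup X\<close>. If \<open>X\<close> has no negative jumps, \<open>m\<close> only
  increases while \<open>X = -m\<close>, so \<open>(X + m) / (m + s) - ln (1 + m / s)\<close> is a local supermartingale, and stopping it when
  \<open>X\<close> reaches \<open>s\<close> or \<open>m\<close> exceeds \<open>a\<close> gives \<open>P (S > s, m \<le> a) \<le> E (ln (1 + min m a / s))\<close>. Integrating this with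
  \<open>a = s / k\<close> against \<open>p * s powr (p - 1)\<close> yields, for every \<open>k \<ge> 1\<close>,
  \<open>E (max S (k * m) powr p) \<le> (k powr p + \<integral> s powr (p - 1) / (s + 1) over {k..}) * E (m powr p)\<close>; the factor is
  minimal at \<open>k = max 1 (1 / p - 1)\<close>.

  Sharpness. For \<open>q > 1\<close> let a Brownian motion run through the levels \<open>-1, -q, -q\<^sup>2, \<dots>\<close> and stop it at the
  level \<open>-(q ^ Suc k)\<close> if it has reached \<open>s * q ^ Suc k\<close>, \<open>s = 1 / p - 1\<close>, since the previous level. By gambler's
  ruin the law of the maximum relative to the stopping level does not depend on \<open>k\<close> and produces exactly the factor above,
  while the moments of the level itself are a geometric series that is critical for this \<open>s\<close> as \<open>q\<close> tends to
  \<open>1\<close>. Hence truncating the procedure at a late level costs an arbitrarily small proportion of the moment.\<close>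

section \<open>The upper bound\<close>

text \<open>The potential \<open>(x + m) / (m + s) - ln (1 + m / s)\<close> arises as follows.
  Brownian motion at \<open>x\<close> reaches \<open>s\<close> before \<open>-m\<close> with
  probability \<open>(x + m) / (m + s)\<close>; at \<open>x = -m\<close> this expression grows with
  \<open>m\<close> at rate \<open>1 / (m + s)\<close>, which is the derivative of the subtracted
  logarithm.

  Since \<open>X\<close> is only a cadlag supermartingale, whose supremum and infimum may fail to be
  integrable, the argument is run as a betting system along finite grids. There a single step can
  fall below the old minimum by any amount. Such a step freezes the bet, so that the error is
  controlled by the integrable terminal value.

  Sharpness asks for a concrete Brownian motion on a complete space with its augmented filtration.
  It is built as a random series, whose laws are accessible through characteristic functions. Hence
  independence of an increment from the past is deduced from a factorisation of characteristic
  functions, and all martingale statements from optional stopping applied to hybrid stopping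
  times.\<close>

primrec drawdown :: "(nat \<Rightarrow> real) \<Rightarrow> nat \<Rightarrow> real" where
  "drawdown x 0 = 0"
| "drawdown x (Suc k) = max (drawdown x k) (- x (Suc k))"

definition overshoot :: "real \<Rightarrow> (nat \<Rightarrow> real) \<Rightarrow> nat \<Rightarrow> bool" where
  "overshoot \<delta> x n \<longleftrightarrow> (\<exists>j<n. \<delta> < drawdown x (Suc j) - drawdown x j)"

definition halted :: "real \<Rightarrow> real \<Rightarrow> (nat \<Rightarrow> real) \<Rightarrow> nat \<Rightarrow> bool" where
  "halted s a x n \<longleftrightarrow> (\<exists>j\<le>n. s \<le> x j \<or> a < drawdown x j)"

text \<open>An active bet is the slope in \<open>x\<close> of \<open>(x + m) / (m + s)\<close>; the
  initial \<open>1 / s\<close> is this slope at \<open>m = 0\<close>. The bet on the step from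
  \<open>k\<close> to \<open>Suc k\<close> depends on \<open>x 0, ..., x k\<close> only.
  Overshooting is tested before halting: a bet that is open when the large drop occurs is held to
  the end rather than closed, so the loss is measured by the terminal value and not by the bottom of
  the drop, for which no integrable bound is available.\<close>

primrec bet :: "real \<Rightarrow> real \<Rightarrow> real \<Rightarrow> (nat \<Rightarrow> real) \<Rightarrow> nat \<Rightarrow> real" where
  "bet s a \<delta> x 0 = 1 / s"
| "bet s a \<delta> x (Suc k) =
     (if overshoot \<delta> x (Suc k) then bet s a \<delta> x k
      else if halted s a x (Suc k) then 0
      else 1 / (drawdown x (Suc k) + s))"

lemma drawdown_nonneg: "0 \<le> drawdown x k"
  by (induction k) auto

text \<open>The recursion skips \<open>x 0\<close>; starting at \<open>0\<close> is what covers this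
  index too.\<close>

lemma drawdown_ge: "x 0 = 0 \<Longrightarrow> - x k \<le> drawdown x k"
  by (cases k) auto

lemma drawdown_eq: "drawdown x k = 0 \<or> (\<exists>j\<le>k. drawdown x k = - x j)"
  by (induction k) (auto simp: max_def le_Suc_eq)

lemma bet_bounds:
  assumes "0 < s"
  shows "0 \<le> bet s a \<delta> x k" "bet s a \<delta> x k \<le> 1 / s"
proof -
  have "0 < drawdown x k + s" "s \<le> drawdown x k + s" for k
    using assms drawdown_nonneg[of x k] by linarith+
  then have "0 \<le> bet s a \<delta> x k \<and> bet s a \<delta> x k \<le> 1 / s"
    using assms
    by (induction k) (auto intro!: divide_left_mono mult_pos_pos simp: less_imp_le simp del: drawdown.simps)
  then show "0 \<le> bet s a \<delta> x k" "bet s a \<delta> x k \<le> 1 / s" by auto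
qed

lemma ln_one_plus_lower:
  fixes u c :: real
  assumes "0 \<le> u" "1 + u \<le> c"
  shows "u \<le> c * ln (1 + u)"
proof -
  have "ln (1 / (1 + u)) \<le> 1 / (1 + u) - 1"
    using assms by (intro ln_le_minus_one) auto
  then have "1 - 1 / (1 + u) \<le> ln (1 + u)"
    using assms by (simp add: ln_div)
  then have "u / (1 + u) \<le> ln (1 + u)"
    using assms by (simp add: field_simps)
  then have "u \<le> (1 + u) * ln (1 + u)"
    using assms by (simp add: field_simps)
  also have "\<dots> \<le> c * ln (1 + u)"
    using assms by (intro mult_right_mono) auto
  finally show ?thesis .
qed

text \<open>A left-endpoint Riemann sum of \<open>1 / (m + s)\<close> overestimates the logarithm.
  For \<open>u = (d' - d) / (d + s)\<close> the increment of the logarithm is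
  \<open>ln (1 + u)\<close>, and \<open>u \<le> \<delta> / s\<close> together with
  \<open>u \<le> (1 + u) * ln (1 + u)\<close> limits the excess to the factor
  \<open>1 + \<delta> / s\<close>.\<close>

lemma ln_drawdown_step:
  fixes d d' s \<delta> :: real
  assumes "0 < s" "0 \<le> d" "d \<le> d'" "d' - d \<le> \<delta>"
  shows "(d' - d) / (d + s) \<le> (1 + \<delta> / s) * (ln (1 + d' / s) - ln (1 + d / s))"
proof -
  define u where "u = (d' - d) / (d + s)"
  have u: "0 \<le> u" using assms by (simp add: u_def)
  have "u \<le> \<delta> / s"
    unfolding u_def using assms by (intro frac_le) auto
  then have "u \<le> (1 + \<delta> / s) * ln (1 + u)"
    using u by (intro ln_one_plus_lower) auto
  also have "1 + u = (1 + d' / s) / (1 + d / s)"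
  proof -
    have "1 + u = (d' + s) / (d + s)" "1 + d' / s = (d' + s) / s" "1 + d / s = (d + s) / s"
      unfolding u_def using assms by (simp_all add: field_simps)
    then show ?thesis using assms by simp
  qed
  also have "ln \<dots> = ln (1 + d' / s) - ln (1 + d / s)"
    using assms by (intro ln_divide_pos) (auto intro!: add_pos_nonneg)
  finally show ?thesis unfolding u_def .
qed

text \<open>\<open>ln (1 + y / s)\<close> has slope at most \<open>1 / s\<close> for
  \<open>y \<ge> 0\<close>. This pays for the last step below the level \<open>-a\<close>, after
  which the drawdown may exceed the cap \<open>a\<close> by up to \<open>\<delta>\<close>.\<close>

lemma ln_shift:
  fixes a b s \<delta> :: real
  assumes "0 < s" "0 \<le> a" "0 \<le> \<delta>" "0 \<le> b" "b \<le> a + \<delta>"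
  shows "ln (1 + b / s) \<le> ln (1 + a / s) + \<delta> / s"
proof -
  define A B where "A = 1 + a / s" and "B = 1 + b / s"
  have A: "1 \<le> A" and B: "1 \<le> B" using assms by (auto simp: A_def B_def)
  have BA: "B \<le> A + \<delta> / s"
    using assms by (simp add: A_def B_def add_divide_distrib[symmetric] divide_right_mono)
  have "ln B - ln A = ln (B / A)" using A B by (simp add: ln_div)
  also have "\<dots> \<le> B / A - 1" using A B by (intro ln_le_minus_one) auto
  also have "\<dots> = (B - A) / A" using A by (simp add: field_simps)
  also have "\<dots> \<le> (\<delta> / s) / A" using A BA by (intro divide_right_mono) auto
  also have "\<dots> \<le> (\<delta> / s) / 1" using A assms by (intro divide_left_mono) auto
  finally show ?thesis unfolding A_def B_def by simp
qed

text \<open>Discrete Azema--Yor argument: while active, the gain dominates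
  \<open>(x + m) / (m + s) - (1 + \<delta> / s) * ln (1 + m / s)\<close> with \<open>m\<close> the drawdown. After a drawdown step larger
  than \<open>\<delta>\<close> the bet is frozen, so that the remaining loss is controlled by the terminal value of \<open>x\<close>
  alone, whatever the size of that step.\<close>

lemma bet_gain:
  fixes x :: "nat \<Rightarrow> real"
  assumes x0: "x 0 = 0" and s: "0 < s" and a: "0 \<le> a" and \<delta>: "0 < \<delta>"
  defines "g \<equiv> \<lambda>n. \<Sum>k<n. bet s a \<delta> x k * (x (Suc k) - x k)"
    and "L \<equiv> \<lambda>n. (1 + \<delta> / s) * (ln (1 + min (drawdown x n) a / s) + \<delta> / s)"
  shows "(if (\<exists>j\<le>n. s \<le> x j) \<and> drawdown x n \<le> a \<and> \<not> overshoot \<delta> x n then 1 else 0)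
          - L n - (if overshoot \<delta> x n then max 0 (- x n) / s else 0) \<le> g n"
proof -
  let ?d = "drawdown x" and ?w = "bet s a \<delta> x"
  define K where "K n = (1 + \<delta> / s) * ln (1 + ?d n / s)" for n
  have c: "0 < 1 + \<delta> / s" using s \<delta> by (simp add: add_pos_pos)
  have dn: "0 \<le> ?d n" for n by (rule drawdown_nonneg)
  have L_mono: "L n \<le> L (Suc n)" for n
    unfolding L_def using s a dn[of n] dn[of "Suc n"] c
    by (intro mult_left_mono add_right_mono ln_mono add_left_mono divide_right_mono min.mono)
       (auto intro!: add_pos_nonneg)
  have L_nonneg: "0 \<le> L n" for n
    unfolding L_def using s a dn[of n] c \<delta>
    by (intro mult_nonneg_nonneg add_nonneg_nonneg) auto
  have KL: "K n \<le> L m" if "?d n \<le> a + \<delta>" "?d n \<le> ?d m + \<delta>" for n m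
  proof -
    have "ln (1 + ?d n / s) \<le> ln (1 + min (?d m) a / s) + \<delta> / s"
      using s a \<delta> dn[of n] dn[of m] that by (intro ln_shift) auto
    then show ?thesis unfolding K_def L_def using c by (intro mult_left_mono) auto
  qed
  have halt_mono: "halted s a x n \<Longrightarrow> halted s a x (Suc n)" for n
    unfolding halted_def using le_Suc_eq by blast
  have ov_mono: "overshoot \<delta> x n \<Longrightarrow> overshoot \<delta> x (Suc n)" for n
    unfolding overshoot_def using less_Suc_eq by blast
  \<comment> \<open>Invariant by phase. While active, the gain dominates the potential with
    \<open>K\<close> as the logarithmic term. After halting the position is closed, so the gain
    stays constant while its lower bound can only decrease. After an overshoot the weight is
    constant, so \<open>?w n * x n\<close> moves in step with the gain. Passing from
    \<open>L n\<close> to \<open>L (Suc n)\<close> only weakens the bounds.\<close>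
  have "(\<not> overshoot \<delta> x n \<and> \<not> halted s a x n \<longrightarrow>
            ?w n = 1 / (?d n + s) \<and> (x n + ?d n) / (?d n + s) - K n \<le> g n) \<and>
        (\<not> overshoot \<delta> x n \<and> halted s a x n \<longrightarrow>
            ?w n = 0 \<and> (if ?d n \<le> a then 1 else 0) - L n \<le> g n) \<and>
        (overshoot \<delta> x n \<longrightarrow> ?w n * x n - L n \<le> g n)"
  proof (induction n)
    case 0
    show ?case
      using s a \<delta> x0 by (auto simp: overshoot_def halted_def g_def L_def K_def)
  next
    case (Suc n)
    have g_Suc: "g (Suc n) = g n + ?w n * (x (Suc n) - x n)" by (simp add: g_def)
    have mono_d: "?d n \<le> ?d (Suc n)" by simp
    show ?case
    proof (cases "overshoot \<delta> x n")
      case True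
      then have *: "?w n * x n - L n \<le> g n" using Suc by blast
      have "overshoot \<delta> x (Suc n)" using True ov_mono by blast
      then show ?thesis using * g_Suc L_mono[of n] by (auto simp: algebra_simps)
    next
      case nov: False
      show ?thesis
      proof (cases "halted s a x n")
        case True
        then have *: "?w n = 0" "(if ?d n \<le> a then 1 else 0) - L n \<le> g n" using Suc nov by blast+
        have "g (Suc n) = g n" using * g_Suc by simp
        then show ?thesis using * halt_mono[OF True] L_mono[of n] L_nonneg[of n] mono_d
          by (auto split: if_splits simp del: drawdown.simps)
      next
        case nh: False
        then have w: "?w n = 1 / (?d n + s)" and g: "(x n + ?d n) / (?d n + s) - K n \<le> g n"
          using Suc nov by blast+
        have da: "?d n \<le> a" using nh by (auto simp: halted_def not_less)
        have g': "g (Suc n) \<ge> (x (Suc n) + ?d n) / (?d n + s) - K n"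
          using g g_Suc w by (simp add: add_divide_distrib diff_divide_distrib)
        show ?thesis
        proof (cases "overshoot \<delta> x (Suc n)")
          case True
          \<comment> \<open>The oversized step itself never enters \<open>K\<close>: the potential
            is evaluated at the old drawdown, which is at most \<open>a\<close>.\<close>
          have "K n \<le> L (Suc n)" using da mono_d \<delta> by (intro KL) (auto simp del: drawdown.simps)
          moreover have "(x (Suc n)) / (?d n + s) \<le> (x (Suc n) + ?d n) / (?d n + s)"
            using s dn[of n] by (intro divide_right_mono) auto
          ultimately show ?thesis using True g' w by auto
        next
          case nov': False
          then have step: "?d (Suc n) - ?d n \<le> \<delta>"
            using nov' unfolding overshoot_def by (meson lessI not_less)
          have gK: "(x (Suc n) + ?d (Suc n)) / (?d (Suc n) + s) - K (Suc n) \<le> g (Suc n)"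
          proof (cases "- x (Suc n) \<le> ?d n")
            case True
            then have "?d (Suc n) = ?d n" by simp
            then show ?thesis using g' by (simp add: K_def)
          next
            case False
            then have d': "?d (Suc n) = - x (Suc n)" by simp
            \<comment> \<open>At a new minimum the term \<open>(x + m) / (m + s)\<close> vanishes,
              whereas the bet made at the old drawdown leaves
              \<open>- (?d (Suc n) - ?d n) / (?d n + s)\<close>; the growth of \<open>K\<close> has
              to pay for exactly this amount.\<close>
            have "(?d (Suc n) - ?d n) / (?d n + s) \<le> K (Suc n) - K n"
              unfolding K_def right_diff_distrib[symmetric]
              using s dn step mono_d by (intro ln_drawdown_step) auto
            then show ?thesis using g' d' by (simp add: field_simps minus_divide_left del: drawdown.simps)
              (smt (verit) minus_divide_left)
          qed
          have KL': "K (Suc n) \<le> L (Suc n)"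
            using da step \<delta> by (intro KL) (auto simp del: drawdown.simps)
          show ?thesis
          proof (cases "halted s a x (Suc n)")
            case True
            \<comment> \<open>If the drawdown is still within \<open>a\<close>, halting at this step
              can only come from \<open>x\<close> reaching \<open>s\<close>. Then
              \<open>(x + m) / (m + s)\<close> is at least \<open>1\<close>, which is the indicator
              to be earned.\<close>
            have "s \<le> x (Suc n)" if "?d (Suc n) \<le> a"
              using True nh that by (auto simp: halted_def le_Suc_eq simp del: drawdown.simps)
            then have "1 \<le> (x (Suc n) + ?d (Suc n)) / (?d (Suc n) + s)" if "?d (Suc n) \<le> a"
              using that s dn[of "Suc n"] by (simp add: field_simps del: drawdown.simps)
            moreover have "0 \<le> (x (Suc n) + ?d (Suc n)) / (?d (Suc n) + s)"
              using s dn[of "Suc n"] drawdown_ge[of x "Suc n", OF x0]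
              by (intro divide_nonneg_nonneg) (auto simp del: drawdown.simps)
            ultimately show ?thesis using True nov' gK KL'
              by (auto simp del: drawdown.simps)
          next
            case False
            then show ?thesis using nov' gK by (auto simp del: drawdown.simps)
          qed
        qed
      qed
    qed
  qed
  note inv = this
  show ?thesis
  proof (cases "overshoot \<delta> x n")
    case True
    have "- max 0 (- x n) / s \<le> ?w n * x n"
    proof (cases "0 \<le> x n")
      case False
      then have "?w n * (- x n) \<le> 1 / s * (- x n)"
        using bet_bounds(2)[OF s] by (intro mult_right_mono) auto
      then show ?thesis using False by simp
    qed (use bet_bounds(1)[OF s] in auto)
    then show ?thesis using inv True by auto
  next
    case nov: False
    show ?thesis
    proof (cases "halted s a x n")
      case True
      then show ?thesis using nov inv L_nonneg[of n] by (auto split: if_splits)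
    next
      case False
      have "?d n \<le> a" using False by (auto simp: halted_def not_less)
      then have "K n \<le> L n" using \<delta> by (intro KL) auto
      moreover have "0 \<le> (x n + ?d n) / (?d n + s)"
        using s dn[of n] drawdown_ge[of x n, OF x0] by (intro divide_nonneg_nonneg) auto
      moreover have "\<not> (\<exists>j\<le>n. s \<le> x j)" using False by (auto simp: halted_def)
      ultimately show ?thesis using inv nov False by auto
    qed
  qed
qed

section \<open>Adaptedness of the bets and their expected gain\<close>

lemma drawdown_measurable:
  assumes "\<And>j. j \<le> k \<Longrightarrow> X j \<in> borel_measurable N"
  shows "(\<lambda>\<omega>. drawdown (\<lambda>j. X j \<omega>) k) \<in> borel_measurable N"
  using assms by (induction k) auto

lemma pred_drawdown_measurable:
  assumes X: "\<And>j. j \<le> k \<Longrightarrow> X j \<in> borel_measurable N"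
  shows "Measurable.pred N (\<lambda>\<omega>. overshoot \<delta> (\<lambda>j. X j \<omega>) k)"
    and "Measurable.pred N (\<lambda>\<omega>. halted s a (\<lambda>j. X j \<omega>) k)"
proof -
  have d: "(\<lambda>\<omega>. drawdown (\<lambda>j. X j \<omega>) i) \<in> borel_measurable N" if "i \<le> k" for i
    using X that by (intro drawdown_measurable) auto
  show "Measurable.pred N (\<lambda>\<omega>. overshoot \<delta> (\<lambda>j. X j \<omega>) k)"
    unfolding overshoot_def
    by (intro pred_intros_countable pred_intros_conj1' borel_measurable_pred_less
        borel_measurable_const borel_measurable_diff d) auto
  show "Measurable.pred N (\<lambda>\<omega>. halted s a (\<lambda>j. X j \<omega>) k)"
    unfolding halted_def linorder_not_less[symmetric]
    by (intro pred_intros_countable pred_intros_conj1' pred_intros_logic borel_measurable_pred_less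
        borel_measurable_const d X) auto
qed

lemma bet_measurable:
  assumes X: "\<And>j. j \<le> k \<Longrightarrow> X j \<in> borel_measurable N"
  shows "(\<lambda>\<omega>. bet s a \<delta> (\<lambda>j. X j \<omega>) k) \<in> borel_measurable N"
  using X
proof (induction k)
  case (Suc k)
  have [measurable]: "(\<lambda>\<omega>. bet s a \<delta> (\<lambda>j. X j \<omega>) k) \<in> borel_measurable N"
    using Suc by auto
  have [measurable]: "Measurable.pred N (\<lambda>\<omega>. overshoot \<delta> (\<lambda>j. X j \<omega>) (Suc k))"
    "Measurable.pred N (\<lambda>\<omega>. halted s a (\<lambda>j. X j \<omega>) (Suc k))"
    "(\<lambda>\<omega>. drawdown (\<lambda>j. X j \<omega>) (Suc k)) \<in> borel_measurable N"
    using Suc by (auto intro!: pred_drawdown_measurable drawdown_measurable simp del: drawdown.simps)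
  show ?case
    unfolding bet.simps by measurable
qed simp

text \<open>Measurability at time \<open>s\<close> moves \<open>W\<close> through the conditional
  expectation, nonnegativity keeps the direction of the supermartingale inequality, and boundedness
  keeps the products integrable.\<close>

lemma supermartingale_bet:
  assumes fps: "filtered_prob_space M F" and sup: "supermartingale M F X"
    and st: "0 \<le> s" "s \<le> t"
    and W: "W \<in> borel_measurable (F s)" "\<And>\<omega>. 0 \<le> W \<omega>" "\<And>\<omega>. W \<omega> \<le> c"
  shows "integrable M (\<lambda>\<omega>. W \<omega> * (X t \<omega> - X s \<omega>))"
    and "(\<integral>\<omega>. W \<omega> * (X t \<omega> - X s \<omega>) \<partial>M) \<le> 0"
proof -
  interpret prob_space M using fps by (simp add: filtered_prob_space_def)
  have sub: "subalgebra M (F s)" using fps st by (simp add: filtered_prob_space_def)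
  interpret S: finite_measure_subalgebra M "F s"
    by unfold_locales (rule sub)
  have iX: "integrable M (X r)" if "0 \<le> r" for r
    using sup that by (simp add: supermartingale_def)
  have [measurable]: "X s \<in> borel_measurable M" "X t \<in> borel_measurable M"
    using iX st by auto
  have WM[measurable]: "W \<in> borel_measurable M"
    by (rule measurable_from_subalg[OF sub W(1)])
  have iW: "integrable M (\<lambda>\<omega>. W \<omega> * Y \<omega>)" if Y: "integrable M Y" for Y
  proof (rule Bochner_Integration.integrable_bound[where f="\<lambda>\<omega>. c * Y \<omega>"])
    show "integrable M (\<lambda>\<omega>. c * Y \<omega>)" using Y by simp
    have "norm (W \<omega> * Y \<omega>) \<le> norm (c * Y \<omega>)" for \<omega>
      using W(2,3)[of \<omega>] by (auto simp: abs_mult intro!: mult_right_mono)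
    then show "AE \<omega> in M. norm (W \<omega> * Y \<omega>) \<le> norm (c * Y \<omega>)" by simp
    show "(\<lambda>\<omega>. W \<omega> * Y \<omega>) \<in> borel_measurable M" using Y by measurable
  qed
  note iWt = iW[OF iX[of t]] and iWs = iW[OF iX[of s]]
  show "integrable M (\<lambda>\<omega>. W \<omega> * (X t \<omega> - X s \<omega>))"
    using iWt iWs st by (simp add: right_diff_distrib)
  have "(\<integral>\<omega>. W \<omega> * X t \<omega> \<partial>M) = (\<integral>\<omega>. W \<omega> * real_cond_exp M (F s) (X t) \<omega> \<partial>M)"
    using iWt st W(1) by (intro S.real_cond_exp_intg(2)[symmetric]) auto
  also have "\<dots> \<le> (\<integral>\<omega>. W \<omega> * X s \<omega> \<partial>M)"
  proof (rule integral_mono_AE)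
    show "integrable M (\<lambda>\<omega>. W \<omega> * real_cond_exp M (F s) (X t) \<omega>)"
      using iWt st W(1) by (intro S.real_cond_exp_intg(1)) auto
    show "integrable M (\<lambda>\<omega>. W \<omega> * X s \<omega>)" using iWs st by simp
    have "AE \<omega> in M. real_cond_exp M (F s) (X t) \<omega> \<le> X s \<omega>"
      using sup st by (simp add: supermartingale_def)
    then show "AE \<omega> in M. W \<omega> * real_cond_exp M (F s) (X t) \<omega> \<le> W \<omega> * X s \<omega>"
      by eventually_elim (use W in \<open>auto intro!: mult_left_mono\<close>)
  qed
  finally show "(\<integral>\<omega>. W \<omega> * (X t \<omega> - X s \<omega>) \<partial>M) \<le> 0"
    using iWt iWs st by (simp add: right_diff_distrib)
qed

section \<open>Regularity of cadlag paths and countable grids\<close>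

lemma cadlag_nonneg_jump_drop:
  assumes f: "right_cont_left_lims f" and jump: "\<forall>t\<ge>0. jump f t \<ge> 0" and e: "0 < e"
  shows "\<exists>d>0. \<forall>u v. 0 \<le> u \<and> u \<le> v \<and> v \<le> t \<and> v - u < d \<longrightarrow> f u - f v < e"
proof -
  have right: "\<exists>d>0. \<forall>x. r \<le> x \<and> x < r + d \<longrightarrow> \<bar>f x - f r\<bar> < e / 2" if "0 \<le> r" for r
  proof -
    have "(f \<longlongrightarrow> f r) (at_right r)" using f that by (simp add: right_cont_left_lims_def)
    then have "eventually (\<lambda>x. dist (f x) (f r) < e / 2) (at_right r)"
      using e by (intro tendstoD) auto
    then obtain b where b: "b > r" "\<forall>y>r. y < b \<longrightarrow> dist (f y) (f r) < e / 2"
      by (auto simp: eventually_at_right_field)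
    then have "\<forall>x. r \<le> x \<and> x < r + (b - r) \<longrightarrow> \<bar>f x - f r\<bar> < e / 2"
      using e by (metis abs_zero add_diff_cancel_left' cancel_comm_monoid_add_class.diff_cancel
          diff_add_cancel dist_real_def half_gt_zero linorder_not_le nle_le)
    then show ?thesis using b(1) by (intro exI[of _ "b - r"]) auto
  qed
  have left: "\<exists>d>0. \<forall>x. r - d < x \<and> x < r \<longrightarrow> \<bar>f x - Lim (at_left r) f\<bar> < e / 2" if r: "0 < r" for r
  proof -
    obtain l where l: "(f \<longlongrightarrow> l) (at_left r)" using f r by (auto simp: right_cont_left_lims_def)
    then have L: "Lim (at_left r) f = l" by (intro tendsto_Lim) auto
    have "eventually (\<lambda>x. dist (f x) l < e / 2) (at_left r)"
      using e l by (intro tendstoD) auto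
    then obtain b where b: "b < r" "\<forall>y>b. y < r \<longrightarrow> dist (f y) l < e / 2"
      by (auto simp: eventually_at_left_field)
    then show ?thesis using L by (intro exI[of _ "r - b"]) (auto simp: dist_real_def)
  qed
  \<comment> \<open>Near \<open>r\<close> the values before \<open>r\<close> are
    \<open>e / 2\<close>-close to the left limit, and those from \<open>r\<close> on are
    \<open>e / 2\<close>-close to \<open>f r\<close>. Only a pair \<open>u < r \<le> v\<close>
    compares the two, and there the left limit is at most \<open>f r\<close>, so the drop stays
    below \<open>e\<close>. Large upward jumps do no harm because only \<open>f u - f v\<close> is
    estimated.\<close>
  have "\<exists>d>0. \<forall>u v. 0 \<le> u \<and> u \<le> v \<and> \<bar>u - r\<bar> < d \<and> \<bar>v - r\<bar> < d \<longrightarrow> f u - f v < e"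
    if r: "r \<in> {0..t}" for r
  proof -
    obtain d1 where d1: "d1 > 0" "\<And>x. r \<le> x \<Longrightarrow> x < r + d1 \<Longrightarrow> \<bar>f x - f r\<bar> < e / 2"
      using right[of r] r by auto
    show ?thesis
    proof (cases "r = 0")
      case True
      then show ?thesis using d1 by (intro exI[of _ d1]) (auto, smt (verit, best) field_sum_of_halves)
    next
      case False
      define l where "l = Lim (at_left r) f"
      obtain d2 where d2: "d2 > 0" "\<And>x. r - d2 < x \<Longrightarrow> x < r \<Longrightarrow> \<bar>f x - l\<bar> < e / 2"
        using left[of r] r False unfolding l_def by auto
      have lr: "l \<le> f r" using jump r False by (auto simp: jump_def l_def)
      have "f u - f v < e"
        if "0 \<le> u" "u \<le> v" "\<bar>u - r\<bar> < min d1 d2" "\<bar>v - r\<bar> < min d1 d2" for u v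
      proof (cases "u < r")
        case u: True
        then have fu: "\<bar>f u - l\<bar> < e / 2" using that by (intro d2(2)) auto
        show ?thesis
        proof (cases "v < r")
          case True
          then have "\<bar>f v - l\<bar> < e / 2" using that by (intro d2(2)) auto
          then show ?thesis using fu by (auto simp: abs_if split: if_splits)
        next
          case False
          then have "\<bar>f v - f r\<bar> < e / 2" using that by (intro d1(2)) auto
          then show ?thesis using fu lr by (auto simp: abs_if split: if_splits)
        qed
      next
        case False
        then have "\<bar>f u - f r\<bar> < e / 2" "\<bar>f v - f r\<bar> < e / 2"
          using that by (intro d1(2); linarith)+
        then show ?thesis by (auto simp: abs_if split: if_splits)
      qed
      then show ?thesis using d1(1) d2(1) by (intro exI[of _ "min d1 d2"]) auto
    qed
  qed
  then obtain d where d: "\<And>r. r \<in> {0..t} \<Longrightarrow> 0 < d r"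
    "\<And>r u v. r \<in> {0..t} \<Longrightarrow> 0 \<le> u \<Longrightarrow> u \<le> v \<Longrightarrow> \<bar>u - r\<bar> < d r \<Longrightarrow> \<bar>v - r\<bar> < d r \<Longrightarrow> f u - f v < e"
    by metis
  \<comment> \<open>A Lebesgue number of the cover by the local windows serves as the common window
    size.\<close>
  obtain \<delta> where \<delta>: "0 < \<delta>" "\<And>x. x \<in> {0..t} \<Longrightarrow> \<exists>B\<in>(\<lambda>r. ball r (d r)) ` {0..t}. ball x \<delta> \<subseteq> B"
  proof (rule Heine_Borel_lemma[of "{0..t}" "(\<lambda>r. ball r (d r)) ` {0..t}"])
    show "{0..t} \<subseteq> \<Union> ((\<lambda>r. ball r (d r)) ` {0..t})"
      using d(1) by force
  qed auto
  have "f u - f v < e" if "0 \<le> u" "u \<le> v" "v \<le> t" "v - u < \<delta>" for u v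
  proof -
    have "u \<in> {0..t}" using that by auto
    then obtain r where r: "r \<in> {0..t}" "ball u \<delta> \<subseteq> ball r (d r)"
      using \<delta>(2)[of u] by blast
    moreover have "u \<in> ball u \<delta>" "v \<in> ball u \<delta>" using that \<delta>(1) by (auto simp: dist_real_def)
    ultimately show ?thesis using that
      by (intro d(2)[of r u v]) (auto simp: dist_real_def subset_eq abs_minus_commute)
  qed
  then show ?thesis using \<delta>(1) by blast
qed

text \<open>One-sided limits bound the path near each point, on either side, and finitely many such
  neighbourhoods cover the interval. At \<open>0\<close> there is no left limit, but also no time of
  \<open>{0..}\<close> to the left.\<close>

lemma cadlag_bounded:
  assumes f: "right_cont_left_lims f"
  shows "bounded (f ` {0..t})"
proof -
  have "\<exists>U. open U \<and> r \<in> U \<and> bounded (f ` (U \<inter> {0..}))" if r: "r \<in> {0..t}" for r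
  proof -
    have "(f \<longlongrightarrow> f r) (at_right r)" using f r by (simp add: right_cont_left_lims_def)
    then have "eventually (\<lambda>x. dist (f x) (f r) < 1) (at_right r)"
      by (intro tendstoD) auto
    then obtain b where b: "b > r" "\<forall>y>r. y < b \<longrightarrow> dist (f y) (f r) < 1"
      by (auto simp: eventually_at_right_field)
    obtain c and l :: real where c: "c < r" "\<And>y. c < y \<Longrightarrow> y < r \<Longrightarrow> 0 \<le> y \<Longrightarrow> dist (f y) l < 1"
    proof (cases "r = 0")
      case True
      then show ?thesis using that[of "-1" 0] by auto
    next
      case False
      then obtain l where l: "(f \<longlongrightarrow> l) (at_left r)" using f r False
        unfolding right_cont_left_lims_def by (metis atLeastAtMost_iff order_le_less)
      then have "eventually (\<lambda>x. dist (f x) l < 1) (at_left r)" by (intro tendstoD) auto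
      then obtain c where "c < r" "\<forall>y>c. y < r \<longrightarrow> dist (f y) l < 1"
        by (auto simp: eventually_at_left_field)
      then show ?thesis using that[of c l] by auto
    qed
    have "f ` ({c<..<b} \<inter> {0..}) \<subseteq> ball (f r) 1 \<union> ball l 1"
    proof safe
      fix y assume "0 \<le> y" "y \<in> {c<..<b}" "f y \<notin> ball l 1"
      then have "r \<le> y" using c(2)[of y] by (force simp: dist_commute)
      then show "f y \<in> ball (f r) 1" using b(2) \<open>y \<in> {c<..<b}\<close> by (cases "y = r") (auto simp: dist_commute[of "f r"])
    qed
    then have "bounded (f ` ({c<..<b} \<inter> {0..}))"
      by (rule bounded_subset[rotated]) auto
    then show ?thesis using b c by (intro exI[of _ "{c<..<b}"]) auto
  qed
  then obtain U where U: "\<And>r. r \<in> {0..t} \<Longrightarrow> open (U r)" "\<And>r. r \<in> {0..t} \<Longrightarrow> r \<in> U r"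
    "\<And>r. r \<in> {0..t} \<Longrightarrow> bounded (f ` (U r \<inter> {0..}))"
    by metis
  obtain D where D: "D \<subseteq> {0..t}" "finite D" "{0..t} \<subseteq> (\<Union>r\<in>D. U r)"
  proof (rule compactE_image[of "{0..t}" "{0..t}" U])
    show "{0..t} \<subseteq> \<Union> (U ` {0..t})" using U(2) by blast
  qed (use U in auto)
  have "f ` {0..t} \<subseteq> (\<Union>r\<in>D. f ` (U r \<inter> {0..}))" using D(3) by force
  moreover have "bounded (\<Union>r\<in>D. f ` (U r \<inter> {0..}))"
    using D U by (intro bounded_UN) auto
  ultimately show ?thesis by (rule bounded_subset[rotated])
qed

text \<open>The witness is the first grid point at or after \<open>r\<close>: it lies within
  \<open>t / Suc n\<close> of \<open>r\<close> on the right, the only side that right-continuity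
  controls. The endpoint \<open>r = t\<close> is itself a grid point. The order relation to
  \<open>r\<close> is kept because hitting times have to look at grid points after a starting
  time.\<close>

lemma grid_hits_open_right:
  fixes f :: "real \<Rightarrow> real"
  assumes f: "\<forall>t\<ge>0. (f \<longlongrightarrow> f t) (at_right t)" and r: "r \<in> {0..t}" and U: "open U" "f r \<in> U"
  shows "eventually (\<lambda>n. \<exists>k\<le>Suc n. r \<le> t * real k / real (Suc n) \<and> f (t * real k / real (Suc n)) \<in> U) sequentially"
proof (cases "r = t")
  case True
  then show ?thesis
  proof (intro always_eventually allI)
    fix n show "\<exists>k\<le>Suc n. r \<le> t * real k / real (Suc n) \<and> f (t * real k / real (Suc n)) \<in> U"
      using U True by (intro exI[of _ "Suc n"]) (auto simp del: of_nat_Suc)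
  qed
next
  case False
  then have t: "0 < t" "r < t" using r by auto
  have "(f \<longlongrightarrow> f r) (at_right r)" using f r by auto
  then have "eventually (\<lambda>x. f x \<in> U) (at_right r)" using U by (rule topological_tendstoD)
  then obtain b where b: "b > r" "\<forall>y>r. y < b \<longrightarrow> f y \<in> U"
    by (auto simp: eventually_at_right_field)
  have "(\<lambda>n. t / real (Suc n)) \<longlonglongrightarrow> 0" by real_asymp
  then have "eventually (\<lambda>n. t / real (Suc n) < b - r) sequentially"
    using b by (intro order_tendstoD(2)) auto
  then show ?thesis
  proof eventually_elim
    case (elim n)
    define k where "k = nat \<lceil>r * Suc n / t\<rceil>"
    have k1: "r * Suc n / t \<le> k" unfolding k_def by linarith
    have "0 \<le> r * Suc n / t" using r t by auto
    then have k2: "real k < r * Suc n / t + 1" unfolding k_def by linarith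
    have "r * Suc n / t \<le> real (Suc n)"
      using t by (simp add: pos_divide_le_eq mult.commute[of _ t] mult_right_mono del: of_nat_Suc)
    then have "k \<le> Suc n" unfolding k_def by (simp add: nat_le_iff ceiling_le_iff)
    moreover have "r \<le> t * k / Suc n" using k1 t by (simp add: field_simps)
    moreover have "t * k / Suc n < b"
    proof -
      have "t * k / Suc n < t * (r * Suc n / t + 1) / Suc n"
        using k2 t by (intro divide_strict_right_mono mult_strict_left_mono) auto
      also have "\<dots> = (r * Suc n + t) / Suc n"
        using t by (simp add: distrib_left del: of_nat_Suc)
      also have "\<dots> = r + t / Suc n" by (simp add: add_divide_distrib del: of_nat_Suc)
      also have "\<dots> < b" using elim by simp
      finally show ?thesis .
    qed
    ultimately show ?case using b(2) U(2) by (cases "r = t * k / Suc n") (auto intro!: exI[of _ k])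
  qed
qed

lemma grid_hits_open:
  fixes f :: "real \<Rightarrow> real"
  assumes "\<forall>t\<ge>0. (f \<longlongrightarrow> f t) (at_right t)" "r \<in> {0..t}" "open U" "f r \<in> U"
  shows "eventually (\<lambda>n. \<exists>k\<le>Suc n. f (t * real k / real (Suc n)) \<in> U) sequentially"
  using grid_hits_open_right[OF assms] by (rule eventually_mono) blast

text \<open>A countable set on which right-continuous paths over \<open>{0..t}\<close> are
  determined. It has to contain \<open>t\<close> itself, since right-continuity does not recover the
  value at \<open>t\<close> from earlier times.\<close>

definition grid_points :: "real \<Rightarrow> real set" where
  "grid_points t = (\<Union>n. (\<lambda>k. t * real k / real (Suc n)) ` {..Suc n})"

lemma countable_grid_points: "countable (grid_points t)"
  unfolding grid_points_def by (intro countable_UN) (auto intro: countable_finite)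

lemma grid_points_subset: "0 \<le> t \<Longrightarrow> grid_points t \<subseteq> {0..t}"
  unfolding grid_points_def
  by (auto simp del: of_nat_Suc simp: divide_le_eq intro!: mult_left_mono)

lemma grid_points_nonempty: "grid_points t \<noteq> {}"
  unfolding grid_points_def by auto

lemma SUP_grid_points:
  fixes f :: "real \<Rightarrow> real"
  assumes f: "\<forall>t\<ge>0. (f \<longlongrightarrow> f t) (at_right t)" and t: "0 \<le> t" and bdd: "bdd_above (f ` {0..t})"
  shows "(SUP r\<in>{0..t}. f r) = (SUP r\<in>grid_points t. f r)"
proof (rule antisym)
  have bdd': "bdd_above (f ` grid_points t)"
    using bdd_above_mono[OF bdd image_mono[OF grid_points_subset[OF t]]] .
  show "(SUP r\<in>{0..t}. f r) \<le> (SUP r\<in>grid_points t. f r)"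
  proof (rule cSUP_least)
    fix r assume r: "r \<in> {0..t}"
    show "f r \<le> (SUP r\<in>grid_points t. f r)"
    proof (rule ccontr)
      assume "\<not> ?thesis"
      then have "f r \<in> {(SUP r\<in>grid_points t. f r)<..}" by auto
      from grid_hits_open[OF f r _ this]
      obtain n k where "k \<le> Suc n" and *: "(SUP r\<in>grid_points t. f r) < f (t * real k / real (Suc n))"
        by (auto simp del: of_nat_Suc simp: eventually_sequentially)
      then have "t * real k / real (Suc n) \<in> grid_points t" unfolding grid_points_def by blast
      from cSUP_upper[OF this bdd'] * show False by simp
    qed
  qed (use t in auto)
  show "(SUP r\<in>grid_points t. f r) \<le> (SUP r\<in>{0..t}. f r)"
    using grid_points_nonempty grid_points_subset[OF t] bdd
    by (intro cSUP_subset_mono) auto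
qed

lemma cadlag_bdd:
  assumes "right_cont_left_lims f"
  shows "bdd_above (f ` {0..t})" "bdd_below (f ` {0..t})" "bdd_above ((\<lambda>r. \<bar>f r\<bar>) ` {0..t})"
    "bdd_above ((\<lambda>r. - f r) ` {0..t})"
proof -
  obtain K where K: "\<And>r. r \<in> {0..t} \<Longrightarrow> \<bar>f r\<bar> \<le> K"
    using cadlag_bounded[OF assms, of t] that unfolding bounded_iff by (metis image_eqI real_norm_def)
  show "bdd_above (f ` {0..t})" "bdd_below (f ` {0..t})" "bdd_above ((\<lambda>r. \<bar>f r\<bar>) ` {0..t})"
    "bdd_above ((\<lambda>r. - f r) ` {0..t})"
    using K by (auto intro!: bdd_aboveI2[of _ _ K] bdd_belowI2[of _ "-K"] simp: abs_le_iff)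
       (smt (verit) atLeastAtMost_iff)+
qed

lemma INF_uminus_real:
  fixes f :: "'b \<Rightarrow> real"
  shows "(INF r\<in>A. f r) = - (SUP r\<in>A. - f r)"
  by (simp add: Inf_real_def image_image)

lemma max_process_grid:
  assumes f: "right_cont_left_lims (\<lambda>t. X t \<omega>)" and t: "0 \<le> t"
  shows "max_process X t \<omega> = (SUP r\<in>grid_points t. \<bar>X r \<omega>\<bar>)"
  unfolding max_process_def
  using f t by (intro SUP_grid_points cadlag_bdd)
    (auto simp: right_cont_left_lims_def intro!: tendsto_rabs)

lemma inf_process_grid:
  assumes f: "right_cont_left_lims (\<lambda>t. X t \<omega>)" and t: "0 \<le> t"
  shows "inf_process X t \<omega> = min (- (SUP r\<in>grid_points t. - X r \<omega>)) 0"
  unfolding inf_process_def INF_uminus_real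
  using f t by (subst SUP_grid_points)
    (auto simp: right_cont_left_lims_def intro!: tendsto_minus cadlag_bdd)

lemma max_inf_process_measurable:
  assumes X: "\<And>r. 0 \<le> r \<Longrightarrow> X r \<in> borel_measurable M"
    and f: "\<And>\<omega>. \<omega> \<in> space M \<Longrightarrow> right_cont_left_lims (\<lambda>t. X t \<omega>)" and t: "0 \<le> t"
  shows "max_process X t \<in> borel_measurable M" "inf_process X t \<in> borel_measurable M"
proof -
  have sub: "r \<in> grid_points t \<Longrightarrow> 0 \<le> r" for r using grid_points_subset[OF t] by auto
  have bdd: "bdd_above ((\<lambda>r. \<bar>X r \<omega>\<bar>) ` grid_points t)" "bdd_above ((\<lambda>r. - X r \<omega>) ` grid_points t)"
    if "\<omega> \<in> space M" for \<omega>
    using bdd_above_mono[OF cadlag_bdd(3)[OF f[OF that]] image_mono[OF grid_points_subset[OF t]]]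
      bdd_above_mono[OF cadlag_bdd(4)[OF f[OF that]] image_mono[OF grid_points_subset[OF t]]] by auto
  have "(\<lambda>\<omega>. SUP r\<in>grid_points t. \<bar>X r \<omega>\<bar>) \<in> borel_measurable M"
    using X sub bdd by (intro borel_measurable_cSUP countable_grid_points borel_measurable_abs) auto
  then show "max_process X t \<in> borel_measurable M"
    by (rule measurable_cong[THEN iffD2, rotated]) (simp add: max_process_grid f t)
  have "(\<lambda>\<omega>. SUP r\<in>grid_points t. - X r \<omega>) \<in> borel_measurable M"
    using X sub bdd by (intro borel_measurable_cSUP countable_grid_points borel_measurable_uminus) auto
  then have "(\<lambda>\<omega>. min (- (SUP r\<in>grid_points t. - X r \<omega>)) 0) \<in> borel_measurable M"
    by measurable
  then show "inf_process X t \<in> borel_measurable M"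
    by (rule measurable_cong[THEN iffD2, rotated]) (simp add: inf_process_grid f t)
qed

lemma process_bounds:
  assumes f: "right_cont_left_lims (\<lambda>t. X t \<omega>)" and r: "r \<in> {0..t}"
  shows "inf_process X t \<omega> \<le> X r \<omega>" "inf_process X t \<omega> \<le> 0" "\<bar>X r \<omega>\<bar> \<le> max_process X t \<omega>"
    "0 \<le> max_process X t \<omega>"
proof -
  show "inf_process X t \<omega> \<le> X r \<omega>"
    unfolding inf_process_def by (rule min.coboundedI1, rule cINF_lower[OF cadlag_bdd(2)[OF f] r])
  show "\<bar>X r \<omega>\<bar> \<le> max_process X t \<omega>"
    unfolding max_process_def by (rule cSUP_upper[OF r cadlag_bdd(3)[OF f]])
  then show "0 \<le> max_process X t \<omega>" by linarith
qed (simp add: inf_process_def)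

lemma max_process_exceeds:
  assumes f: "right_cont_left_lims (\<lambda>t. X t \<omega>)" and t: "0 \<le> t" and s: "s < max_process X t \<omega>"
  shows "\<exists>r\<in>{0..t}. s < \<bar>X r \<omega>\<bar>"
  using s t unfolding max_process_def
  by (subst (asm) less_cSUP_iff) (auto intro!: cadlag_bdd f)

text \<open>Along refining grids the drawdown steps tend to \<open>0\<close> because the paths have no negative jumps, so the
  event \<open>overshoot\<close> disappears in the limit; the condition \<open>a \<le> s\<close> identifies large values of \<open>\<bar>X\<bar>\<close> with
  large values of \<open>X\<close>.\<close>

lemma prob_max_exceeds_le:
  fixes M :: "'a measure"
  assumes adm: "admissible_process M F X" and t: "0 \<le> t" and s: "0 < s" and a: "0 \<le> a" "a \<le> s"
  shows "measure M {\<omega>\<in>space M. s < max_process X t \<omega> \<and> - inf_process X t \<omega> \<le> a}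
    \<le> (\<integral>\<omega>. ln (1 + min (- inf_process X t \<omega>) a / s) \<partial>M)"
proof -
  note adm' = adm[unfolded admissible_process_def]
  have fps: "filtered_prob_space M F" and sup: "supermartingale M F X" using adm' by auto
  interpret prob_space M using fps by (simp add: filtered_prob_space_def)
  have cad: "right_cont_left_lims (\<lambda>t. X t \<omega>)" if "\<omega> \<in> space M" for \<omega> using adm' that by auto
  have iX: "integrable M (X r)" if "0 \<le> r" for r
    using sup that by (simp add: supermartingale_def)
  then have X[measurable]: "X r \<in> borel_measurable M" if "0 \<le> r" for r using that by auto
  have mm[measurable]: "max_process X t \<in> borel_measurable M" "inf_process X t \<in> borel_measurable M"
    using max_inf_process_measurable[of X M t] X cad t by auto
  define m where "m \<omega> = - inf_process X t \<omega>" for \<omega>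
  have m[measurable]: "m \<in> borel_measurable M" unfolding m_def by measurable
  have m0: "0 \<le> m \<omega>" for \<omega> by (simp add: m_def inf_process_def)
  define E where "E = {\<omega>\<in>space M. s < max_process X t \<omega> \<and> m \<omega> \<le> a}"
  have E[measurable]: "E \<in> sets M" unfolding E_def by measurable
  define T where "T n k = t * real k / real (Suc n)" for n k
  have T0: "0 \<le> T n k" for n k using t by (simp add: T_def)
  have Tmono: "T n k \<le> T n (Suc k)" for n k unfolding T_def
    using t by (intro divide_right_mono mult_left_mono) auto
  have Tt: "T n k \<le> t" if "k \<le> Suc n" for n k
    using t that unfolding T_def by (simp add: divide_le_eq mult_left_mono del: of_nat_Suc)
  define x where "x n \<omega> k = X (T n k) \<omega>" for n \<omega> k
  have xm: "(\<lambda>\<omega>. x n \<omega> k) \<in> borel_measurable M" for n k unfolding x_def using T0 by auto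
  have dd_le: "drawdown (x n \<omega>) k \<le> m \<omega>" if "\<omega> \<in> space M" "k \<le> Suc n" for \<omega> n k
  proof -
    have "- X (T n j) \<omega> \<le> m \<omega>" if "j \<le> Suc n" for j
      unfolding m_def using process_bounds(1)[of X \<omega> "T n j" t] cad T0 Tt that \<open>\<omega> \<in> space M\<close> by auto
    then show ?thesis using drawdown_eq[of "x n \<omega>" k] that m0[of \<omega>] by (auto simp: x_def)
  qed
  have X0: "AE \<omega> in M. X 0 \<omega> = 0" and J: "AE \<omega> in M. \<forall>t\<ge>0. jump (\<lambda>t. X t \<omega>) t \<ge> 0"
    using adm' by auto
  have bound: "measure M E \<le> (1 + \<delta> / s) * ((\<integral>\<omega>. ln (1 + min (m \<omega>) a / s) \<partial>M) + \<delta> / s)"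
    if \<delta>: "0 < \<delta>" for \<delta>
  proof -
    define ov where "ov n \<omega> \<longleftrightarrow> overshoot \<delta> (x n \<omega>) (Suc n)" for n \<omega>
    define hit where "hit n \<omega> \<longleftrightarrow> (\<exists>j\<le>Suc n. s \<le> x n \<omega> j) \<and> drawdown (x n \<omega>) (Suc n) \<le> a \<and> \<not> ov n \<omega>"
      for n \<omega>
    have [measurable]: "Measurable.pred M (ov n)" for n
      unfolding ov_def using pred_drawdown_measurable(1)[where k="Suc n" and X="\<lambda>j \<omega>. x n \<omega> j" and N=M] xm by simp
    have [measurable]: "(\<lambda>\<omega>. drawdown (x n \<omega>) (Suc n)) \<in> borel_measurable M" for n
      using drawdown_measurable[where k="Suc n" and X="\<lambda>j \<omega>. x n \<omega> j" and N=M] xm by simp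
    have [measurable]: "Measurable.pred M (hit n)" for n
      unfolding hit_def using xm by measurable
    define l where "l \<omega> = (1 + \<delta> / s) * (ln (1 + min (m \<omega>) a / s) + \<delta> / s)" for \<omega>
    have lm[measurable]: "l \<in> borel_measurable M" unfolding l_def by measurable
    have ln_bd: "0 \<le> ln (1 + min (m \<omega>) a / s)" "ln (1 + min (m \<omega>) a / s) \<le> a / s" for \<omega>
    proof -
      show "0 \<le> ln (1 + min (m \<omega>) a / s)" using m0[of \<omega>] a s by auto
      have "ln (1 + min (m \<omega>) a / s) \<le> min (m \<omega>) a / s"
        using m0[of \<omega>] a s by (intro ln_add_one_self_le_self) auto
      also have "\<dots> \<le> a / s" using s by (intro divide_right_mono) auto
      finally show "ln (1 + min (m \<omega>) a / s) \<le> a / s" .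
    qed
    have int_ln: "integrable M (\<lambda>\<omega>. ln (1 + min (m \<omega>) a / s))"
      by (rule integrable_const_bound[where B="a / s"]) (use ln_bd in auto)
    then have int_l: "integrable M l" unfolding l_def by auto
    \<comment> \<open>The integrand is a lower bound of the gain of the betting system along the
      \<open>n\<close>-th grid, whose expectation is nonpositive.\<close>
    have gain: "(\<integral>\<omega>. of_bool (hit n \<omega>) - l \<omega> - of_bool (ov n \<omega>) * (max 0 (- X t \<omega>) / s) \<partial>M) \<le> 0"
      (is "(\<integral>\<omega>. ?V n \<omega> \<partial>M) \<le> 0") for n
    proof -
      define G where "G \<omega> = (\<Sum>k<Suc n. bet s a \<delta> (x n \<omega>) k * (X (T n (Suc k)) \<omega> - X (T n k) \<omega>))" for \<omega>
      have W: "(\<lambda>\<omega>. bet s a \<delta> (x n \<omega>) k) \<in> borel_measurable (F (T n k))" for k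
      proof -
        have "(\<lambda>\<omega>. x n \<omega> j) \<in> borel_measurable (F (T n k))" if "j \<le> k" for j
        proof -
          have le: "T n j \<le> T n k" using that t unfolding T_def
            by (intro divide_right_mono mult_left_mono) auto
          have "X (T n j) \<in> borel_measurable (F (T n j))"
            using sup T0 by (simp add: supermartingale_def adapted_def)
          moreover have "subalgebra (F (T n k)) (F (T n j))"
            using fps T0[of n j] T0[of n k] le by (auto simp: filtered_prob_space_def subalgebra_def)
          ultimately show ?thesis unfolding x_def by (rule measurable_from_subalg[rotated])
        qed
        then show ?thesis using bet_measurable[where k=k and X="\<lambda>j \<omega>. x n \<omega> j" and N="F (T n k)" and s=s and a=a and \<delta>=\<delta>] by simp
      qed
      note sb = supermartingale_bet[OF fps sup T0 Tmono W bet_bounds(1)[OF s] bet_bounds(2)[OF s]]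
      have "integrable M G" "(\<integral>\<omega>. G \<omega> \<partial>M) \<le> 0"
        unfolding G_def using sb by (auto intro!: sum_nonpos simp del: sum.lessThan_Suc)
      moreover have "(\<integral>\<omega>. ?V n \<omega> \<partial>M) \<le> (\<integral>\<omega>. G \<omega> \<partial>M)"
      proof (rule integral_mono_AE)
        have "integrable M (\<lambda>\<omega>. of_bool (hit n \<omega>) :: real)"
          by (rule integrable_const_bound[where B=1]) auto
        moreover have "integrable M (\<lambda>\<omega>. of_bool (ov n \<omega>) * (max 0 (- X t \<omega>) / s))"
          by (rule Bochner_Integration.integrable_bound[where f="\<lambda>\<omega>. X t \<omega> / s"])
             (use iX t s in \<open>auto simp: divide_right_mono\<close>)
        ultimately show "integrable M (?V n)" using int_l by auto
        show "AE \<omega> in M. ?V n \<omega> \<le> G \<omega>"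
          using X0 AE_space
        proof eventually_elim
          case (elim \<omega>)
          have x0: "x n \<omega> 0 = 0" using elim by (simp add: x_def T_def)
          have xt: "x n \<omega> (Suc n) = X t \<omega>" by (simp add: x_def T_def del: of_nat_Suc)
          have Gx: "G \<omega> = (\<Sum>k<Suc n. bet s a \<delta> (x n \<omega>) k * (x n \<omega> (Suc k) - x n \<omega> k))"
            by (simp add: G_def x_def)
          have "(1 + \<delta> / s) * (ln (1 + min (drawdown (x n \<omega>) (Suc n)) a / s) + \<delta> / s) \<le> l \<omega>"
            unfolding l_def using dd_le[of \<omega> "Suc n" n] elim drawdown_nonneg[of "x n \<omega>" "Suc n"] s a \<delta>
            by (intro mult_left_mono add_right_mono ln_mono add_left_mono divide_right_mono min.mono)
               (auto intro!: add_pos_nonneg simp del: drawdown.simps)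
          with bet_gain[of "x n \<omega>" s a \<delta> "Suc n", OF x0 s a(1) \<delta>] show ?case
            unfolding Gx[symmetric] xt hit_def ov_def by (auto split: if_splits simp del: drawdown.simps)
        qed
      qed fact
      ultimately show ?thesis by simp
    qed
    \<comment> \<open>Error of the \<open>n\<close>-th grid: the exceedance may be missed, or an
      overshoot may have frozen the bet. The error involves the path only through its terminal
      value, is dominated by \<open>1 + \<bar>X t \<omega>\<bar> / s\<close>, and vanishes
      eventually on almost every path.\<close>
    define R where "R n \<omega> = indicator E \<omega> * of_bool (\<not> hit n \<omega>) + of_bool (ov n \<omega>) * (max 0 (- X t \<omega>) / s)"
      for n \<omega>
    have Rm[measurable]: "R n \<in> borel_measurable M" for n unfolding R_def using t by measurable
    have R_bd: "norm (R n \<omega>) \<le> 1 + \<bar>X t \<omega>\<bar> / s" for n \<omega>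
      unfolding R_def using s by (auto simp: indicator_def divide_right_mono intro!: add_mono)
         (smt (verit) divide_nonneg_pos divide_right_mono)+
    have lim: "(\<lambda>n. \<integral>\<omega>. R n \<omega> \<partial>M) \<longlonglongrightarrow> (\<integral>\<omega>. 0 \<partial>M)"
    proof (rule integral_dominated_convergence[where w="\<lambda>\<omega>. 1 + \<bar>X t \<omega>\<bar> / s"])
      show "integrable M (\<lambda>\<omega>. 1 + \<bar>X t \<omega>\<bar> / s)" using iX t by auto
      show "AE \<omega> in M. (\<lambda>n. R n \<omega>) \<longlonglongrightarrow> 0"
        using J AE_space X0
      proof eventually_elim
        case (elim \<omega>)
        have rc: "\<forall>t\<ge>0. ((\<lambda>t. X t \<omega>) \<longlongrightarrow> X t \<omega>) (at_right t)"
          using cad elim by (auto simp: right_cont_left_lims_def)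
        obtain d where d: "d > 0"
          "\<And>u v. 0 \<le> u \<Longrightarrow> u \<le> v \<Longrightarrow> v \<le> t \<Longrightarrow> v - u < d \<Longrightarrow> X u \<omega> - X v \<omega> < \<delta>"
          using cadlag_nonneg_jump_drop[OF cad, of \<omega> \<delta> t] elim \<delta> by blast
        have "(\<lambda>n. t / real (Suc n)) \<longlonglongrightarrow> 0" by real_asymp
        then have ev: "eventually (\<lambda>n. t / real (Suc n) < d) sequentially"
          using d by (intro order_tendstoD(2)) auto
        have ev1: "eventually (\<lambda>n. \<not> ov n \<omega>) sequentially"
          using ev
        proof eventually_elim
          case (elim n)
          have "drawdown (x n \<omega>) (Suc j) - drawdown (x n \<omega>) j \<le> \<delta>" if j: "j < Suc n" for j
          proof -
            have "T n (Suc j) - T n j = t / Suc n" unfolding T_def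
              by (simp add: diff_divide_distrib[symmetric] algebra_simps del: of_nat_Suc) (simp add: algebra_simps)
            then have "X (T n j) \<omega> - X (T n (Suc j)) \<omega> < \<delta>"
              using elim j Tt[of "Suc j" n] by (intro d(2) T0 Tmono) auto
            moreover have "- x n \<omega> j \<le> drawdown (x n \<omega>) j"
              using \<open>X 0 \<omega> = 0\<close> by (intro drawdown_ge) (simp add: x_def T_def)
            ultimately show ?thesis using \<delta> by (auto simp: x_def)
          qed
          then show ?case unfolding ov_def overshoot_def by (meson not_less)
        qed
        have ev2: "eventually (\<lambda>n. \<omega> \<in> E \<longrightarrow> hit n \<omega>) sequentially"
        proof (cases "\<omega> \<in> E")
          case True
          then have "s < max_process X t \<omega>" "m \<omega> \<le> a" by (auto simp: E_def)
          from max_process_exceeds[of X \<omega> t s] cad t this(1) elim obtain r where r: "r \<in> {0..t}" "s < \<bar>X r \<omega>\<bar>" by auto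
          have "- X r \<omega> \<le> m \<omega>" unfolding m_def using process_bounds(1)[of X \<omega> r t] cad r(1) elim by auto
          then have "X r \<omega> \<in> {s<..}" using r(2) \<open>m \<omega> \<le> a\<close> a by auto
          from grid_hits_open[OF rc r(1) _ this]
          have "eventually (\<lambda>n. \<exists>k\<le>Suc n. s < x n \<omega> k) sequentially" by (simp add: x_def T_def)
          with ev1 show ?thesis
          proof eventually_elim
            case (elim n)
            then show ?case unfolding hit_def
              using dd_le[of \<omega> "Suc n" n] \<open>m \<omega> \<le> a\<close> \<open>\<omega> \<in> space M\<close> by (auto intro: less_imp_le)
          qed
        qed auto
        have "eventually (\<lambda>n. R n \<omega> = 0) sequentially"
          using ev1 ev2 by eventually_elim (auto simp: R_def indicator_def)
        then show ?case by (rule tendsto_eventually)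
      qed
    qed (use R_bd in auto)
    have "measure M E \<le> (\<integral>\<omega>. l \<omega> \<partial>M) + (\<integral>\<omega>. R n \<omega> \<partial>M)" for n
    proof -
      have iR: "integrable M (R n)"
        by (rule Bochner_Integration.integrable_bound[where f="\<lambda>\<omega>. 1 + \<bar>X t \<omega>\<bar> / s"])
           (use R_bd iX t s in \<open>auto intro!: AE_I2 order.trans[OF R_bd]\<close>)
      have i2: "integrable M (\<lambda>\<omega>. of_bool (ov n \<omega>) * (max 0 (- X t \<omega>) / s))"
          by (rule Bochner_Integration.integrable_bound[where f="\<lambda>\<omega>. X t \<omega> / s"])
             (use iX t s in \<open>auto simp: divide_right_mono\<close>)
      have i3: "integrable M (\<lambda>\<omega>. of_bool (hit n \<omega>) :: real)"
          by (rule integrable_const_bound[where B=1]) auto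
      have iE: "integrable M (indicator E :: 'a \<Rightarrow> real)"
        by (rule integrable_const_bound[where B=1]) auto
      have "measure M E - (\<integral>\<omega>. R n \<omega> \<partial>M) - (\<integral>\<omega>. l \<omega> \<partial>M) = (\<integral>\<omega>. indicator E \<omega> - R n \<omega> - l \<omega> \<partial>M)"
        using iR int_l iE by simp
      also have "\<dots> \<le> (\<integral>\<omega>. of_bool (hit n \<omega>) - l \<omega> - of_bool (ov n \<omega>) * (max 0 (- X t \<omega>) / s) \<partial>M)"
      proof (rule integral_mono)
        show "indicator E \<omega> - R n \<omega> - l \<omega> \<le> of_bool (hit n \<omega>) - l \<omega> - of_bool (ov n \<omega>) * (max 0 (- X t \<omega>) / s)" for \<omega>
          by (auto simp: R_def indicator_def)
      qed (use iR int_l i2 i3 iE in auto)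
      also have "\<dots> \<le> 0" by (rule gain)
      finally show ?thesis by simp
    qed
    then have "measure M E \<le> (\<integral>\<omega>. l \<omega> \<partial>M) + (\<integral>\<omega>. 0 \<partial>M)"
      by (intro LIMSEQ_le_const[OF tendsto_add[OF tendsto_const lim]]) blast
    also have "(\<integral>\<omega>. l \<omega> \<partial>M) = (1 + \<delta> / s) * ((\<integral>\<omega>. ln (1 + min (m \<omega>) a / s) \<partial>M) + \<delta> / s)"
      unfolding l_def using int_ln by (simp add: prob_space)
    finally show ?thesis by simp
  qed
  \<comment> \<open>The grid has been refined away; only the tolerance \<open>\<delta>\<close> is
    left, and it is sent to \<open>0\<close> along \<open>1 / Suc n\<close>.\<close>
  define I where "I = (\<integral>\<omega>. ln (1 + min (m \<omega>) a / s) \<partial>M)"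
  have "(\<lambda>n. (1 + 1 / real (Suc n) / s) * (I + 1 / real (Suc n) / s)) \<longlonglongrightarrow> (1 + 0 / s) * (I + 0 / s)"
    using LIMSEQ_inverse_real_of_nat s
    by (intro tendsto_intros) (auto simp: inverse_eq_divide)
  then have "measure M E \<le> (1 + 0 / s) * (I + 0 / s)"
  proof (rule LIMSEQ_le_const, intro exI allI impI)
    fix n
    show "measure M E \<le> (1 + 1 / real (Suc n) / s) * (I + 1 / real (Suc n) / s)"
      unfolding I_def by (rule bound) simp
  qed
  then show ?thesis unfolding E_def I_def m_def by simp
qed

section \<open>Layer-cake integrals and the moment bound\<close>

lemma nn_integral_powr_from_0:
  fixes p v :: real
  assumes p: "0 < p" and v: "0 \<le> v"
  shows "(\<integral>\<^sup>+ s. ennreal (p * s powr (p - 1)) * indicator {0..v} s \<partial>lborel) = ennreal (v powr p)"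
proof -
  have "((\<lambda>x. x powr (p - 1)) has_integral (v powr (p - 1 + 1) / (p - 1 + 1))) {0..v}"
    using p v by (intro has_integral_powr_from_0) auto
  then have "((\<lambda>x. p * x powr (p - 1)) has_integral (p * (v powr p / p))) {0..v}"
    by (intro has_integral_mult_right) simp
  then have "((\<lambda>x. p * x powr (p - 1)) has_integral (v powr p)) {0..v}"
    using p by simp
  then show ?thesis
    using p by (intro nn_integral_has_integral_lebesgue') auto
qed

lemma nn_integral_powr_layer:
  fixes p y v :: real
  assumes p: "0 < p" and v: "0 \<le> y" "y \<le> v"
  shows "ennreal (v powr p)
    = ennreal (y powr p) + (\<integral>\<^sup>+ s. ennreal (p * s powr (p - 1)) * indicator {y..<v} s \<partial>lborel)"
proof -
  have AE: "AE s in lborel. s \<noteq> v \<and> s \<noteq> y"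
    using AE_lborel_singleton[of v] AE_lborel_singleton[of y] by eventually_elim auto
  have "ennreal (v powr p) = (\<integral>\<^sup>+ s. ennreal (p * s powr (p - 1)) * indicator {0..v} s \<partial>lborel)"
    using p v by (simp add: nn_integral_powr_from_0)
  also have "\<dots> = (\<integral>\<^sup>+ s. ennreal (p * s powr (p - 1)) * indicator {0..y} s
      + ennreal (p * s powr (p - 1)) * indicator {y..<v} s \<partial>lborel)"
    using v by (intro nn_integral_cong_AE eventually_mono[OF AE]) (auto simp: indicator_def)
  also have "\<dots> = (\<integral>\<^sup>+ s. ennreal (p * s powr (p - 1)) * indicator {0..y} s \<partial>lborel)
      + (\<integral>\<^sup>+ s. ennreal (p * s powr (p - 1)) * indicator {y..<v} s \<partial>lborel)"
    by (intro nn_integral_add) auto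
  finally show ?thesis using p v by (simp add: nn_integral_powr_from_0)
qed

definition tail_integral :: "real \<Rightarrow> real \<Rightarrow> real" where
  "tail_integral p k = (LBINT s:{k..}. s powr (p - 1) / (s + 1))"

text \<open>The comparison function is \<open>s powr (p - 2)\<close>, integrable at infinity because
  \<open>p < 1\<close>. The nonnegative integral is the form used with Fubini and scaling, the real
  one appears in the constant.\<close>

lemma tail_integral:
  fixes p k :: real
  assumes p: "p < 1" and k: "0 < k"
  shows "(\<integral>\<^sup>+ s. ennreal (s powr (p - 1) / (s + 1)) * indicator {k..} s \<partial>lborel) = ennreal (tail_integral p k)"
    and "0 \<le> tail_integral p k"
proof -
  have "((\<lambda>x. x powr (p - 2)) has_integral -(k powr (p - 2 + 1)) / (p - 2 + 1)) {k..}"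
    using p k by (intro has_integral_powr_to_inf) auto
  then have "(\<integral>\<^sup>+ s. ennreal (indicator {k..} s * s powr (p - 2)) \<partial>lborel) < \<infinity>"
    by (subst nn_integral_has_integral_lebesgue) auto
  then have "integrable lborel (\<lambda>s. indicator {k..} s * s powr (p - 2))"
    by (intro integrableI_nonneg) auto
  then have int: "integrable lborel (\<lambda>s. indicator {k..} s * (s powr (p - 1) / (s + 1)))"
  proof (rule Bochner_Integration.integrable_bound)
    show "AE s in lborel. norm (indicator {k..} s * (s powr (p - 1) / (s + 1)))
        \<le> norm (indicator {k..} s * s powr (p - 2))"
    proof (rule AE_I2)
      fix s :: real
      have "s powr (p - 1) / (s + 1) \<le> s powr (p - 2)" if "k \<le> s"
      proof -
        have "s powr (p - 1) = s powr (p - 2) * s"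
          using that k powr_add[of s "p - 2" 1] by simp
        also have "\<dots> \<le> s powr (p - 2) * (s + 1)" by (intro mult_left_mono) auto
        finally show ?thesis using that k by (simp add: pos_divide_le_eq)
      qed
      then show "norm (indicator {k..} s * (s powr (p - 1) / (s + 1)))
        \<le> norm (indicator {k..} s * s powr (p - 2))"
        using k by (auto simp: indicator_def)
    qed
  qed auto
  show "0 \<le> tail_integral p k"
    unfolding tail_integral_def set_lebesgue_integral_def
    using k by (intro integral_nonneg_AE AE_I2) (auto simp: indicator_def)
  have "(\<integral>\<^sup>+ s. ennreal (indicator {k..} s * (s powr (p - 1) / (s + 1))) \<partial>lborel) = ennreal (tail_integral p k)"
    unfolding tail_integral_def set_lebesgue_integral_def real_scaleR_def
    using int k by (intro nn_integral_eq_integral AE_I2) (auto simp: indicator_def)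
  moreover have "ennreal (indicator {k..} s * (s powr (p - 1) / (s + 1)))
      = ennreal (s powr (p - 1) / (s + 1)) * indicator {k..} s" for s
    by (auto simp: indicator_def)
  ultimately show "(\<integral>\<^sup>+ s. ennreal (s powr (p - 1) / (s + 1)) * indicator {k..} s \<partial>lborel)
      = ennreal (tail_integral p k)" by simp
qed

lemma ln_as_nn_integral:
  fixes s y :: real
  assumes "0 < s" "0 \<le> y"
  shows "ennreal (ln (1 + y / s)) = (\<integral>\<^sup>+ v. ennreal (1 / (v + s)) * indicator {0..y} v \<partial>lborel)"
proof -
  have "(\<integral>\<^sup>+ v. ennreal (1 / (v + s)) * indicator {0..y} v \<partial>lborel) = ennreal (ln (y + s) - ln (0 + s))"
    using assms by (intro nn_integral_FTC_Icc) (auto intro!: derivative_eq_intros simp: field_simps)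
  also have "ln (y + s) - ln (0 + s) = ln ((y + s) / s)"
    using assms by (simp add: ln_div)
  also have "(y + s) / s = 1 + y / s" using assms by (simp add: field_simps)
  finally show ?thesis by simp
qed

text \<open>Writing the logarithm as an integral and exchanging the order of integration leaves, after the
  substitution \<open>s = v * u\<close>, the tail integral.\<close>

lemma nn_integral_ln_tail:
  fixes p k m :: real
  assumes p: "0 < p" "p < 1" and k: "1 \<le> k" and m: "0 \<le> m"
  shows "(\<integral>\<^sup>+ s. ennreal (p * s powr (p - 1)) * (indicator {0<..} s * ennreal (ln (1 + min m (s / k) / s))) \<partial>lborel)
    = ennreal (tail_integral p k) * ennreal (m powr p)"
proof -
  \<comment> \<open>The cap \<open>s / k\<close> in the logarithm becomes the condition
    \<open>k * v \<le> s\<close>. For fixed \<open>s\<close> it limits \<open>v\<close> from above,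
    for fixed \<open>v\<close> it limits \<open>s\<close> from below; in units of \<open>v\<close>
    the latter is the ray \<open>{k..}\<close>.\<close>
  define h where "h v s = ennreal (p * s powr (p - 1)) * ennreal (1 / (v + s)) *
      (indicator {0..m} v * (indicator {0<..} s * (if k * v \<le> s then 1 else 0)))" for v s :: real
  have hm: "(\<lambda>(v, s). h v s) \<in> borel_measurable (lborel \<Otimes>\<^sub>M lborel)"
    unfolding h_def by measurable
  have "(\<integral>\<^sup>+ s. ennreal (p * s powr (p - 1)) * (indicator {0<..} s * ennreal (ln (1 + min m (s / k) / s))) \<partial>lborel)
      = (\<integral>\<^sup>+ s. (\<integral>\<^sup>+ v. h v s \<partial>lborel) \<partial>lborel)"
  proof (rule nn_integral_cong)
    fix s :: real
    show "ennreal (p * s powr (p - 1)) * (indicator {0<..} s * ennreal (ln (1 + min m (s / k) / s)))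
        = (\<integral>\<^sup>+ v. h v s \<partial>lborel)"
    proof (cases "0 < s")
      case True
      have "indicator {0..min m (s / k)} v = (indicator {0..m} v * (if k * v \<le> s then 1 else 0) :: ennreal)" for v
        using k by (auto simp: indicator_def field_simps)
      then show ?thesis
        using True k m
        by (subst ln_as_nn_integral) (auto simp: h_def nn_integral_cmult[symmetric] mult.assoc intro!: nn_integral_cong)
    qed (simp add: h_def)
  qed
  also have "\<dots> = (\<integral>\<^sup>+ v. (\<integral>\<^sup>+ s. h v s \<partial>lborel) \<partial>lborel)"
    using hm by (intro lborel_pair.Fubini') (simp add: case_prod_unfold)
  also have "\<dots> = (\<integral>\<^sup>+ v. ennreal (tail_integral p k) * (ennreal (p * v powr (p - 1)) * indicator {0..m} v) \<partial>lborel)"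
  proof (rule nn_integral_cong_AE)
    show "AE v in lborel. (\<integral>\<^sup>+ s. h v s \<partial>lborel)
        = ennreal (tail_integral p k) * (ennreal (p * v powr (p - 1)) * indicator {0..m} v)"
      using AE_lborel_singleton[of "0::real"]
    proof eventually_elim
      case (elim v)
      show ?case
      proof (cases "v \<in> {0..m}")
        case True
        then have v: "0 < v" using elim by auto
        have "(\<integral>\<^sup>+ s. h v s \<partial>lborel) = ennreal \<bar>v\<bar> * (\<integral>\<^sup>+ u. h v (0 + v * u) \<partial>lborel)"
          using v hm by (intro nn_integral_real_affine) (auto simp: h_def)
        also have "\<dots> = (\<integral>\<^sup>+ u. ennreal v * h v (v * u) \<partial>lborel)"
          using v by (subst nn_integral_cmult) (auto simp: h_def)
        also have "\<dots> = (\<integral>\<^sup>+ u. ennreal (p * v powr (p - 1)) * (ennreal (u powr (p - 1) / (u + 1)) * indicator {k..} u) \<partial>lborel)"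
        proof (rule nn_integral_cong)
          fix u :: real
          show "ennreal v * h v (v * u)
            = ennreal (p * v powr (p - 1)) * (ennreal (u powr (p - 1) / (u + 1)) * indicator {k..} u)"
          proof (cases "k \<le> u")
            case u: True
            then have u0: "0 < u" "0 < v * u" "k * v \<le> v * u" using k v by (auto simp: mult.commute)
            have "ennreal v * h v (v * u) = ennreal (v * (p * (v * u) powr (p - 1) * (1 / (v + v * u))))"
              unfolding h_def using True u0 p v by (simp add: ennreal_mult''[symmetric] ennreal_mult'[symmetric])
            also have "v * (p * (v * u) powr (p - 1) * (1 / (v + v * u)))
                = p * v powr (p - 1) * (u powr (p - 1) / (u + 1))"
            proof -
              have "v + v * u = v * (u + 1)" by (simp add: algebra_simps)
              then show ?thesis using v u0 by (simp add: powr_mult)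
            qed
            finally show ?thesis using u p u0 by (simp add: ennreal_mult''[symmetric] ennreal_mult'[symmetric])
          next
            case False
            then have "\<not> k * v \<le> v * u" using v by (simp add: mult.commute)
            then show ?thesis using False by (simp add: h_def)
          qed
        qed
        also have "\<dots> = ennreal (p * v powr (p - 1)) * ennreal (tail_integral p k)"
          using p k by (subst nn_integral_cmult) (auto simp: tail_integral(1))
        finally show ?thesis using True by (simp add: mult.commute)
      qed (simp add: h_def)
    qed
  qed
  also have "\<dots> = ennreal (tail_integral p k) * ennreal (m powr p)"
    using p m by (subst nn_integral_cmult) (auto simp: nn_integral_powr_from_0)
  finally show ?thesis .
qed

lemma moment_max_process_le:
  fixes M :: "'a measure"
  assumes adm: "admissible_process M F X" and t: "0 \<le> t" and p: "0 < p" "p < 1" and k: "1 \<le> k"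
  shows "(\<integral>\<^sup>+ \<omega>. ennreal (\<bar>max_process X t \<omega>\<bar> powr p) \<partial>M)
    \<le> ennreal (k powr p + tail_integral p k) * (\<integral>\<^sup>+ \<omega>. ennreal (\<bar>inf_process X t \<omega>\<bar> powr p) \<partial>M)"
proof -
  note adm' = adm[unfolded admissible_process_def]
  have fps: "filtered_prob_space M F" and sup: "supermartingale M F X" using adm' by auto
  interpret prob_space M using fps by (simp add: filtered_prob_space_def)
  interpret P: pair_sigma_finite M lborel by unfold_locales
  have cad: "right_cont_left_lims (\<lambda>t. X t \<omega>)" if "\<omega> \<in> space M" for \<omega> using adm' that by auto
  have X: "X r \<in> borel_measurable M" if "0 \<le> r" for r
    using sup that by (auto simp: supermartingale_def)
  define m where "m \<omega> = - inf_process X t \<omega>" for \<omega>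
  define S where "S \<omega> = max_process X t \<omega>" for \<omega>
  have [measurable]: "m \<in> borel_measurable M" "S \<in> borel_measurable M"
    using max_inf_process_measurable[of X M t] X cad t by (simp_all add: m_def[abs_def] S_def[abs_def])
  have m0: "0 \<le> m \<omega>" for \<omega> by (simp add: m_def inf_process_def)
  have S0: "0 \<le> S \<omega>" if "\<omega> \<in> space M" for \<omega>
    using process_bounds(4)[of X \<omega> 0 t] cad that t by (simp add: S_def)
  \<comment> \<open>Heights below \<open>k * m\<close> are estimated by \<open>k * m\<close> itself;
    a height \<open>s\<close> between \<open>k * m\<close> and \<open>S\<close> satisfies
    \<open>m \<le> s / k\<close>, which is the event with a probability bound. If
    \<open>S < k * m\<close>, the layer is empty and the first term suffices.\<close>
  have "(\<integral>\<^sup>+ \<omega>. ennreal (S \<omega> powr p) \<partial>M) \<le> (\<integral>\<^sup>+ \<omega>. ennreal ((k * m \<omega>) powr p) +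
      (\<integral>\<^sup>+ s. ennreal (p * s powr (p - 1)) * indicator {k * m \<omega>..<S \<omega>} s \<partial>lborel) \<partial>M)"
  proof (rule nn_integral_mono)
    fix \<omega> assume \<omega>: "\<omega> \<in> space M"
    have km: "0 \<le> k * m \<omega>" using k m0 by simp
    show "ennreal (S \<omega> powr p) \<le> ennreal ((k * m \<omega>) powr p) +
      (\<integral>\<^sup>+ s. ennreal (p * s powr (p - 1)) * indicator {k * m \<omega>..<S \<omega>} s \<partial>lborel)"
    proof (cases "k * m \<omega> \<le> S \<omega>")
      case True
      then show ?thesis by (rule eq_refl[OF nn_integral_powr_layer[OF p(1) km]])
    next
      case False
      then have "S \<omega> powr p \<le> (k * m \<omega>) powr p"
        by (intro powr_mono2 less_imp_le[OF p(1)] S0[OF \<omega>]) simp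
      then show ?thesis by (intro add_increasing2 ennreal_leI zero_le)
    qed
  qed
  also have "\<dots> = (\<integral>\<^sup>+ \<omega>. ennreal ((k * m \<omega>) powr p) \<partial>M) +
      (\<integral>\<^sup>+ \<omega>. (\<integral>\<^sup>+ s. ennreal (p * s powr (p - 1)) * (if k * m \<omega> \<le> s \<and> s < S \<omega> then 1 else 0) \<partial>lborel) \<partial>M)"
  proof -
    have ind: "indicator {k * m \<omega>..<S \<omega>} s = (if k * m \<omega> \<le> s \<and> s < S \<omega> then 1 else 0 :: ennreal)" for s \<omega>
      by (simp add: indicator_def)
    show ?thesis unfolding ind by (rule nn_integral_add) measurable
  qed
  also have "(\<integral>\<^sup>+ \<omega>. (\<integral>\<^sup>+ s. ennreal (p * s powr (p - 1)) * (if k * m \<omega> \<le> s \<and> s < S \<omega> then 1 else 0) \<partial>lborel) \<partial>M)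
      = (\<integral>\<^sup>+ s. (\<integral>\<^sup>+ \<omega>. ennreal (p * s powr (p - 1)) * (if k * m \<omega> \<le> s \<and> s < S \<omega> then 1 else 0) \<partial>M) \<partial>lborel)"
    by (rule P.Fubini'[symmetric]) measurable
  also have "\<dots> \<le> (\<integral>\<^sup>+ s. (\<integral>\<^sup>+ \<omega>. ennreal (p * s powr (p - 1)) *
      (indicator {0<..} s * ennreal (ln (1 + min (m \<omega>) (s / k) / s))) \<partial>M) \<partial>lborel)"
  proof (rule nn_integral_mono_AE)
    show "AE s in lborel. (\<integral>\<^sup>+ \<omega>. ennreal (p * s powr (p - 1)) * (if k * m \<omega> \<le> s \<and> s < S \<omega> then 1 else 0) \<partial>M)
      \<le> (\<integral>\<^sup>+ \<omega>. ennreal (p * s powr (p - 1)) *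
      (indicator {0<..} s * ennreal (ln (1 + min (m \<omega>) (s / k) / s))) \<partial>M)"
      using AE_lborel_singleton[of "0::real"]
    proof eventually_elim
      case (elim s)
      show ?case
      proof (cases "0 < s")
        case False
        then have "(if k * m \<omega> \<le> s \<and> s < S \<omega> then 1 else 0) = (0::ennreal)" for \<omega>
        proof -
          have "0 \<le> k * m \<omega>" using k m0 by simp
          then have "\<not> k * m \<omega> \<le> s" using False elim by linarith
          then show ?thesis by simp
        qed
        then show ?thesis by simp
      next
        case s: True
        \<comment> \<open>Here \<open>k \<ge> 1\<close> enters: the cap \<open>s / k\<close> may not
          exceed \<open>s\<close>, since otherwise a large \<open>\<bar>X\<bar>\<close> could stem
          from the infimum.\<close>
        have sk: "0 \<le> s / k" "s / k \<le> s" using s k by (auto simp: field_simps)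
        have "(\<integral>\<^sup>+ \<omega>. (if k * m \<omega> \<le> s \<and> s < S \<omega> then 1 else 0 :: ennreal) \<partial>M)
            = (\<integral>\<^sup>+ \<omega>. indicator {\<omega>\<in>space M. s < S \<omega> \<and> m \<omega> \<le> s / k} \<omega> \<partial>M)"
          using k by (intro nn_integral_cong) (simp add: indicator_def pos_le_divide_eq mult.commute conj_commute)
        also have "\<dots> = ennreal (measure M {\<omega>\<in>space M. s < S \<omega> \<and> m \<omega> \<le> s / k})"
          by (subst nn_integral_indicator) (auto simp: emeasure_eq_measure)
        also have "\<dots> \<le> ennreal (\<integral>\<omega>. ln (1 + min (m \<omega>) (s / k) / s) \<partial>M)"
          using prob_max_exceeds_le[OF adm t s sk] by (intro ennreal_leI) (simp add: m_def S_def)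
        also have "\<dots> = (\<integral>\<^sup>+ \<omega>. ennreal (ln (1 + min (m \<omega>) (s / k) / s)) \<partial>M)"
        proof (rule nn_integral_eq_integral[symmetric])
          have b: "0 \<le> ln (1 + min (m \<omega>) (s / k) / s) \<and> ln (1 + min (m \<omega>) (s / k) / s) \<le> 1" for \<omega>
          proof -
            have "0 \<le> min (m \<omega>) (s / k) / s" "min (m \<omega>) (s / k) / s \<le> 1"
              using m0[of \<omega>] s sk by (auto simp: min_le_iff_disj)
            then show ?thesis using ln_add_one_self_le_self[of "min (m \<omega>) (s / k) / s"] by auto
          qed
          show "integrable M (\<lambda>\<omega>. ln (1 + min (m \<omega>) (s / k) / s))"
            by (rule integrable_const_bound[where B=1]) (use b in auto)
          show "AE \<omega> in M. 0 \<le> ln (1 + min (m \<omega>) (s / k) / s)" using b by auto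
        qed
        finally show ?thesis using s
          by (simp add: nn_integral_cmult mult_left_mono)
      qed
    qed
  qed
  also have "(\<integral>\<^sup>+ s. (\<integral>\<^sup>+ \<omega>. ennreal (p * s powr (p - 1)) *
      (indicator {0<..} s * ennreal (ln (1 + min (m \<omega>) (s / k) / s))) \<partial>M) \<partial>lborel)
    = (\<integral>\<^sup>+ \<omega>. (\<integral>\<^sup>+ s. ennreal (p * s powr (p - 1)) *
      (indicator {0<..} s * ennreal (ln (1 + min (m \<omega>) (s / k) / s))) \<partial>lborel) \<partial>M)"
    by (rule P.Fubini') measurable
  also have "\<dots> = (\<integral>\<^sup>+ \<omega>. ennreal (tail_integral p k) * ennreal (m \<omega> powr p) \<partial>M)"
    using p k m0 by (simp add: nn_integral_ln_tail)
  also have "(\<integral>\<^sup>+ \<omega>. ennreal ((k * m \<omega>) powr p) \<partial>M) + (\<integral>\<^sup>+ \<omega>. ennreal (tail_integral p k) * ennreal (m \<omega> powr p) \<partial>M)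
      = (\<integral>\<^sup>+ \<omega>. ennreal (k powr p + tail_integral p k) * ennreal (m \<omega> powr p) \<partial>M)"
  proof (subst nn_integral_add[symmetric])
    show "(\<integral>\<^sup>+ \<omega>. ennreal ((k * m \<omega>) powr p) + ennreal (tail_integral p k) * ennreal (m \<omega> powr p) \<partial>M)
      = (\<integral>\<^sup>+ \<omega>. ennreal (k powr p + tail_integral p k) * ennreal (m \<omega> powr p) \<partial>M)"
    proof (rule nn_integral_cong)
      fix \<omega>
      have "(k * m \<omega>) powr p = k powr p * m \<omega> powr p" by (rule powr_mult)
      then show "ennreal ((k * m \<omega>) powr p) + ennreal (tail_integral p k) * ennreal (m \<omega> powr p)
        = ennreal (k powr p + tail_integral p k) * ennreal (m \<omega> powr p)"
        using tail_integral(2)[of p k] p k by (simp add: ennreal_mult'' distrib_right)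
    qed
  qed auto
  also have "\<dots> = ennreal (k powr p + tail_integral p k) * (\<integral>\<^sup>+ \<omega>. ennreal (m \<omega> powr p) \<partial>M)"
    by (rule nn_integral_cmult) simp
  finally have main: "(\<integral>\<^sup>+ \<omega>. ennreal (S \<omega> powr p) \<partial>M)
    \<le> ennreal (k powr p + tail_integral p k) * (\<integral>\<^sup>+ \<omega>. ennreal (m \<omega> powr p) \<partial>M)"
    by (simp add: add_mono)
  have "(\<integral>\<^sup>+ \<omega>. ennreal (\<bar>max_process X t \<omega>\<bar> powr p) \<partial>M) = (\<integral>\<^sup>+ \<omega>. ennreal (S \<omega> powr p) \<partial>M)"
    using S0 by (intro nn_integral_cong) (simp add: S_def)
  moreover have "\<bar>inf_process X t \<omega>\<bar> = m \<omega>" for \<omega> using m0[of \<omega>] by (simp add: m_def)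
  ultimately show ?thesis using main by simp
qed

text \<open>The factor in the moment bound has derivative
  \<open>k powr (p - 1) * (p - 1 / (k + 1))\<close> in \<open>k\<close>, negative below
  \<open>1 / p - 1\<close> and positive above. Over the admissible range \<open>k \<ge> 1\<close>
  the minimum is therefore at this maximum, and the case distinction at \<open>p = 1 / 2\<close> is
  the question which of the two terms wins.\<close>

definition opt_ratio :: "real \<Rightarrow> real" where
  "opt_ratio p = max 1 (1 / p - 1)"

definition moment_const :: "real \<Rightarrow> real" where
  "moment_const p = opt_ratio p powr p + tail_integral p (opt_ratio p)"

lemma moment_const_ge_1:
  assumes "0 < p" "p < 1"
  shows "1 \<le> moment_const p"
proof -
  have "1 powr p \<le> opt_ratio p powr p"
    using assms by (intro powr_mono2) (auto simp: opt_ratio_def)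
  moreover have "0 < opt_ratio p" by (simp add: opt_ratio_def less_max_iff_disj)
  ultimately show ?thesis
    using tail_integral(2)[of p "opt_ratio p"] assms by (simp add: moment_const_def)
qed

lemma best_const_eq:
  assumes "0 < p" "p < 1"
  shows "best_const p = moment_const p powr (1 / p)"
proof -
  have "p \<le> 1 / 2 \<longleftrightarrow> 1 \<le> 1 / p - 1" using assms by (simp add: field_simps)
  then show ?thesis
    by (auto simp: best_const_def moment_const_def opt_ratio_def tail_integral_def max_def)
qed

lemma ennreal_powr_mono: "x \<le> y \<Longrightarrow> 0 \<le> a \<Longrightarrow> ennreal_powr x a \<le> ennreal_powr y a"
  by (cases x; cases y) (auto simp: ennreal_powr_def top_unique intro!: ennreal_leI powr_mono2)

lemma ennreal_powr_mult:
  assumes "0 < c" "0 < a"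
  shows "ennreal_powr (ennreal c * x) a = ennreal (c powr a) * ennreal_powr x a"
proof (cases x)
  case (real r)
  then have *: "ennreal c * x = ennreal (c * r)" using assms by (simp add: ennreal_mult)
  show ?thesis
    unfolding * using assms real by (simp add: ennreal_powr_def powr_mult flip: ennreal_mult)
next
  case top
  then show ?thesis using assms by (simp add: ennreal_powr_def ennreal_mult_top)
qed

theorem process_norm_max_le:
  fixes M :: "'a measure"
  assumes adm: "admissible_process M F X" and p: "0 < p" "p < 1"
  shows "process_norm M p (max_process X) \<le> ennreal (best_const p) * process_norm M p (inf_process X)"
  unfolding process_norm_def
proof (rule SUP_least)
  fix t :: real assume "t \<in> {0..}"
  then have t: "0 \<le> t" by simp
  have C: "0 < moment_const p" using moment_const_ge_1[OF p] by simp
  let ?I = "\<lambda>t. \<integral>\<^sup>+ \<omega>. ennreal (\<bar>inf_process X t \<omega>\<bar> powr p) \<partial>M"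
  have "ennreal_powr (\<integral>\<^sup>+ \<omega>. ennreal (\<bar>max_process X t \<omega>\<bar> powr p) \<partial>M) (1 / p)
      \<le> ennreal_powr (ennreal (moment_const p) * ?I t) (1 / p)"
    using moment_max_process_le[OF adm t p, of "opt_ratio p"] p
    by (intro ennreal_powr_mono) (auto simp: moment_const_def opt_ratio_def)
  also have "\<dots> = ennreal (best_const p) * ennreal_powr (?I t) (1 / p)"
    using C p by (simp add: ennreal_powr_mult best_const_eq)
  also have "\<dots> \<le> ennreal (best_const p) * (SUP t\<in>{0..}. ennreal_powr (?I t) (1 / p))"
    using t by (intro mult_left_mono SUP_upper) auto
  finally show "ennreal_powr (\<integral>\<^sup>+ \<omega>. ennreal (\<bar>max_process X t \<omega>\<bar> powr p) \<partial>M) (1 / p)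
    \<le> ennreal (best_const p) * (SUP t\<in>{0..}. ennreal_powr (?I t) (1 / p))" .
qed

section \<open>Independence from characteristic functions\<close>

lemma borel_measurable_cis [measurable (raw)]:
  "f \<in> borel_measurable M \<Longrightarrow> (\<lambda>\<omega>. cis (f \<omega>)) \<in> borel_measurable M"
  by (rule borel_measurable_continuous_on) (auto intro!: continuous_intros)

lemma char_eq_cis: "char M t = (\<integral>x. cis (t * x) \<partial>M)"
  by (simp add: char_def cis_conv_exp)

text \<open>At \<open>\<theta> = 0\<close> the hypothesis says that both weights have the same mass
  \<open>c\<close>. For \<open>c > 0\<close>, \<open>u / c\<close> and \<open>v / c\<close> are
  densities of two probability measures whose images under \<open>X\<close> have equal
  characteristic functions, so Levy's uniqueness theorem applies. For \<open>c = 0\<close> both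
  weights vanish almost everywhere.\<close>

lemma (in prob_space) weighted_law_unique_nonneg:
  fixes u v X :: "'a \<Rightarrow> real"
  assumes [measurable]: "X \<in> borel_measurable M"
    and u: "integrable M u" "\<And>\<omega>. 0 \<le> u \<omega>" and v: "integrable M v" "\<And>\<omega>. 0 \<le> v \<omega>"
    and eq: "\<And>\<theta>. (\<integral>\<omega>. u \<omega> *\<^sub>R cis (\<theta> * X \<omega>) \<partial>M) = (\<integral>\<omega>. v \<omega> *\<^sub>R cis (\<theta> * X \<omega>) \<partial>M)"
    and A: "A \<in> sets borel"
  shows "(\<integral>\<omega>. u \<omega> * indicator A (X \<omega>) \<partial>M) = (\<integral>\<omega>. v \<omega> * indicator A (X \<omega>) \<partial>M)"
proof -
  define c where "c = (\<integral>\<omega>. u \<omega> \<partial>M)"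
  have cv: "(\<integral>\<omega>. v \<omega> \<partial>M) = c"
  proof -
    have "complex_of_real (\<integral>\<omega>. u \<omega> \<partial>M) = complex_of_real (\<integral>\<omega>. v \<omega> \<partial>M)"
      using eq[of 0] by (simp add: scaleR_conv_of_real)
    then show ?thesis unfolding c_def of_real_eq_iff by simp
  qed
  have c0: "0 \<le> c" unfolding c_def using u by simp
  show ?thesis
  proof (cases "c = 0")
    case True
    have "AE \<omega> in M. u \<omega> = 0"
      using u True c_def by (subst integral_nonneg_eq_0_iff_AE[symmetric]) auto
    moreover have "AE \<omega> in M. v \<omega> = 0"
      using v True cv by (subst integral_nonneg_eq_0_iff_AE[symmetric]) auto
    ultimately have "AE \<omega> in M. u \<omega> * indicator A (X \<omega>) = v \<omega> * indicator A (X \<omega>)"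
      by eventually_elim simp
    then show ?thesis by (intro integral_cong_AE) (use u v A in \<open>auto intro!: borel_measurable_times\<close>)
  next
    case False
    then have c: "0 < c" using c0 by simp
    define L where "L w = distr (density M (\<lambda>\<omega>. ennreal (w \<omega> / c))) borel X" for w
    have L: "real_distribution (L w)" "char (L w) \<theta> = (\<integral>\<omega>. w \<omega> *\<^sub>R cis (\<theta> * X \<omega>) \<partial>M) / c"
        "measure (L w) A = (\<integral>\<omega>. w \<omega> * indicator A (X \<omega>) \<partial>M) / c"
      if w: "integrable M w" "\<And>\<omega>. 0 \<le> w \<omega>" "(\<integral>\<omega>. w \<omega> \<partial>M) = c" for w \<theta>
    proof -
      have [measurable]: "w \<in> borel_measurable M" using w by auto
      have "emeasure (density M (\<lambda>\<omega>. ennreal (w \<omega> / c))) (space M) = (\<integral>\<^sup>+ \<omega>. ennreal (w \<omega> / c) \<partial>M)"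
        by (subst emeasure_density) (auto intro!: nn_integral_cong)
      also have "\<dots> = ennreal (\<integral>\<omega>. w \<omega> / c \<partial>M)"
        using w c by (intro nn_integral_eq_integral) auto
      also have "\<dots> = 1" using w c by simp
      finally interpret D: prob_space "density M (\<lambda>\<omega>. ennreal (w \<omega> / c))"
        by (intro prob_spaceI) simp
      show "real_distribution (L w)" unfolding L_def
        by (intro D.real_distribution_distr) simp
      have "char (L w) \<theta> = (\<integral>\<omega>. (w \<omega> / c) *\<^sub>R cis (\<theta> * X \<omega>) \<partial>M)"
        unfolding L_def char_eq_cis
        by (subst integral_distr) (auto intro!: integral_density AE_I2 simp: w(2) c0)
      also have "\<dots> = (\<integral>\<omega>. w \<omega> *\<^sub>R cis (\<theta> * X \<omega>) / c \<partial>M)"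
        by (intro Bochner_Integration.integral_cong) (auto simp: scaleR_conv_of_real)
      finally show "char (L w) \<theta> = (\<integral>\<omega>. w \<omega> *\<^sub>R cis (\<theta> * X \<omega>) \<partial>M) / c" by simp
      have "measure (L w) A = (\<integral>x. indicator A x \<partial>L w)" using A by (simp add: L_def)
      also have "\<dots> = (\<integral>\<omega>. indicator A (X \<omega>) \<partial>density M (\<lambda>\<omega>. ennreal (w \<omega> / c)))"
        unfolding L_def using A by (intro integral_distr) auto
      also have "\<dots> = (\<integral>\<omega>. (w \<omega> / c) *\<^sub>R indicator A (X \<omega>) \<partial>M)"
        using A by (intro integral_density AE_I2) (auto simp: w(2) c0)
      finally show "measure (L w) A = (\<integral>\<omega>. w \<omega> * indicator A (X \<omega>) \<partial>M) / c" by simp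
    qed
    have "L u = L v"
      by (rule Levy_uniqueness) (use L[OF u c_def[symmetric]] L[OF v cv] eq in auto)
    then show ?thesis using L(3)[OF u c_def[symmetric]] L(3)[OF v cv] c by simp
  qed
qed


lemma (in prob_space) integrable_cis_mult:
  assumes "f \<in> borel_measurable M" "\<And>\<omega>. norm (f \<omega> :: complex) \<le> K" "X \<in> borel_measurable M"
  shows "integrable M (\<lambda>\<omega>. f \<omega> * cis (X \<omega>))"
  by (rule integrable_const_bound[where B=K]) (use assms in \<open>auto simp: norm_mult\<close>)

text \<open>A bounded weight is determined, conditionally on \<open>X\<close>, by its weighted characteristic function.
  This replaces the uniqueness theorem for characteristic functions of random vectors.\<close>

lemma (in prob_space) weighted_char_zero:
  fixes f :: "'a \<Rightarrow> complex" and X :: "'a \<Rightarrow> real"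
  assumes X[measurable]: "X \<in> borel_measurable M"
    and f[measurable]: "f \<in> borel_measurable M" and bd: "\<And>\<omega>. norm (f \<omega>) \<le> K"
    and zero: "\<And>\<theta>. (\<integral>\<omega>. f \<omega> * cis (\<theta> * X \<omega>) \<partial>M) = 0"
    and A: "A \<in> sets borel"
  shows "(\<integral>\<omega>. f \<omega> * indicator A (X \<omega>) \<partial>M) = 0"
proof -
  \<comment> \<open>A real weight is split into its positive and negative part; the vanishing
    integral says that both have the same weighted characteristic function.\<close>
  have real_case: "(\<integral>\<omega>. g \<omega> * indicator A (X \<omega>) \<partial>M) = 0"
    if g[measurable]: "g \<in> borel_measurable M" and gbd: "\<And>\<omega>. \<bar>g \<omega>\<bar> \<le> K"
      and gz: "\<And>\<theta>. (\<integral>\<omega>. g \<omega> *\<^sub>R cis (\<theta> * X \<omega>) \<partial>M) = 0" for g :: "'a \<Rightarrow> real"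
  proof -
    have ip: "integrable M (\<lambda>\<omega>. max (g \<omega>) 0)" "integrable M (\<lambda>\<omega>. max (- g \<omega>) 0)"
    proof -
      have "\<bar>max (g \<omega>) 0\<bar> \<le> K" "\<bar>max (- g \<omega>) 0\<bar> \<le> K" for \<omega>
        using gbd[of \<omega>] by linarith+
      then show "integrable M (\<lambda>\<omega>. max (g \<omega>) 0)" "integrable M (\<lambda>\<omega>. max (- g \<omega>) 0)"
        by (auto intro!: integrable_const_bound[where B=K])
    qed
    have ie: "integrable M (\<lambda>\<omega>. max (g \<omega>) 0 *\<^sub>R cis (\<theta> * X \<omega>))"
      "integrable M (\<lambda>\<omega>. max (- g \<omega>) 0 *\<^sub>R cis (\<theta> * X \<omega>))" for \<theta>
      using ip by (auto intro: Bochner_Integration.integrable_bound[OF ip(1)] Bochner_Integration.integrable_bound[OF ip(2)])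
    have ia: "integrable M (\<lambda>\<omega>. max (g \<omega>) 0 * indicator A (X \<omega>))"
      "integrable M (\<lambda>\<omega>. max (- g \<omega>) 0 * indicator A (X \<omega>))"
      using ip A by (auto intro: Bochner_Integration.integrable_bound[OF ip(1)] Bochner_Integration.integrable_bound[OF ip(2)] simp: indicator_def)
    have "(\<integral>\<omega>. max (g \<omega>) 0 * indicator A (X \<omega>) \<partial>M) = (\<integral>\<omega>. max (- g \<omega>) 0 * indicator A (X \<omega>) \<partial>M)"
    proof (rule weighted_law_unique_nonneg)
      fix \<theta>
      have "(\<integral>\<omega>. max (g \<omega>) 0 *\<^sub>R cis (\<theta> * X \<omega>) \<partial>M) - (\<integral>\<omega>. max (- g \<omega>) 0 *\<^sub>R cis (\<theta> * X \<omega>) \<partial>M)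
        = (\<integral>\<omega>. g \<omega> *\<^sub>R cis (\<theta> * X \<omega>) \<partial>M)"
        unfolding Bochner_Integration.integral_diff[OF ie, symmetric]
        by (intro Bochner_Integration.integral_cong) (auto simp: max_def)
      then show "(\<integral>\<omega>. max (g \<omega>) 0 *\<^sub>R cis (\<theta> * X \<omega>) \<partial>M) = (\<integral>\<omega>. max (- g \<omega>) 0 *\<^sub>R cis (\<theta> * X \<omega>) \<partial>M)"
        using gz by simp
    qed (use ip A in auto)
    moreover have "(\<integral>\<omega>. max (g \<omega>) 0 * indicator A (X \<omega>) \<partial>M) - (\<integral>\<omega>. max (- g \<omega>) 0 * indicator A (X \<omega>) \<partial>M)
        = (\<integral>\<omega>. g \<omega> * indicator A (X \<omega>) \<partial>M)"
      unfolding Bochner_Integration.integral_diff[OF ia, symmetric]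
      by (intro Bochner_Integration.integral_cong) (auto simp: max_def)
    ultimately show ?thesis by simp
  qed
  note int = integrable_cis_mult[OF f bd]
  \<comment> \<open>Conjugation turns the frequency \<open>\<theta>\<close> into
    \<open>- \<theta>\<close>. As the hypothesis covers both signs, it passes to
    \<open>cnj f\<close> and hence to the real and imaginary parts of \<open>f\<close>.\<close>
  have zero': "(\<integral>\<omega>. cnj (f \<omega>) * cis (\<theta> * X \<omega>) \<partial>M) = 0" for \<theta>
  proof -
    have "cnj (\<integral>\<omega>. f \<omega> * cis ((- \<theta>) * X \<omega>) \<partial>M) = (\<integral>\<omega>. cnj (f \<omega> * cis ((- \<theta>) * X \<omega>)) \<partial>M)"
      by (rule Bochner_Integration.integral_cnj[symmetric])
    also have "\<dots> = (\<integral>\<omega>. cnj (f \<omega>) * cis (\<theta> * X \<omega>) \<partial>M)"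
      by (intro Bochner_Integration.integral_cong) (auto simp: cis_cnj)
    finally show ?thesis using zero[of "- \<theta>"] by simp
  qed
  have cf: "(\<lambda>\<omega>. cnj (f \<omega>)) \<in> borel_measurable M"
    by (rule borel_measurable_continuous_on[OF _ f]) (intro continuous_intros)
  note int' = integrable_cis_mult[OF cf, of K, simplified, OF bd]
  have re: "(\<integral>\<omega>. Re (f \<omega>) *\<^sub>R cis (\<theta> * X \<omega>) \<partial>M) = 0" for \<theta>
  proof -
    have "(\<integral>\<omega>. Re (f \<omega>) *\<^sub>R cis (\<theta> * X \<omega>) \<partial>M)
      = (\<integral>\<omega>. (f \<omega> * cis (\<theta> * X \<omega>) + cnj (f \<omega>) * cis (\<theta> * X \<omega>)) / 2 \<partial>M)"
      by (intro Bochner_Integration.integral_cong refl)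
         (simp add: distrib_right[symmetric] complex_add_cnj scaleR_conv_of_real)
    also have "\<dots> = 0"
      using zero zero' int[of "\<lambda>\<omega>. \<theta> * X \<omega>"] int'[of "\<lambda>\<omega>. \<theta> * X \<omega>"] by simp
    finally show ?thesis .
  qed
  have im: "(\<integral>\<omega>. Im (f \<omega>) *\<^sub>R cis (\<theta> * X \<omega>) \<partial>M) = 0" for \<theta>
  proof -
    have "(\<integral>\<omega>. Im (f \<omega>) *\<^sub>R cis (\<theta> * X \<omega>) \<partial>M)
      = (\<integral>\<omega>. (f \<omega> * cis (\<theta> * X \<omega>) - cnj (f \<omega>) * cis (\<theta> * X \<omega>)) / (2 * \<i>) \<partial>M)"
    proof (intro Bochner_Integration.integral_cong refl)
      fix \<omega>
      have "f \<omega> * cis (\<theta> * X \<omega>) - cnj (f \<omega>) * cis (\<theta> * X \<omega>)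
        = (2 * \<i>) * (complex_of_real (Im (f \<omega>)) * cis (\<theta> * X \<omega>))"
        by (simp add: left_diff_distrib[symmetric] complex_diff_cnj)
      then show "Im (f \<omega>) *\<^sub>R cis (\<theta> * X \<omega>)
        = (f \<omega> * cis (\<theta> * X \<omega>) - cnj (f \<omega>) * cis (\<theta> * X \<omega>)) / (2 * \<i>)"
        by (simp add: scaleR_conv_of_real)
    qed
    also have "\<dots> = 0"
      using zero zero' int[of "\<lambda>\<omega>. \<theta> * X \<omega>"] int'[of "\<lambda>\<omega>. \<theta> * X \<omega>"] by simp
    finally show ?thesis .
  qed
  have bd': "\<bar>Re (f \<omega>)\<bar> \<le> K" "\<bar>Im (f \<omega>)\<bar> \<le> K" for \<omega>
    using bd[of \<omega>] abs_Re_le_cmod[of "f \<omega>"] abs_Im_le_cmod[of "f \<omega>"] by linarith+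
  have r: "(\<integral>\<omega>. Re (f \<omega>) * indicator A (X \<omega>) \<partial>M) = 0"
    by (rule real_case[OF _ bd'(1) re]) simp
  have i: "(\<integral>\<omega>. Im (f \<omega>) * indicator A (X \<omega>) \<partial>M) = 0"
    by (rule real_case[OF _ bd'(2) im]) simp
  have ii: "integrable M (\<lambda>\<omega>. f \<omega> * indicator A (X \<omega>))"
    by (rule integrable_const_bound[where B=K])
       (use bd A in \<open>auto simp: norm_mult indicator_def intro: order.trans[OF norm_ge_zero]\<close>)
  show ?thesis
  proof (rule complex_eqI)
    show "Re (\<integral>\<omega>. f \<omega> * indicator A (X \<omega>) \<partial>M) = Re 0"
    proof -
      have "Re (\<integral>\<omega>. f \<omega> * indicator A (X \<omega>) \<partial>M) = (\<integral>\<omega>. Re (f \<omega> * indicator A (X \<omega>)) \<partial>M)"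
        by (rule integral_Re[OF ii, symmetric])
      also have "\<dots> = (\<integral>\<omega>. Re (f \<omega>) * indicator A (X \<omega>) \<partial>M)"
        by (intro Bochner_Integration.integral_cong) (auto simp: indicator_def)
      finally show ?thesis using r by simp
    qed
    show "Im (\<integral>\<omega>. f \<omega> * indicator A (X \<omega>) \<partial>M) = Im 0"
    proof -
      have "Im (\<integral>\<omega>. f \<omega> * indicator A (X \<omega>) \<partial>M) = (\<integral>\<omega>. Im (f \<omega> * indicator A (X \<omega>)) \<partial>M)"
        by (rule integral_Im[OF ii, symmetric])
      also have "\<dots> = (\<integral>\<omega>. Im (f \<omega>) * indicator A (X \<omega>) \<partial>M)"
        by (intro Bochner_Integration.integral_cong) (auto simp: indicator_def)
      finally show ?thesis using i by simp
    qed
  qed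
qed

text \<open>Factorisation says that the centred exponential of \<open>Y\<close> integrates to
  \<open>0\<close> against every exponential of the \<open>X i\<close>. The exponentials are traded
  for indicators one coordinate at a time; each trade is uniqueness in a single real variable, with
  all other factors kept as a bounded complex weight. The exponential of \<open>Y\<close> is traded
  last.\<close>

lemma (in prob_space) indep_cylinder_of_char:
  fixes Y :: "'a \<Rightarrow> real" and X :: "nat \<Rightarrow> 'a \<Rightarrow> real" and n :: nat
  assumes Y[measurable]: "Y \<in> borel_measurable M"
    and X: "\<And>i. i < n \<Longrightarrow> X i \<in> borel_measurable M"
    and fac: "\<And>\<theta> \<eta>. (\<integral>\<omega>. cis (\<theta> * Y \<omega> + (\<Sum>i<n. \<eta> i * X i \<omega>)) \<partial>M)
        = (\<integral>\<omega>. cis (\<theta> * Y \<omega>) \<partial>M) * (\<integral>\<omega>. cis (\<Sum>i<n. \<eta> i * X i \<omega>) \<partial>M)"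
    and A: "\<And>i. i < n \<Longrightarrow> A i \<in> sets borel" and C: "C \<in> sets borel"
  shows "prob {\<omega>\<in>space M. (\<forall>i<n. X i \<omega> \<in> A i) \<and> Y \<omega> \<in> C}
    = prob {\<omega>\<in>space M. \<forall>i<n. X i \<omega> \<in> A i} * prob {\<omega>\<in>space M. Y \<omega> \<in> C}"
proof -
  define \<phi> where "\<phi> \<theta> = (\<integral>\<omega>. cis (\<theta> * Y \<omega>) \<partial>M)" for \<theta>
  have ie: "integrable M (\<lambda>\<omega>. cis (Z \<omega>))" if "Z \<in> borel_measurable M" for Z
    by (rule integrable_const_bound[where B=1]) (use that in auto)
  have \<phi>_bd: "norm (\<phi> \<theta>) \<le> 1" for \<theta>
  proof -
    have "norm (\<phi> \<theta>) \<le> (\<integral>\<omega>. norm (cis (\<theta> * Y \<omega>)) \<partial>M)" unfolding \<phi>_def by (rule integral_norm_bound)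
    then show ?thesis by (simp add: prob_space)
  qed
  define D where "D \<theta> \<omega> = cis (\<theta> * Y \<omega>) - \<phi> \<theta>" for \<theta> \<omega>
  have [measurable]: "D \<theta> \<in> borel_measurable M" for \<theta> unfolding D_def by measurable
  have D_bd: "norm (D \<theta> \<omega>) \<le> 2" for \<theta> \<omega>
    unfolding D_def using norm_triangle_ineq4[of "cis (\<theta> * Y \<omega>)" "\<phi> \<theta>"] \<phi>_bd[of \<theta>] by simp
  define G where "G m \<omega> = (\<Prod>i<m. indicator (A i) (X i \<omega>) :: complex)" for m \<omega>
  have G_meas: "G m \<in> borel_measurable M" if "m \<le> n" for m
    unfolding G_def
  proof (rule borel_measurable_prod)
    fix i assume "i \<in> {..<m}"
    then show "(\<lambda>\<omega>. indicator (A i) (X i \<omega>) :: complex) \<in> borel_measurable M"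
      using that by (intro measurable_compose[OF X borel_measurable_indicator[OF A]]) auto
  qed
  have G_bd: "norm (G m \<omega>) \<le> 1" for m \<omega>
    unfolding G_def prod_norm[symmetric] by (intro prod_le_1) (auto simp: indicator_def)
  \<comment> \<open>The first \<open>m\<close> coordinates already carry indicators, the others
    still carry frequencies. The frequencies are arbitrary in the induction so that the one at
    \<open>m\<close> can run through all \<open>\<theta>'\<close>.\<close>
  have step: "(\<integral>\<omega>. D \<theta> \<omega> * G m \<omega> * cis (\<Sum>i=m..<n. \<eta> i * X i \<omega>) \<partial>M) = 0" if "m \<le> n" for m \<theta> \<eta>
    using that
  proof (induction m arbitrary: \<eta>)
    case 0
    have sm: "(\<lambda>\<omega>. \<Sum>i<n. \<eta> i * X i \<omega>) \<in> borel_measurable M" using X by (intro borel_measurable_sum) auto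
    have "(\<integral>\<omega>. D \<theta> \<omega> * G 0 \<omega> * cis (\<Sum>i=0..<n. \<eta> i * X i \<omega>) \<partial>M)
      = (\<integral>\<omega>. cis (\<theta> * Y \<omega> + (\<Sum>i<n. \<eta> i * X i \<omega>)) - \<phi> \<theta> * cis (\<Sum>i<n. \<eta> i * X i \<omega>) \<partial>M)"
      by (intro Bochner_Integration.integral_cong)
         (auto simp: D_def G_def left_diff_distrib cis_mult distrib_left lessThan_atLeast0)
    also have "\<dots> = 0"
      using fac[of \<theta> \<eta>] sm by (subst Bochner_Integration.integral_diff) (auto intro!: ie simp: \<phi>_def)
    finally show ?case .
  next
    case (Suc m)
    then have m: "m < n" by simp
    let ?R = "\<lambda>\<omega>. \<Sum>i=Suc m..<n. \<eta> i * X i \<omega>"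
    have sm: "?R \<in> borel_measurable M" using X by (intro borel_measurable_sum) auto
    have "(\<integral>\<omega>. (D \<theta> \<omega> * G m \<omega> * cis (?R \<omega>)) * indicator (A m) (X m \<omega>) \<partial>M) = 0"
    proof (rule weighted_char_zero[where K=2])
      show "X m \<in> borel_measurable M" using X m by auto
      show "(\<lambda>\<omega>. D \<theta> \<omega> * G m \<omega> * cis (?R \<omega>)) \<in> borel_measurable M"
        using sm G_meas[of m] m by (intro borel_measurable_times borel_measurable_cis) auto
      show "norm (D \<theta> \<omega> * G m \<omega> * cis (?R \<omega>)) \<le> 2" for \<omega>
        using mult_mono[OF D_bd[of \<theta> \<omega>] G_bd[of m \<omega>]] by (simp add: norm_mult)
      fix \<theta>'
      have "(\<integral>\<omega>. D \<theta> \<omega> * G m \<omega> * cis (\<Sum>i=m..<n. (\<eta>(m := \<theta>')) i * X i \<omega>) \<partial>M) = 0"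
        using Suc by simp
      also have "(\<lambda>\<omega>. \<Sum>i=m..<n. (\<eta>(m := \<theta>')) i * X i \<omega>) = (\<lambda>\<omega>. \<theta>' * X m \<omega> + ?R \<omega>)"
        using m by (auto simp: sum.atLeast_Suc_lessThan intro!: ext sum.cong)
      finally show "(\<integral>\<omega>. (D \<theta> \<omega> * G m \<omega> * cis (?R \<omega>)) * cis (\<theta>' * X m \<omega>) \<partial>M) = 0"
        by (simp add: cis_mult[symmetric] distrib_left mult_ac)
    qed (use A m in auto)
    then show ?case by (simp add: G_def mult_ac)
  qed
  define E where "E = {\<omega>\<in>space M. \<forall>i<n. X i \<omega> \<in> A i}"
  have [measurable]: "E \<in> sets M"
  proof -
    have "{\<omega>\<in>space M. X i \<omega> \<in> A i} \<in> sets M" if "i < n" for i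
      using measurable_sets[OF X A] that by (simp add: vimage_def Int_def conj_commute)
    then have "{\<omega>\<in>space M. \<forall>i\<in>{..<n}. X i \<omega> \<in> A i} \<in> sets M"
      by (intro sets.sets_Collect_finite_All) auto
    moreover have "E = {\<omega>\<in>space M. \<forall>i\<in>{..<n}. X i \<omega> \<in> A i}" by (auto simp: E_def)
    ultimately show ?thesis by simp
  qed
  have GE: "G n \<omega> = indicator E \<omega>" if "\<omega> \<in> space M" for \<omega>
    using that by (auto simp: G_def E_def indicator_def intro!: prod.neutral)
  have iE: "integrable M (\<lambda>\<omega>. indicator E \<omega> * cis (\<theta> * Y \<omega>))" for \<theta>
    by (rule integrable_cis_mult[where K=1]) (auto simp: indicator_def)
  have pE: "(\<integral>\<omega>. indicator E \<omega> \<partial>M) = complex_of_real (prob E)"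
  proof -
    have "(\<lambda>\<omega>. indicator E \<omega>) = (\<lambda>\<omega>. complex_of_real (indicator E \<omega>))"
      by (auto simp: indicator_def fun_eq_iff)
    then have "(\<integral>\<omega>. indicator E \<omega> \<partial>M) = (\<integral>\<omega>. complex_of_real (indicator E \<omega>) \<partial>M)" by simp
    also have "\<dots> = complex_of_real (\<integral>\<omega>. indicator E \<omega> \<partial>M)" by (rule integral_complex_of_real)
    finally show ?thesis by simp
  qed
  \<comment> \<open>The roles change: \<open>Y\<close> is now the variable, and the centred
    indicator of the cylinder is the weight.\<close>
  have "(\<integral>\<omega>. (indicator E \<omega> - of_real (prob E)) * indicator C (Y \<omega>) \<partial>M) = (0::complex)"
  proof (rule weighted_char_zero[where K=2])
    show "norm (indicator E \<omega> - of_real (prob E) :: complex) \<le> 2" for \<omega>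
    proof -
      have "norm (indicator E \<omega> - of_real (prob E) :: complex)
        \<le> norm (indicator E \<omega> :: complex) + norm (complex_of_real (prob E))"
        by (rule norm_triangle_ineq4)
      also have "\<dots> \<le> 1 + 1" by (intro add_mono) (auto simp: indicator_def)
      finally show ?thesis by simp
    qed
    fix \<theta>
    have "0 = (\<integral>\<omega>. D \<theta> \<omega> * G n \<omega> * cis (\<Sum>i=n..<n. 0 * X i \<omega>) \<partial>M)"
      using step[of n \<theta> "\<lambda>_. 0"] by simp
    also have "\<dots> = (\<integral>\<omega>. indicator E \<omega> * cis (\<theta> * Y \<omega>) - \<phi> \<theta> * indicator E \<omega> \<partial>M)"
      by (intro Bochner_Integration.integral_cong) (auto simp: GE D_def algebra_simps)
    also have "\<dots> = (\<integral>\<omega>. indicator E \<omega> * cis (\<theta> * Y \<omega>) \<partial>M) - \<phi> \<theta> * prob E"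
      using iE[of \<theta>] iE[of 0] pE by (subst Bochner_Integration.integral_diff) auto
    finally have *: "(\<integral>\<omega>. indicator E \<omega> * cis (\<theta> * Y \<omega>) \<partial>M) = \<phi> \<theta> * prob E" by simp
    have "(\<integral>\<omega>. (indicator E \<omega> - of_real (prob E)) * cis (\<theta> * Y \<omega>) \<partial>M)
      = (\<integral>\<omega>. indicator E \<omega> * cis (\<theta> * Y \<omega>) \<partial>M) - prob E * \<phi> \<theta>"
      unfolding \<phi>_def using iE[of \<theta>] ie[of "\<lambda>\<omega>. \<theta> * Y \<omega>"]
      by (subst left_diff_distrib, subst Bochner_Integration.integral_diff) auto
    then show "(\<integral>\<omega>. (indicator E \<omega> - of_real (prob E)) * cis (\<theta> * Y \<omega>) \<partial>M) = 0" using * by simp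
  qed (use C in auto)
  moreover have "(\<integral>\<omega>. (indicator E \<omega> - of_real (prob E)) * indicator C (Y \<omega>) \<partial>M)
    = complex_of_real (prob {\<omega>\<in>space M. (\<forall>i<n. X i \<omega> \<in> A i) \<and> Y \<omega> \<in> C} - prob E * prob {\<omega>\<in>space M. Y \<omega> \<in> C})"
    (is "?l = complex_of_real (prob ?EC - prob E * prob ?C)")
  proof -
    have [measurable]: "?C \<in> sets M" using C by measurable
    have EC: "?EC = E \<inter> ?C" by (auto simp: E_def)
    have "?l = (\<integral>\<omega>. complex_of_real (indicator ?EC \<omega> - prob E * indicator ?C \<omega>) \<partial>M)"
      by (intro Bochner_Integration.integral_cong) (auto simp: indicator_def E_def)
    also have "\<dots> = complex_of_real (\<integral>\<omega>. indicator ?EC \<omega> - prob E * indicator ?C \<omega> \<partial>M)"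
      by (rule integral_complex_of_real)
    also have "(\<integral>\<omega>. indicator ?EC \<omega> - prob E * indicator ?C \<omega> \<partial>M) = prob ?EC - prob E * prob ?C"
      unfolding EC by (subst Bochner_Integration.integral_diff) (auto intro!: integrable_const_bound[where B=1])
    finally show ?thesis .
  qed
  ultimately show ?thesis unfolding E_def by (simp add: of_real_eq_iff[symmetric] del: of_real_eq_iff of_real_diff)
qed

section \<open>The augmented natural filtration\<close>

lemma natural_filtration_gen_subset:
  "{B s -` A \<inter> space M | s A. 0 \<le> s \<and> s \<le> t \<and> A \<in> sets borel} \<union> null_sets M \<subseteq> Pow (space M)"
  by (auto dest: null_setsD2 sets.sets_into_space)

lemma space_natural_filtration [simp]: "space (natural_filtration M B t) = space M"
  unfolding natural_filtration_def using natural_filtration_gen_subset by (rule space_measure_of)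

lemma sets_natural_filtration:
  "sets (natural_filtration M B t) = sigma_sets (space M)
     ({B s -` A \<inter> space M | s A. 0 \<le> s \<and> s \<le> t \<and> A \<in> sets borel} \<union> null_sets M)"
  unfolding natural_filtration_def using natural_filtration_gen_subset by (rule sets_measure_of)

lemma natural_filtration_mono:
  "s \<le> t \<Longrightarrow> sets (natural_filtration M B s) \<subseteq> sets (natural_filtration M B t)"
  unfolding sets_natural_filtration
proof (rule sigma_sets_mono', rule Un_mono[OF _ order_refl], rule subsetI)
  fix C assume "s \<le> t" "C \<in> {B r -` A \<inter> space M | r A. 0 \<le> r \<and> r \<le> s \<and> A \<in> sets borel}"
  then obtain r A where "C = B r -` A \<inter> space M" "0 \<le> r" "r \<le> t" "A \<in> sets borel" by auto
  then show "C \<in> {B r -` A \<inter> space M | r A. 0 \<le> r \<and> r \<le> t \<and> A \<in> sets borel}" by blast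
qed

lemma measurable_natural_filtration:
  assumes "0 \<le> s" "s \<le> t"
  shows "B s \<in> borel_measurable (natural_filtration M B t)"
proof (rule measurableI)
  fix A :: "real set" assume "A \<in> sets borel"
  then show "B s -` A \<inter> space (natural_filtration M B t) \<in> sets (natural_filtration M B t)"
    unfolding sets_natural_filtration space_natural_filtration using assms
    by (intro sigma_sets.Basic) blast
qed simp

lemma null_sets_natural_filtration: "null_sets M \<subseteq> sets (natural_filtration M B t)"
  unfolding sets_natural_filtration by (auto intro: sigma_sets.Basic)

lemma subalgebra_natural_filtration:
  assumes "\<And>s. 0 \<le> s \<Longrightarrow> B s \<in> borel_measurable M"
  shows "subalgebra M (natural_filtration M B t)"
  unfolding subalgebra_def
proof (intro conjI)
  show "sets (natural_filtration M B t) \<subseteq> sets M"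
    unfolding sets_natural_filtration
    using assms by (intro sets.sigma_sets_subset) (auto intro: measurable_sets)
qed simp

lemma filtered_natural_filtration:
  assumes "prob_space M" "complete_measure M" "\<And>s. 0 \<le> s \<Longrightarrow> B s \<in> borel_measurable M"
  shows "filtered_prob_space M (natural_filtration M B)"
  unfolding filtered_prob_space_def
proof (intro conjI allI impI)
  show "subalgebra M (natural_filtration M B t)" for t
    using assms(3) by (rule subalgebra_natural_filtration)
  show "sets (natural_filtration M B s) \<subseteq> sets (natural_filtration M B t)" if "0 \<le> s \<and> s \<le> t" for s t
    using that by (intro natural_filtration_mono) simp
  show "null_sets M \<subseteq> sets (natural_filtration M B 0)"
    by (rule null_sets_natural_filtration)
qed (use assms in auto)

text \<open>The cylinder sets, up to null sets, are closed under intersection and generate the filtration.\<close>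

lemma (in prob_space) natural_filtration_indep:
  fixes B :: "real \<Rightarrow> 'a \<Rightarrow> real" and Y :: "'a \<Rightarrow> real"
  assumes B: "\<And>s. 0 \<le> s \<Longrightarrow> B s \<in> borel_measurable M" and Y: "Y \<in> borel_measurable M"
    and fac: "\<And>n r \<theta> \<eta>. (\<And>i. i < n \<Longrightarrow> 0 \<le> r i \<and> r i \<le> s) \<Longrightarrow>
        (\<integral>\<omega>. cis (\<theta> * Y \<omega> + (\<Sum>i<n. \<eta> i * B (r i) \<omega>)) \<partial>M)
        = (\<integral>\<omega>. cis (\<theta> * Y \<omega>) \<partial>M) * (\<integral>\<omega>. cis (\<Sum>i<(n::nat). \<eta> i * B (r i) \<omega>) \<partial>M)"
    and s: "0 \<le> s" and A: "A \<in> sets (natural_filtration M B s)" and C: "C \<in> sets borel"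
  shows "prob (A \<inter> {\<omega>\<in>space M. Y \<omega> \<in> C}) = prob A * prob {\<omega>\<in>space M. Y \<omega> \<in> C}"
proof -
  define YC where "YC = {\<omega>\<in>space M. Y \<omega> \<in> C}"
  have [measurable]: "YC \<in> sets M" unfolding YC_def using Y C by measurable
  define cyl where "cyl = {{\<omega>\<in>space M. \<forall>i<n. B (r i) \<omega> \<in> D i} | (n::nat) r D.
      \<forall>i<n. 0 \<le> r i \<and> r i \<le> s \<and> D i \<in> sets borel}"
  have cyl_sets: "G \<in> sets M" if "G \<in> cyl" for G
  proof -
    obtain n r D where G: "G = {\<omega>\<in>space M. \<forall>i<(n::nat). B (r i) \<omega> \<in> D i}"
      "\<forall>i<n. 0 \<le> r i \<and> r i \<le> s \<and> D i \<in> sets borel"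
      using \<open>G \<in> cyl\<close> unfolding cyl_def by blast
    have "{\<omega>\<in>space M. B (r i) \<omega> \<in> D i} \<in> sets M" if "i < n" for i
      using measurable_sets[OF B, of "r i" "D i"] G that by (simp add: vimage_def Int_def conj_commute)
    then have "{\<omega>\<in>space M. \<forall>i\<in>{..<n}. B (r i) \<omega> \<in> D i} \<in> sets M"
      by (intro sets.sets_Collect_finite_All) auto
    moreover have "G = {\<omega>\<in>space M. \<forall>i\<in>{..<n}. B (r i) \<omega> \<in> D i}" by (auto simp: G)
    ultimately show ?thesis by simp
  qed
  have cyl_indep: "prob (G \<inter> YC) = prob G * prob YC" if G: "G \<in> cyl" for G
  proof -
    obtain n r D where G: "G = {\<omega>\<in>space M. \<forall>i<(n::nat). B (r i) \<omega> \<in> D i}"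
      "\<And>i. i < n \<Longrightarrow> 0 \<le> r i \<and> r i \<le> s" "\<And>i. i < n \<Longrightarrow> D i \<in> sets borel"
      using G unfolding cyl_def by blast
    have "prob {\<omega>\<in>space M. (\<forall>i<n. B (r i) \<omega> \<in> D i) \<and> Y \<omega> \<in> C}
      = prob {\<omega>\<in>space M. \<forall>i<n. B (r i) \<omega> \<in> D i} * prob {\<omega>\<in>space M. Y \<omega> \<in> C}"
      by (rule indep_cylinder_of_char[OF Y]) (use B G fac C in auto)
    moreover have "G \<inter> YC = {\<omega>\<in>space M. (\<forall>i<n. B (r i) \<omega> \<in> D i) \<and> Y \<omega> \<in> C}"
      by (auto simp: G YC_def)
    ultimately show ?thesis by (simp add: G YC_def)
  qed
  have cyl_Int: "G \<inter> H \<in> cyl" if "G \<in> cyl" "H \<in> cyl" for G H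
  proof -
    obtain n r D where G: "G = {\<omega>\<in>space M. \<forall>i<(n::nat). B (r i) \<omega> \<in> D i}"
      "\<forall>i<n. 0 \<le> r i \<and> r i \<le> s \<and> D i \<in> sets borel"
      using \<open>G \<in> cyl\<close> unfolding cyl_def by blast
    obtain n' r' D' where H: "H = {\<omega>\<in>space M. \<forall>i<(n'::nat). B (r' i) \<omega> \<in> D' i}"
      "\<forall>i<n'. 0 \<le> r' i \<and> r' i \<le> s \<and> D' i \<in> sets borel"
      using \<open>H \<in> cyl\<close> unfolding cyl_def by blast
    \<comment> \<open>Two cylinders are intersected by concatenating their lists of times and
      constraints; repeated times are allowed.\<close>
    define r'' where "r'' i = (if i < n then r i else r' (i - n))" for i
    define D'' where "D'' i = (if i < n then D i else D' (i - n))" for i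
    have all: "(\<forall>i<n + n'. P (r'' i) (D'' i)) \<longleftrightarrow> (\<forall>i<n. P (r i) (D i)) \<and> (\<forall>i<n'. P (r' i) (D' i))" for P
    proof safe
      fix i assume "\<forall>i<n + n'. P (r'' i) (D'' i)" "i < n'"
      then have "P (r'' (n + i)) (D'' (n + i))" by auto
      then show "P (r' i) (D' i)" by (simp add: r''_def D''_def)
    next
      fix i assume *: "\<forall>i<n + n'. P (r'' i) (D'' i)" "i < n"
      then have "P (r'' i) (D'' i)" by auto
      then show "P (r i) (D i)" using * by (simp add: r''_def D''_def)
    qed (auto simp: r''_def D''_def)
    have "G \<inter> H = {\<omega>\<in>space M. \<forall>i<n + n'. B (r'' i) \<omega> \<in> D'' i}"
      unfolding G H all[of "\<lambda>a b. B a _ \<in> b"] by auto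
    moreover have "\<forall>i<n + n'. 0 \<le> r'' i \<and> r'' i \<le> s \<and> D'' i \<in> sets borel"
      using all[of "\<lambda>a b. 0 \<le> a \<and> a \<le> s \<and> b \<in> sets borel"] G H by blast
    ultimately show ?thesis unfolding cyl_def by blast
  qed
  \<comment> \<open>Working modulo null sets brings the null sets of the augmentation into an
    intersection-stable generator: each of them agrees almost everywhere with the empty
    cylinder.\<close>
  define Gen where "Gen = {G \<in> sets M. \<exists>H\<in>cyl. AE \<omega> in M. \<omega> \<in> G \<longleftrightarrow> \<omega> \<in> H}"
  have sub: "{B r -` D \<inter> space M | r D. 0 \<le> r \<and> r \<le> s \<and> D \<in> sets borel} \<union> null_sets M \<subseteq> Gen"
  proof safe
    fix r and D :: "real set" assume r: "0 \<le> r" "r \<le> s" "D \<in> sets borel"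
    have "B r -` D \<inter> space M \<in> cyl"
      unfolding cyl_def using r
      by (intro CollectI exI[of _ "1::nat"] exI[of _ "\<lambda>_. r"] exI[of _ "\<lambda>_. D"]) auto
    then show "B r -` D \<inter> space M \<in> Gen" unfolding Gen_def using cyl_sets by blast
  next
    fix N assume N: "N \<in> null_sets M"
    have "{} \<in> cyl"
      unfolding cyl_def using s
      by (intro CollectI exI[of _ "1::nat"] exI[of _ "\<lambda>_. 0"] exI[of _ "\<lambda>_. {}"]) auto
    then show "N \<in> Gen" unfolding Gen_def using N AE_not_in[OF N] by (auto intro!: bexI[of _ "{}"])
  qed
  have A': "A \<in> sigma_sets (space M) Gen"
    using A sigma_sets_mono'[OF sub] unfolding sets_natural_filtration by auto
  have Gen_sets: "sigma_sets (space M) Gen \<subseteq> sets M"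
    by (rule sets.sigma_sets_subset) (auto simp: Gen_def)
  have "Int_stable Gen"
  proof (rule Int_stableI)
    fix G1 G2 assume "G1 \<in> Gen" "G2 \<in> Gen"
    then obtain H1 H2 where H: "H1 \<in> cyl" "H2 \<in> cyl" "AE \<omega> in M. \<omega> \<in> G1 \<longleftrightarrow> \<omega> \<in> H1" "AE \<omega> in M. \<omega> \<in> G2 \<longleftrightarrow> \<omega> \<in> H2"
      and G: "G1 \<in> sets M" "G2 \<in> sets M" unfolding Gen_def by blast
    from H(3,4) have "AE \<omega> in M. \<omega> \<in> G1 \<inter> G2 \<longleftrightarrow> \<omega> \<in> H1 \<inter> H2" by eventually_elim auto
    then show "G1 \<inter> G2 \<in> Gen" unfolding Gen_def using cyl_Int[OF H(1,2)] G by blast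
  qed
  moreover have "Gen \<subseteq> Pow (space M)" by (auto simp: Gen_def dest: sets.sets_into_space)
  ultimately have "prob (A \<inter> YC) = prob A * prob YC"
    using A'
  proof (induction rule: sigma_sets_induct_disjoint)
    case (basic G)
    then obtain H where H: "H \<in> cyl" "AE \<omega> in M. \<omega> \<in> G \<longleftrightarrow> \<omega> \<in> H" and G: "G \<in> sets M"
      unfolding Gen_def by blast
    have [measurable]: "H \<in> sets M" "G \<in> sets M" using cyl_sets H G by auto
    have "prob G = prob H" using H(2) by (intro measure_eq_AE) auto
    moreover have "prob (G \<inter> YC) = prob (H \<inter> YC)"
      using H(2) by (intro measure_eq_AE) (auto elim: eventually_mono)
    ultimately show ?case using cyl_indep[OF H(1)] by simp
  next
    case (compl G)
    then have [measurable]: "G \<in> sets M" using Gen_sets by auto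
    have "(space M - G) \<inter> YC = YC - G \<inter> YC" by (auto simp: YC_def)
    then have "prob ((space M - G) \<inter> YC) = prob YC - prob (G \<inter> YC)"
      by (simp add: finite_measure_Diff)
    also have "\<dots> = (1 - prob G) * prob YC" using compl by (simp add: algebra_simps)
    finally show ?case by (simp add: prob_compl)
  next
    case (union G)
    have [measurable]: "G i \<in> sets M" for i using union Gen_sets by auto
    have "(\<lambda>i. prob (G i \<inter> YC)) sums prob (\<Union>i. G i \<inter> YC)"
      using union(1) by (intro finite_measure_UNION) (auto simp: disjoint_family_on_def)
    moreover have "(\<lambda>i. prob (G i) * prob YC) sums (prob (\<Union>i. G i) * prob YC)"
      using union(1) by (intro sums_mult2 finite_measure_UNION) auto
    ultimately have "prob (\<Union>i. G i \<inter> YC) = prob (\<Union>i. G i) * prob YC"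
      using union(3) by (auto intro: sums_unique2)
    moreover have "(\<Union>i. G i) \<inter> YC = (\<Union>i. G i \<inter> YC)" by auto
    ultimately show ?case by (simp only:)
  qed simp
  then show ?thesis by (simp add: YC_def)
qed

section \<open>Levy--Ciesielski construction of Brownian motion\<close>

definition tent :: "real \<Rightarrow> real" where
  "tent x = max 0 (1 - \<bar>2 * x - 1\<bar>)"

definition clamp01 :: "real \<Rightarrow> real" where
  "clamp01 x = max 0 (min 1 x)"

text \<open>Covariance of the Brownian bridge on the unit interval. Clamping makes it vanish unless
  both arguments lie strictly inside the interval, so rescaled copies on dyadic cells can be added
  over all cells at once.\<close>

definition bridge_cov :: "real \<Rightarrow> real \<Rightarrow> real" where
  "bridge_cov x y = min (clamp01 x) (clamp01 y) - clamp01 x * clamp01 y"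

lemma tent_cases:
  "x \<le> 0 \<Longrightarrow> tent x = 0" "0 \<le> x \<Longrightarrow> x \<le> 1 / 2 \<Longrightarrow> tent x = 2 * x"
  "1 / 2 \<le> x \<Longrightarrow> x \<le> 1 \<Longrightarrow> tent x = 2 - 2 * x" "1 \<le> x \<Longrightarrow> tent x = 0"
  by (auto simp: tent_def abs_if max_def)

lemma clamp01_cases:
  "x \<le> 0 \<Longrightarrow> clamp01 x = 0" "0 \<le> x \<Longrightarrow> x \<le> 1 \<Longrightarrow> clamp01 x = x" "1 \<le> x \<Longrightarrow> clamp01 x = 1"
  by (auto simp: clamp01_def)

lemma bridge_cov_outside:
  "x \<le> 0 \<or> 1 \<le> x \<or> y \<le> 0 \<or> 1 \<le> y \<Longrightarrow> bridge_cov x y = 0"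
  by (auto simp: bridge_cov_def clamp01_def min_def max_def)

lemma bridge_cov_commute: "bridge_cov x y = bridge_cov y x"
  by (simp add: bridge_cov_def min.commute mult.commute)

lemma bridge_cov_le:
  assumes "0 \<le> x" "x \<le> y" "y \<le> 1"
  shows "bridge_cov x y = x * (1 - y)"
  using assms by (simp add: bridge_cov_def clamp01_cases algebra_simps)

lemma bridge_cov_bound: "\<bar>bridge_cov x y\<bar> \<le> 1"
proof -
  have c: "0 \<le> clamp01 z" "clamp01 z \<le> 1" for z by (auto simp: clamp01_def)
  have "0 \<le> clamp01 x * clamp01 y" "clamp01 x * clamp01 y \<le> 1"
    using c[of x] c[of y] by (auto intro: mult_le_one)
  then show ?thesis using c[of x] c[of y] unfolding bridge_cov_def by linarith
qed

text \<open>Self-similarity of the covariance of the Brownian bridge: conditionally on the value at the midpoint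
  the two halves are independent bridges. Iterating it is the Levy--Ciesielski expansion.\<close>

lemma bridge_cov_split:
  "bridge_cov x y = tent x * tent y / 4 + (bridge_cov (2 * x) (2 * y) + bridge_cov (2 * x - 1) (2 * y - 1)) / 2"
proof -
  \<comment> \<open>The first term is the contribution of the midpoint, whose variance is
    \<open>1 / 4\<close>; each half is a bridge over half the time, whence the factor
    \<open>1 / 2\<close>. For arguments on different sides of \<open>1 / 2\<close> both half-bridge
    terms vanish.\<close>
  have *: "bridge_cov x y = tent x * tent y / 4 + (bridge_cov (2 * x) (2 * y) + bridge_cov (2 * x - 1) (2 * y - 1)) / 2"
    if xy: "x \<le> y" for x y
  proof -
    consider "x \<le> 0" | "1 \<le> y" | "0 \<le> x" "y \<le> 1 / 2" | "0 \<le> x" "x \<le> 1 / 2" "1 / 2 \<le> y" "y \<le> 1" | "1 / 2 \<le> x" "y \<le> 1"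
      by linarith
    then show ?thesis
    proof cases
      case 1
      then show ?thesis by (simp add: bridge_cov_outside tent_cases)
    next
      case 2
      then show ?thesis by (simp add: bridge_cov_outside tent_cases)
    next
      case 3
      then have "bridge_cov (2 * x - 1) (2 * y - 1) = 0" by (intro bridge_cov_outside) auto
      then show ?thesis using 3 xy by (simp add: bridge_cov_le tent_cases field_simps)
    next
      case 4
      then have "bridge_cov (2 * x - 1) (2 * y - 1) = 0" "bridge_cov (2 * x) (2 * y) = 0"
        by (auto intro!: bridge_cov_outside)
      then show ?thesis using 4 xy by (simp add: bridge_cov_le tent_cases field_simps)
    next
      case 5
      then have "bridge_cov (2 * x) (2 * y) = 0" by (intro bridge_cov_outside) auto
      then show ?thesis using 5 xy by (simp add: bridge_cov_le tent_cases field_simps)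
    qed
  qed
  show ?thesis
  proof (cases "x \<le> y")
    case False
    then have "bridge_cov y x = tent y * tent x / 4 + (bridge_cov (2 * y) (2 * x) + bridge_cov (2 * y - 1) (2 * x - 1)) / 2"
      by (intro *) simp
    then show ?thesis by (simp add: bridge_cov_commute mult.commute)
  qed (rule *)
qed

section \<open>Dyadic expansion of the bridge covariance\<close>

lemma sum_even_odd: "(\<Sum>k<2 * m. f k) = (\<Sum>k<m. f (2 * k) + f (2 * k + 1 :: nat))"
  for f :: "nat \<Rightarrow> real"
  by (induction m) (auto simp: algebra_simps)

lemma sum_le_single:
  fixes f :: "nat \<Rightarrow> real"
  assumes "\<And>k. k < m \<Longrightarrow> \<bar>f k\<bar> \<le> (if k = k0 then 1 else 0)"
  shows "(\<Sum>k<m. \<bar>f k\<bar>) \<le> 1"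
proof -
  have "(\<Sum>k<m. \<bar>f k\<bar>) \<le> (\<Sum>k<m. if k = k0 then 1 else 0)" using assms by (intro sum_mono) auto
  also have "\<dots> \<le> 1" by (simp add: sum.delta)
  finally show ?thesis .
qed

lemma unit_cell:
  assumes "0 < x - real k" "x - real k < 1"
  shows "k = nat \<lfloor>x\<rfloor>"
proof -
  have "\<lfloor>x\<rfloor> = int k" using assms by (intro floor_unique) auto
  then show ?thesis by simp
qed

text \<open>The hat has height \<open>1\<close> and is positive only inside the unit interval; so at
  most one of its integer translates is nonzero at \<open>x\<close>.\<close>

lemma sum_tent_le: "(\<Sum>k<m. tent (x - real k)) \<le> 1"
proof -
  have "\<bar>tent (x - real k)\<bar> \<le> (if k = nat \<lfloor>x\<rfloor> then 1 else 0)" for k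
  proof (cases "0 < x - real k \<and> x - real k < 1")
    case True
    then show ?thesis using unit_cell[of x k] by (simp add: tent_def)
  next
    case False
    then have "tent (x - real k) = 0" using tent_cases(1,4)[of "x - real k"] by linarith
    then show ?thesis by simp
  qed
  from sum_le_single[of m "\<lambda>k. tent (x - real k)", OF this] show ?thesis by (simp add: tent_def)
qed

text \<open>Hat over the dyadic cell from \<open>k / 2 ^ j\<close> to
  \<open>(k + 1) / 2 ^ j\<close>, scaled by the standard deviation at the midpoint of a bridge over
  this cell: the variance there is a quarter of the cell length \<open>1 / 2 ^ j\<close>.\<close>

definition schauder_coeff :: "nat \<Rightarrow> nat \<Rightarrow> real \<Rightarrow> real" where
  "schauder_coeff j k u = tent (2 ^ j * u - real k) / (2 * sqrt (2 ^ j))"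

definition cov_partial :: "nat \<Rightarrow> real \<Rightarrow> real \<Rightarrow> real" where
  "cov_partial N u v = (\<Sum>j<N. \<Sum>k<2 ^ j. schauder_coeff j k u * schauder_coeff j k v)"

text \<open>The self-similarity is iterated. The halves of cell \<open>k\<close> are the cells
  \<open>2 * k\<close> and \<open>2 * k + 1\<close> of the next level, so the remainder keeps its
  form.\<close>

lemma cov_partial_eq:
  "bridge_cov u v = cov_partial N u v
     + (\<Sum>k<2 ^ N. bridge_cov (2 ^ N * u - real k) (2 ^ N * v - real k)) / 2 ^ N"
proof (induction N)
  case (Suc N)
  let ?x = "\<lambda>k. 2 ^ N * u - real k" and ?y = "\<lambda>k. 2 ^ N * v - real k"
  have "(\<Sum>k<2 ^ N. bridge_cov (?x k) (?y k)) / 2 ^ N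
    = (\<Sum>k<2 ^ N. schauder_coeff N k u * schauder_coeff N k v)
      + (\<Sum>k<2 ^ N. bridge_cov (2 * ?x k) (2 * ?y k) + bridge_cov (2 * ?x k - 1) (2 * ?y k - 1)) / 2 ^ Suc N"
    by (subst bridge_cov_split)
       (simp add: sum.distrib sum_divide_distrib schauder_coeff_def add_divide_distrib)
  also have "(\<Sum>k<2 ^ N. bridge_cov (2 * ?x k) (2 * ?y k) + bridge_cov (2 * ?x k - 1) (2 * ?y k - 1))
    = (\<Sum>k<2 * 2 ^ N. bridge_cov (2 ^ Suc N * u - real k) (2 ^ Suc N * v - real k))"
    by (subst sum_even_odd) (simp add: algebra_simps)
  finally show ?case using Suc by (simp add: cov_partial_def)
qed (auto simp: cov_partial_def)

text \<open>In the remainder only the cell containing \<open>2 ^ N * u\<close> can contribute, with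
  a covariance bounded by \<open>1\<close>; the factor \<open>1 / 2 ^ N\<close> does the
  rest.\<close>

lemma cov_partial_tendsto: "(\<lambda>N. cov_partial N u v) \<longlonglongrightarrow> bridge_cov u v"
proof -
  have "\<bar>cov_partial N u v - bridge_cov u v\<bar> \<le> (1 / 2) ^ N" for N
  proof -
    let ?S = "\<Sum>k<2 ^ N. bridge_cov (2 ^ N * u - real k) (2 ^ N * v - real k)"
    have "\<bar>bridge_cov (2 ^ N * u - real k) (2 ^ N * v - real k)\<bar> \<le> (if k = nat \<lfloor>2 ^ N * u\<rfloor> then 1 else 0)" for k
    proof (cases "0 < 2 ^ N * u - real k \<and> 2 ^ N * u - real k < 1")
      case True
      then show ?thesis using unit_cell[of "2 ^ N * u" k] bridge_cov_bound by simp
    next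
      case False
      then have "bridge_cov (2 ^ N * u - real k) (2 ^ N * v - real k) = 0"
        by (intro bridge_cov_outside) linarith
      then show ?thesis by simp
    qed
    then have "(\<Sum>k<2 ^ N. \<bar>bridge_cov (2 ^ N * u - real k) (2 ^ N * v - real k)\<bar>) \<le> 1"
      by (intro sum_le_single)
    then have "\<bar>?S\<bar> \<le> 1" by (rule order_trans[OF sum_abs])
    then have "\<bar>?S / 2 ^ N\<bar> \<le> 1 / 2 ^ N" by (simp add: abs_divide divide_right_mono)
    then show ?thesis using cov_partial_eq[of u v N] by (simp add: power_one_over)
  qed
  then have le: "\<forall>\<^sub>F N in sequentially. norm (cov_partial N u v - bridge_cov u v) \<le> (1 / 2) ^ N"
    by simp
  have "(\<lambda>N. cov_partial N u v - bridge_cov u v) \<longlonglongrightarrow> 0"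
    by (rule Lim_null_comparison[OF le LIMSEQ_realpow_zero]) auto
  then show ?thesis by (rule LIM_zero_cancel)
qed

section \<open>Uniform convergence of the bridge series\<close>

definition bridge_level :: "(nat \<Rightarrow> real) \<Rightarrow> nat \<Rightarrow> real \<Rightarrow> real" where
  "bridge_level z j u = (\<Sum>k<2 ^ j. z (prod_encode (j, k)) * schauder_coeff j k u)"

text \<open>The exponent \<open>j / 4\<close> leaves room on both sides: the hats of level
  \<open>j\<close> have height of order \<open>2 powr (- (j / 2))\<close>, so the levels are bounded
  by a geometric sequence; and eighth moments of Gaussian coefficients make the probability of a
  violation at level \<open>j\<close> summable over \<open>j\<close>.\<close>

definition tame :: "(nat \<Rightarrow> real) \<Rightarrow> bool" where
  "tame z \<longleftrightarrow> (\<forall>\<^sub>F j in sequentially. \<forall>k<2 ^ j. \<bar>z (prod_encode (j, k))\<bar> \<le> 2 powr (j / 4))"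

definition bridge :: "(nat \<Rightarrow> real) \<Rightarrow> real \<Rightarrow> real" where
  "bridge z u = (\<Sum>j. bridge_level z j u)"

lemma bridge_level_bound:
  assumes "\<forall>k<2 ^ j. \<bar>z (prod_encode (j, k))\<bar> \<le> 2 powr (j / 4)"
  shows "\<bar>bridge_level z j u\<bar> \<le> (2 powr (- (1 / 4))) ^ j"
proof -
  have "\<bar>bridge_level z j u\<bar> \<le> (\<Sum>k<2 ^ j. 2 powr (j / 4) * (tent (2 ^ j * u - real k) / (2 * sqrt (2 ^ j))))"
    unfolding bridge_level_def schauder_coeff_def using assms
    by (intro order_trans[OF sum_abs] sum_mono) (auto simp: abs_mult tent_def intro!: mult_right_mono divide_right_mono)
  also have "\<dots> = 2 powr (j / 4) / (2 * sqrt (2 ^ j)) * (\<Sum>k<2 ^ j. tent (2 ^ j * u - real k))"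
    by (simp add: sum_distrib_left sum_divide_distrib)
  also have "\<dots> \<le> 2 powr (j / 4) / (2 * sqrt (2 ^ j)) * 1"
    by (intro mult_left_mono sum_tent_le) auto
  also have "\<dots> \<le> 2 powr (j / 4) / sqrt (2 ^ j)"
    by (simp add: field_simps)
  also have "sqrt (2 ^ j) = 2 powr (j / 2)"
    by (simp add: powr_half_sqrt[symmetric] powr_realpow[symmetric] powr_powr)
  also have "2 powr (j / 4) / 2 powr (j / 2) = 2 powr (- (1 / 4) * j)"
    by (simp add: powr_diff[symmetric])
  also have "\<dots> = (2 powr (- (1 / 4))) ^ j" by (subst powr_realpow[symmetric]) (simp_all add: powr_powr)
  finally show ?thesis .
qed

lemma continuous_bridge_level: "continuous_on A (bridge_level z j)"
  unfolding bridge_level_def[abs_def] schauder_coeff_def tent_def by (intro continuous_intros) auto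

lemma bridge_uniform_limit:
  assumes "tame z"
  shows "uniform_limit UNIV (\<lambda>N u. \<Sum>j<N. bridge_level z j u) (bridge z) sequentially"
  unfolding bridge_def[abs_def]
proof (rule Weierstrass_m_test_ev)
  show "\<forall>\<^sub>F j in sequentially. \<forall>u\<in>UNIV. norm (bridge_level z j u) \<le> (2 powr (- (1 / 4))) ^ j"
    using assms unfolding tame_def by eventually_elim (auto intro: bridge_level_bound)
  have "2 powr (- (1 / 4)) < (2::real) powr 0" by (intro powr_less_mono) auto
  then show "summable (\<lambda>j. (2 powr (- (1 / 4))) ^ j :: real)" by (intro summable_geometric) simp
qed

lemma continuous_bridge:
  assumes "tame z"
  shows "continuous_on A (bridge z)"
  by (rule continuous_on_subset[OF uniform_limit_theorem[OF _ bridge_uniform_limit[OF assms]]])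
     (auto intro!: always_eventually continuous_on_sum continuous_bridge_level)

lemma bridge_tendsto:
  assumes "tame z"
  shows "(\<lambda>N. \<Sum>j<N. bridge_level z j u) \<longlonglongrightarrow> bridge z u"
  using tendsto_uniform_limitI[OF bridge_uniform_limit[OF assms]] by auto

section \<open>Independent Gaussian coefficients\<close>

definition gauss_seq :: "(nat \<Rightarrow> real) measure" where
  "gauss_seq = (\<Pi>\<^sub>M n\<in>UNIV. std_normal_distribution)"

interpretation gauss: product_prob_space "\<lambda>_::nat. std_normal_distribution" UNIV
  by (intro product_prob_spaceI prob_space_normal_density) simp

lemma prob_space_gauss_seq: "prob_space gauss_seq"
  unfolding gauss_seq_def by (rule gauss.P.prob_space_axioms)

lemma measurable_gauss_coord [measurable]: "(\<lambda>z. z n) \<in> borel_measurable gauss_seq"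
proof -
  have "(\<lambda>z. z n) \<in> measurable gauss_seq std_normal_distribution"
    unfolding gauss_seq_def by (rule measurable_component_singleton) simp
  then show ?thesis by (simp cong: measurable_cong_sets)
qed

lemma cis_sum: "finite I \<Longrightarrow> cis (\<Sum>i\<in>I. f i) = (\<Prod>i\<in>I. cis (f i))"
  by (induction I rule: finite_induct) (auto simp: cis_mult[symmetric])

lemma gauss_seq_char:
  assumes I: "finite I"
  shows "(\<integral>z. cis (\<Sum>n\<in>I. c n * z n) \<partial>gauss_seq) = of_real (exp (- (\<Sum>n\<in>I. (c n)\<^sup>2) / 2))"
proof -
  let ?P = "\<Pi>\<^sub>M n\<in>I. std_normal_distribution"
  have [measurable]: "(\<lambda>x. x n) \<in> borel_measurable ?P" if "n \<in> I" for n
  proof -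
    have "(\<lambda>x. x n) \<in> measurable ?P std_normal_distribution"
      using that by (rule measurable_component_singleton)
    then show ?thesis by (simp cong: measurable_cong_sets)
  qed
  have "(\<integral>z. cis (\<Sum>n\<in>I. c n * z n) \<partial>gauss_seq) = (\<integral>z. (\<Prod>n\<in>I. cis (c n * restrict z I n)) \<partial>gauss_seq)"
    using I by (simp add: cis_sum)
  also have "\<dots> = (\<integral>x. (\<Prod>n\<in>I. cis (c n * x n)) \<partial>distr gauss_seq ?P (\<lambda>z. restrict z I))"
    unfolding gauss_seq_def
  proof (rule integral_distr[symmetric])
    show "(\<lambda>z. restrict z I) \<in> (\<Pi>\<^sub>M n\<in>UNIV. std_normal_distribution) \<rightarrow>\<^sub>M ?P"
      by (rule measurable_restrict_subset) simp
  qed (auto intro!: borel_measurable_prod borel_measurable_cis borel_measurable_times)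
  also have "distr gauss_seq ?P (\<lambda>z. restrict z I) = ?P"
    unfolding gauss_seq_def using I by (intro gauss.distr_PiM_restrict_finite) auto
  also have "(\<integral>x. (\<Prod>n\<in>I. cis (c n * x n)) \<partial>?P) = (\<Prod>n\<in>I. \<integral>x. cis (c n * x) \<partial>std_normal_distribution)"
  proof (rule gauss.product_integral_prod[OF I])
    show "integrable std_normal_distribution (\<lambda>x. cis (c n * x))" for n
      by (rule gauss.M.integrable_const_bound[where B=1]) auto
  qed
  also have "\<dots> = (\<Prod>n\<in>I. of_real (exp (- (c n)\<^sup>2 / 2)))"
    by (simp add: char_eq_cis[symmetric] char_std_normal_distribution)
  also have "\<dots> = of_real (exp (- (\<Sum>n\<in>I. (c n)\<^sup>2) / 2))"
    using I by (simp add: of_real_prod[symmetric] exp_sum[symmetric] sum_negf[symmetric] sum_divide_distrib del: of_real_prod)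
  finally show ?thesis .
qed

text \<open>Markov's inequality for the eighth moment, which is \<open>105 = 3 * 5 * 7\<close>. At
  \<open>x = 2 powr (j / 4)\<close> the denominator is \<open>4 ^ j\<close>, enough against the
  \<open>2 ^ j\<close> coefficients of level \<open>j\<close>; the fourth moment would only give
  \<open>2 ^ j\<close>.\<close>

lemma gauss_tail:
  assumes x: "0 < x"
  shows "measure gauss_seq {z\<in>space gauss_seq. x < \<bar>z n\<bar>} \<le> 105 / x ^ 8"
proof -
  interpret G: prob_space gauss_seq by (rule prob_space_gauss_seq)
  have D: "distr gauss_seq std_normal_distribution (\<lambda>z. z n) = std_normal_distribution"
    unfolding gauss_seq_def by (rule gauss.PiM_component) simp
  have m: "(\<lambda>z. z n) \<in> measurable gauss_seq std_normal_distribution"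
    unfolding gauss_seq_def by (rule measurable_component_singleton) simp
  have i: "integrable gauss_seq (\<lambda>z. (z n) ^ (2 * 4))"
    using std_normal_distribution_even_moments(2)[of 4] m
    by (subst (asm) D[symmetric], subst (asm) integrable_distr_eq) auto
  have e: "(\<integral>z. (z n) ^ (2 * 4) \<partial>gauss_seq) = 105"
  proof -
    have "(\<integral>z. (z n) ^ (2 * 4) \<partial>gauss_seq)
      = (\<integral>x. x ^ (2 * 4) \<partial>distr gauss_seq std_normal_distribution (\<lambda>z. z n))"
      using m by (intro integral_distr[symmetric]) auto
    also have "\<dots> = fact (2 * 4) / (2 ^ 4 * fact 4)"
      unfolding D by (rule std_normal_distribution_even_moments(1))
    also have "\<dots> = 105" by (simp add: fact_numeral)
    finally show ?thesis .
  qed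
  have "measure gauss_seq {z\<in>space gauss_seq. x < \<bar>z n\<bar>}
    \<le> measure gauss_seq {z\<in>space gauss_seq. x ^ (2 * 4) \<le> (z n) ^ (2 * 4)}"
  proof (rule G.finite_measure_mono)
    have "x ^ (2 * 4) \<le> y ^ (2 * 4)" if "x < \<bar>y\<bar>" for y
    proof -
      have "x ^ (2 * 4) \<le> \<bar>y\<bar> ^ (2 * 4)" using that x by (intro power_mono) auto
      then show ?thesis by (simp add: power_even_abs)
    qed
    then show "{z\<in>space gauss_seq. x < \<bar>z n\<bar>} \<subseteq> {z\<in>space gauss_seq. x ^ (2 * 4) \<le> (z n) ^ (2 * 4)}" by auto
  qed measurable
  also have "\<dots> \<le> (\<integral>z. (z n) ^ (2 * 4) \<partial>gauss_seq) / x ^ (2 * 4)"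
    using x by (intro integral_Markov_inequality_measure[OF i, of "{}"]) auto
  finally show ?thesis unfolding e by simp
qed

lemma AE_tame: "AE z in gauss_seq. tame z"
proof -
  interpret G: prob_space gauss_seq by (rule prob_space_gauss_seq)
  define A where "A j = (\<Union>k<2 ^ j. {z\<in>space gauss_seq. 2 powr (j / 4) < \<bar>z (prod_encode (j, k))\<bar>})" for j :: nat
  have [measurable]: "A j \<in> sets gauss_seq" for j unfolding A_def by measurable
  have A_le: "G.prob (A j) \<le> 105 * (1 / 2) ^ j" for j
  proof -
    have "(2 powr (real j / 4)) ^ 8 = (2::real) powr (2 * real j)"
      by (simp add: powr_realpow[symmetric] powr_powr)
    also have "\<dots> = 4 ^ j"
      by (simp add: powr_powr[symmetric] powr_realpow)
    finally have pw: "(2 powr (real j / 4)) ^ 8 = (4::real) ^ j" .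
    have "G.prob (A j) \<le> (\<Sum>k<2 ^ j. G.prob {z\<in>space gauss_seq. 2 powr (j / 4) < \<bar>z (prod_encode (j, k))\<bar>})"
      unfolding A_def by (rule G.finite_measure_subadditive_finite) auto
    also have "\<dots> \<le> (\<Sum>k<(2::nat) ^ j. 105 / 4 ^ j)"
      unfolding pw[symmetric] by (intro sum_mono gauss_tail) auto
    also have "\<dots> = 105 * (2 ^ j / 4 ^ j)" by simp
    also have "2 ^ j / 4 ^ j = (1 / 2 :: real) ^ j" by (simp add: power_divide[symmetric])
    finally show ?thesis .
  qed
  have "AE z in gauss_seq. eventually (\<lambda>j. z \<in> space gauss_seq - A j) sequentially"
  proof (rule borel_cantelli_AE1)
    show "summable (\<lambda>j. measure gauss_seq (A j))"
      by (rule summable_comparison_test'[where g="\<lambda>j. 105 * (1 / 2) ^ j" and N=0])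
         (use A_le in \<open>auto intro!: summable_mult summable_geometric\<close>)
  qed (auto simp: G.emeasure_eq_measure)
  then show ?thesis
  proof (rule AE_mp, intro AE_I2 impI)
    fix z assume "z \<in> space gauss_seq" "eventually (\<lambda>j. z \<in> space gauss_seq - A j) sequentially"
    from this(2) show "tame z" unfolding tame_def
      by eventually_elim (auto simp: A_def not_less)
  qed
qed

section \<open>Brownian motion on the half-line\<close>

definition bm_space :: "(nat \<Rightarrow> real) measure" where
  "bm_space = completion gauss_seq"

text \<open>If \<open>b\<close> is a Brownian bridge on \<open>[0,1]\<close> then \<open>(1 + t) * b (t / (1 + t))\<close> is a Brownian motion.\<close>

definition bm :: "real \<Rightarrow> (nat \<Rightarrow> real) \<Rightarrow> real" where
  "bm t z = (if tame z then (1 + t) * bridge z (t / (1 + t)) else 0)"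

lemma measurable_bm_gauss [measurable]: "bm t \<in> borel_measurable gauss_seq"
proof -
  have [measurable]: "Measurable.pred gauss_seq tame"
    unfolding tame_def eventually_sequentially by measurable
  have [measurable]: "(\<lambda>z. bridge_level z j u) \<in> borel_measurable gauss_seq" for j u
    unfolding bridge_level_def by measurable
  have [measurable]: "(\<lambda>z. bridge z u) \<in> borel_measurable gauss_seq" for u
    unfolding bridge_def by measurable
  show ?thesis unfolding bm_def[abs_def] by measurable
qed

lemma measurable_bm: "bm t \<in> borel_measurable bm_space"
  unfolding bm_space_def by (rule measurable_completion) (rule measurable_bm_gauss)

lemma prob_space_bm_space: "prob_space bm_space"
  unfolding bm_space_def using prob_space_gauss_seq by (rule prob_space.prob_space_completion)

lemma complete_measure_bm_space: "complete_measure bm_space"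
  unfolding bm_space_def by (rule completion.complete_measure_axioms)

text \<open>Every path is continuous, not just almost every one, because \<open>bm\<close> is set to
  \<open>0\<close> off the tame sequences.\<close>

lemma continuous_bm: "continuous_on {0..} (\<lambda>t. bm t z)"
proof (cases "tame z")
  case True
  have "continuous_on {0..} (\<lambda>t. bridge z (t / (1 + t)))"
    by (rule continuous_on_compose2[OF continuous_bridge[OF True, of UNIV]]) (auto intro!: continuous_intros)
  then show ?thesis using True unfolding bm_def by (auto intro!: continuous_intros)
qed (simp add: bm_def)

lemma bm_0: "bm 0 z = 0"
proof -
  have "bridge_level z j 0 = 0" for j
    unfolding bridge_level_def schauder_coeff_def by (simp add: tent_cases)
  then show ?thesis by (simp add: bm_def bridge_def)
qed

text \<open>For \<open>s \<le> t\<close> the bridge covariance at the transformed times is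
  \<open>s / (1 + s) * (1 / (1 + t))\<close>, and the prefactors cancel both denominators.\<close>

lemma bridge_cov_time_change:
  assumes "0 \<le> s" "0 \<le> t"
  shows "(1 + s) * (1 + t) * bridge_cov (s / (1 + s)) (t / (1 + t)) = min s t"
proof -
  have *: "(1 + s) * (1 + t) * bridge_cov (s / (1 + s)) (t / (1 + t)) = s" if "0 \<le> s" "s \<le> t" for s t
  proof -
    have "s / (1 + s) \<le> t / (1 + t)" using that by (simp add: field_simps)
    then have "bridge_cov (s / (1 + s)) (t / (1 + t)) = s / (1 + s) * (1 - t / (1 + t))"
      using that by (intro bridge_cov_le) auto
    also have "1 - t / (1 + t) = 1 / (1 + t)" using that by (simp add: field_simps)
    finally show ?thesis using that by simp
  qed
  show ?thesis
  proof (cases "s \<le> t")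
    case False
    then show ?thesis using *[of t s] assms by (simp add: bridge_cov_commute mult_ac)
  qed (use *[of s t] assms in auto)
qed

text \<open>Cutting the series at level \<open>N\<close> leaves a linear combination of finitely
  many independent standard Gaussians, whose variance is the quadratic form of
  \<open>cov_partial N\<close>. Both sides converge: the left by bounded convergence on tame
  sequences, the right by the covariance expansion. The factors \<open>1 + t i\<close> of the time
  change are absorbed in the coefficients \<open>b i\<close>.\<close>

lemma bm_char:
  fixes a t :: "'i \<Rightarrow> real"
  assumes I: "finite I" and t: "\<And>i. i \<in> I \<Longrightarrow> 0 \<le> t i"
  shows "(\<integral>z. cis (\<Sum>i\<in>I. a i * bm (t i) z) \<partial>bm_space)
    = of_real (exp (- (\<Sum>i\<in>I. \<Sum>j\<in>I. a i * a j * min (t i) (t j)) / 2))"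
proof -
  interpret G: prob_space gauss_seq by (rule prob_space_gauss_seq)
  define u where "u i = t i / (1 + t i)" for i
  define b where "b i = a i * (1 + t i)" for i
  define f where "f N z = (\<Sum>i\<in>I. b i * (\<Sum>j<N. bridge_level z j (u i)))" for N z
  define S where "S N = (SIGMA j:{..<N}. {..<(2::nat) ^ j})" for N
  define c where "c jk = (\<Sum>i\<in>I. b i * schauder_coeff (fst jk) (snd jk) (u i))" for jk
  have f_eq: "f N z = (\<Sum>n\<in>prod_encode ` S N. c (prod_decode n) * z n)" for N z
  proof -
    have "f N z = (\<Sum>i\<in>I. b i * (\<Sum>jk\<in>S N. z (prod_encode jk) * schauder_coeff (fst jk) (snd jk) (u i)))"
      unfolding f_def bridge_level_def S_def by (simp add: sum.Sigma case_prod_unfold)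
    also have "\<dots> = (\<Sum>jk\<in>S N. c jk * z (prod_encode jk))"
      unfolding c_def by (simp add: sum_distrib_left sum_distrib_right mult_ac sum.swap[of _ I "S N"])
    also have "\<dots> = (\<Sum>n\<in>prod_encode ` S N. c (prod_decode n) * z n)"
      by (subst sum.reindex) (auto intro: inj_prod_encode inj_on_subset)
    finally show ?thesis .
  qed
  have var: "(\<Sum>n\<in>prod_encode ` S N. (c (prod_decode n))\<^sup>2) = (\<Sum>i\<in>I. \<Sum>j\<in>I. b i * b j * cov_partial N (u i) (u j))" for N
  proof -
    have "(\<Sum>n\<in>prod_encode ` S N. (c (prod_decode n))\<^sup>2) = (\<Sum>jk\<in>S N. (c jk)\<^sup>2)"
      by (subst sum.reindex) (auto intro: inj_prod_encode inj_on_subset)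
    also have "\<dots> = (\<Sum>jk\<in>S N. \<Sum>i\<in>I. \<Sum>j\<in>I. b i * b j * (schauder_coeff (fst jk) (snd jk) (u i) * schauder_coeff (fst jk) (snd jk) (u j)))"
      unfolding c_def power2_eq_square sum_product by (simp add: mult_ac)
    also have "\<dots> = (\<Sum>i\<in>I. \<Sum>jk\<in>S N. \<Sum>j\<in>I. b i * b j * (schauder_coeff (fst jk) (snd jk) (u i) * schauder_coeff (fst jk) (snd jk) (u j)))"
      by (rule sum.swap)
    also have "\<dots> = (\<Sum>i\<in>I. \<Sum>j\<in>I. \<Sum>jk\<in>S N. b i * b j * (schauder_coeff (fst jk) (snd jk) (u i) * schauder_coeff (fst jk) (snd jk) (u j)))"
      by (intro sum.cong refl sum.swap)
    also have "\<dots> = (\<Sum>i\<in>I. \<Sum>j\<in>I. b i * b j * cov_partial N (u i) (u j))"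
      unfolding cov_partial_def S_def by (simp add: sum_distrib_left[symmetric] sum.Sigma case_prod_unfold)
    finally show ?thesis .
  qed
  have finS: "finite (prod_encode ` S N)" for N unfolding S_def by auto
  have [measurable]: "f N \<in> borel_measurable gauss_seq" for N
    unfolding f_eq[abs_def] by measurable
  have "(\<lambda>N. \<integral>z. cis (f N z) \<partial>gauss_seq) \<longlonglongrightarrow> (\<integral>z. cis (\<Sum>i\<in>I. a i * bm (t i) z) \<partial>gauss_seq)"
  proof (rule integral_dominated_convergence[where w="\<lambda>_. 1"])
    show "AE z in gauss_seq. (\<lambda>N. cis (f N z)) \<longlonglongrightarrow> cis (\<Sum>i\<in>I. a i * bm (t i) z)"
      using AE_tame
    proof eventually_elim
      case (elim z)
      have "(\<lambda>N. f N z) \<longlonglongrightarrow> (\<Sum>i\<in>I. b i * bridge z (u i))"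
        unfolding f_def by (intro tendsto_sum tendsto_mult tendsto_const bridge_tendsto elim)
      also have "(\<Sum>i\<in>I. b i * bridge z (u i)) = (\<Sum>i\<in>I. a i * bm (t i) z)"
        using elim by (simp add: bm_def b_def u_def mult_ac)
      finally show ?case by (rule tendsto_cis)
    qed
  qed auto
  moreover have "(\<lambda>N. \<integral>z. cis (f N z) \<partial>gauss_seq)
      \<longlonglongrightarrow> of_real (exp (- (\<Sum>i\<in>I. \<Sum>j\<in>I. b i * b j * bridge_cov (u i) (u j)) / 2))"
    unfolding f_eq gauss_seq_char[OF finS] var
    by (intro tendsto_of_real tendsto_exp tendsto_divide tendsto_minus tendsto_sum tendsto_mult tendsto_const
        cov_partial_tendsto) auto
  ultimately have "(\<integral>z. cis (\<Sum>i\<in>I. a i * bm (t i) z) \<partial>gauss_seq)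
    = of_real (exp (- (\<Sum>i\<in>I. \<Sum>j\<in>I. b i * b j * bridge_cov (u i) (u j)) / 2))"
    by (rule LIMSEQ_unique)
  also have "(\<Sum>i\<in>I. \<Sum>j\<in>I. b i * b j * bridge_cov (u i) (u j)) = (\<Sum>i\<in>I. \<Sum>j\<in>I. a i * a j * min (t i) (t j))"
  proof (intro sum.cong refl)
    fix i j assume "i \<in> I" "j \<in> I"
    from bridge_cov_time_change[OF t[OF this(1)] t[OF this(2)], symmetric]
    show "b i * b j * bridge_cov (u i) (u j) = a i * a j * min (t i) (t j)"
      by (simp add: b_def u_def mult_ac)
  qed
  finally show ?thesis
    unfolding bm_space_def by (subst integral_completion) auto
qed

lemma bm_increment_char:
  assumes st: "0 \<le> s" "s \<le> t" and r: "\<And>i. i < (n::nat) \<Longrightarrow> 0 \<le> r i \<and> r i \<le> s"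
  shows "(\<integral>z. cis (\<theta> * (bm t z - bm s z) + (\<Sum>i<n. \<eta> i * bm (r i) z)) \<partial>bm_space)
    = of_real (exp (- (\<theta>\<^sup>2 * (t - s)) / 2)) * of_real (exp (- (\<Sum>i<n. \<Sum>j<n. \<eta> i * \<eta> j * min (r i) (r j)) / 2))"
proof -
  \<comment> \<open>Two points are appended to the past times: \<open>t\<close> with coefficient
    \<open>\<theta>\<close> and \<open>s\<close> with coefficient \<open>- \<theta>\<close>. Every
    \<open>r i\<close> is at most \<open>s\<close>, so \<open>min (r i) t\<close> and
    \<open>min (r i) s\<close> are both \<open>r i\<close> and the cross terms cancel.\<close>
  define a where "a i = (if i < n then \<eta> i else if i = n then \<theta> else - \<theta>)" for i
  define \<tau> where "\<tau> i = (if i < n then r i else if i = n then t else s)" for i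
  have "(\<integral>z. cis (\<theta> * (bm t z - bm s z) + (\<Sum>i<n. \<eta> i * bm (r i) z)) \<partial>bm_space)
    = (\<integral>z. cis (\<Sum>i<Suc (Suc n). a i * bm (\<tau> i) z) \<partial>bm_space)"
    by (intro Bochner_Integration.integral_cong refl arg_cong[where f=cis])
       (simp add: a_def \<tau>_def algebra_simps)
  also have "\<dots> = of_real (exp (- (\<Sum>i<Suc (Suc n). \<Sum>j<Suc (Suc n). a i * a j * min (\<tau> i) (\<tau> j)) / 2))"
    using st r by (intro bm_char) (auto simp: \<tau>_def)
  also have "(\<Sum>i<Suc (Suc n). \<Sum>j<Suc (Suc n). a i * a j * min (\<tau> i) (\<tau> j))
    = \<theta>\<^sup>2 * (t - s) + (\<Sum>i<n. \<Sum>j<n. \<eta> i * \<eta> j * min (r i) (r j))"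
  proof -
    have m: "min (r i) t = r i" "min (r i) s = r i" "min t (r i) = r i" "min s (r i) = r i" if "i < n" for i
      using r[OF that] st by auto
    define row where "row i = (\<Sum>j<Suc (Suc n). a i * a j * min (\<tau> i) (\<tau> j))" for i
    have "row i = (\<Sum>j<n. \<eta> i * \<eta> j * min (r i) (r j))" if "i < n" for i
      using that by (simp add: row_def a_def \<tau>_def m)
    moreover have "row n = (\<Sum>j<n. \<theta> * \<eta> j * r j) + \<theta>\<^sup>2 * (t - s)"
      using st by (simp add: row_def a_def \<tau>_def m power2_eq_square algebra_simps)
    moreover have "row (Suc n) = - (\<Sum>j<n. \<theta> * \<eta> j * r j)"
      using st by (simp add: row_def a_def \<tau>_def m power2_eq_square algebra_simps sum_negf)
    ultimately have "(\<Sum>i<Suc (Suc n). row i) = \<theta>\<^sup>2 * (t - s) + (\<Sum>i<n. \<Sum>j<n. \<eta> i * \<eta> j * min (r i) (r j))"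
      by simp
    then show ?thesis unfolding row_def .
  qed
  finally show ?thesis
    by (simp add: of_real_mult[symmetric] exp_add[symmetric] add_divide_distrib diff_divide_distrib del: of_real_mult)
qed

lemma bm_indep:
  assumes st: "0 \<le> s" "s \<le> t"
    and A: "A \<in> sets (natural_filtration bm_space bm s)" and C: "C \<in> sets borel"
  shows "measure bm_space (A \<inter> {z\<in>space bm_space. bm t z - bm s z \<in> C})
    = measure bm_space A * measure bm_space {z\<in>space bm_space. bm t z - bm s z \<in> C}"
proof -
  interpret prob_space bm_space by (rule prob_space_bm_space)
  show ?thesis
  proof (rule natural_filtration_indep[OF measurable_bm _ _ st(1) A C])
    show "(\<lambda>z. bm t z - bm s z) \<in> borel_measurable bm_space"
      by (intro borel_measurable_diff measurable_bm)
    fix n :: nat and r \<theta> \<eta> assume r: "\<And>i. i < n \<Longrightarrow> 0 \<le> r i \<and> r i \<le> s"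
    \<comment> \<open>One formula yields all three factors: the joint one, that of the increment (no
      past times) and that of the past (\<open>\<theta> = 0\<close>).\<close>
    show "(\<integral>z. cis (\<theta> * (bm t z - bm s z) + (\<Sum>i<n. \<eta> i * bm (r i) z)) \<partial>bm_space)
      = (\<integral>z. cis (\<theta> * (bm t z - bm s z)) \<partial>bm_space) * (\<integral>z. cis (\<Sum>i<n. \<eta> i * bm (r i) z) \<partial>bm_space)"
      using bm_increment_char[OF st r, of n "\<lambda>i. i" \<theta> \<eta>] bm_increment_char[OF st, of 0 r \<theta> \<eta>]
        bm_increment_char[OF st r, of n "\<lambda>i. i" 0 \<eta>]
      by (simp add: bm_increment_char[OF st r])
  qed
qed

lemma bm_increment_distributed:
  assumes st: "0 \<le> s" "s < t"
  shows "distributed bm_space lborel (\<lambda>z. bm t z - bm s z) (\<lambda>x. ennreal (normal_density 0 (sqrt (t - s)) x))"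
proof -
  interpret prob_space bm_space by (rule prob_space_bm_space)
  define \<sigma> where "\<sigma> = sqrt (t - s)"
  have \<sigma>: "0 < \<sigma>" "\<sigma>\<^sup>2 = t - s" using st by (auto simp: \<sigma>_def)
  define Z where "Z z = (bm t z - bm s z) / \<sigma>" for z
  have Zm[measurable]: "Z \<in> borel_measurable bm_space"
    unfolding Z_def[abs_def] by (intro borel_measurable_divide borel_measurable_diff measurable_bm) simp
  have "distr bm_space borel Z = std_normal_distribution"
  proof (rule Levy_uniqueness)
    show "real_distribution (distr bm_space borel Z)" by (rule real_distribution_distr) simp
    show "char (distr bm_space borel Z) = char std_normal_distribution"
    proof
      fix \<theta>
      have "char (distr bm_space borel Z) \<theta> = (\<integral>z. cis ((\<theta> / \<sigma>) * (bm t z - bm s z)) \<partial>bm_space)"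
        unfolding char_eq_cis by (subst integral_distr) (auto simp: Z_def)
      also have "\<dots> = of_real (exp (- ((\<theta> / \<sigma>)\<^sup>2 * (t - s)) / 2))"
        using bm_increment_char[of s t 0 "\<lambda>_. 0" "\<theta> / \<sigma>" "\<lambda>_. 0"] st by simp
      also have "(\<theta> / \<sigma>)\<^sup>2 * (t - s) = \<theta>\<^sup>2" using \<sigma> by (simp add: power_divide flip: \<sigma>(2))
      finally show "char (distr bm_space borel Z) \<theta> = char std_normal_distribution \<theta>"
        by (simp add: char_std_normal_distribution)
    qed
  qed (rule real_dist_normal_dist)
  then have "distributed bm_space lborel Z std_normal_density"
    unfolding distributed_def by (auto simp: distr_cong[of bm_space bm_space lborel borel Z Z])
  then have "distributed bm_space lborel (\<lambda>z. ((bm t z - bm s z) - 0) / \<sigma>) std_normal_density"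
    by (simp add: Z_def[abs_def])
  then show ?thesis
    unfolding \<sigma>_def[symmetric]
    using normal_standard_normal_convert[OF \<sigma>(1), of "\<lambda>z. bm t z - bm s z" 0] by simp
qed

theorem brownian_motion_bm: "brownian_motion bm_space bm"
proof -
  interpret prob_space bm_space by (rule prob_space_bm_space)
  have "indep_vars (\<lambda>_. borel) (\<lambda>i z. bm (\<tau> (Suc i)) z - bm (\<tau> i) z) {..<n}"
    if \<tau>0: "0 \<le> \<tau> 0" and mono: "mono \<tau>" for n :: nat and \<tau>
  proof (cases "n = 0")
    case True
    then show ?thesis by (auto simp: indep_vars_def indep_sets_def)
  next
    case False
    define D where "D i z = bm (\<tau> (Suc i)) z - bm (\<tau> i) z" for i z
    have \<tau>: "0 \<le> \<tau> i" for i using \<tau>0 monoD[OF mono, of 0 i] by simp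
    have Dm: "D i \<in> borel_measurable bm_space" for i
      unfolding D_def[abs_def] by (intro borel_measurable_diff measurable_bm)
    \<comment> \<open>The increments are peeled off from the end: the event about the earlier ones
      lies in the filtration at \<open>\<tau> m\<close>, from which the next increment is
      independent.\<close>
    have prod: "prob {z\<in>space bm_space. \<forall>i<m. D i z \<in> A i} = (\<Prod>i<m. prob {z\<in>space bm_space. D i z \<in> A i})"
      if A: "\<And>i. A i \<in> sets borel" for A m
    proof (induction m)
      case 0
      then show ?case by (simp add: prob_space)
    next
      case (Suc m)
      let ?F = "natural_filtration bm_space bm (\<tau> m)"
      have "{z\<in>space bm_space. \<forall>i\<in>{..<m}. D i z \<in> A i} \<in> sets ?F"
      proof (cases "m = 0")
        case True
        then show ?thesis using sets.top[of ?F] by simp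
      next
        case False
        have "D i \<in> borel_measurable ?F" if "i < m" for i
          unfolding D_def[abs_def] using that \<tau> monoD[OF mono, of "Suc i" m] monoD[OF mono, of i m]
          by (intro borel_measurable_diff measurable_natural_filtration) auto
        then have "{z\<in>space bm_space. D i z \<in> A i} \<in> sets ?F" if "i < m" for i
          using measurable_sets[of "D i" ?F borel "A i"] A that by (simp add: vimage_def Int_def conj_commute)
        then have "{z\<in>space ?F. \<forall>i\<in>{..<m}. D i z \<in> A i} \<in> sets ?F"
          by (intro sets.sets_Collect_finite_All) auto
        then show ?thesis by simp
      qed
      then have "prob ({z\<in>space bm_space. \<forall>i\<in>{..<m}. D i z \<in> A i} \<inter> {z\<in>space bm_space. bm (\<tau> (Suc m)) z - bm (\<tau> m) z \<in> A m})
        = prob {z\<in>space bm_space. \<forall>i\<in>{..<m}. D i z \<in> A i} * prob {z\<in>space bm_space. bm (\<tau> (Suc m)) z - bm (\<tau> m) z \<in> A m}"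
        using \<tau> mono A by (intro bm_indep) (auto simp: mono_def)
      moreover have "{z\<in>space bm_space. \<forall>i<Suc m. D i z \<in> A i} = {z\<in>space bm_space. \<forall>i\<in>{..<m}. D i z \<in> A i} \<inter> {z\<in>space bm_space. bm (\<tau> (Suc m)) z - bm (\<tau> m) z \<in> A m}"
        by (auto simp: D_def less_Suc_eq)
      moreover have "{z\<in>space bm_space. \<forall>i\<in>{..<m}. D i z \<in> A i} = {z\<in>space bm_space. \<forall>i<m. D i z \<in> A i}" by auto
      ultimately show ?case using Suc by (simp add: D_def)
    qed
    have "indep_vars (\<lambda>_. borel) D {..<n} \<longleftrightarrow>
      (\<forall>A\<in>{..<n} \<rightarrow> sets borel. prob (\<Inter>j\<in>{..<n}. D j -` A j \<inter> space bm_space) = (\<Prod>j\<in>{..<n}. prob (D j -` A j \<inter> space bm_space)))"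
      using False Dm by (intro indep_vars_finite) (auto simp: Int_stable_def sets.sigma_sets_eq[of borel, simplified])
    moreover have "prob (\<Inter>j\<in>{..<n}. D j -` A j \<inter> space bm_space) = (\<Prod>j\<in>{..<n}. prob (D j -` A j \<inter> space bm_space))"
      if A: "A \<in> {..<n} \<rightarrow> sets borel" for A
    proof -
      define A' where "A' i = (if i < n then A i else {})" for i
      have "A' i \<in> sets borel" for i using A by (auto simp: A'_def)
      from prod[of A' n, OF this]
      have "prob {z\<in>space bm_space. \<forall>i<n. D i z \<in> A i} = (\<Prod>i<n. prob {z\<in>space bm_space. D i z \<in> A i})"
        by (simp add: A'_def cong: conj_cong)
      moreover have "(\<Inter>j\<in>{..<n}. D j -` A j \<inter> space bm_space) = {z\<in>space bm_space. \<forall>i<n. D i z \<in> A i}"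
        using False by auto
      moreover have "D j -` A j \<inter> space bm_space = {z\<in>space bm_space. D j z \<in> A j}" for j by auto
      ultimately show ?thesis by simp
    qed
    ultimately show ?thesis unfolding D_def[abs_def] by blast
  qed
  then show ?thesis
    unfolding brownian_motion_def
    using prob_space_bm_space measurable_bm bm_increment_distributed continuous_bm bm_0 by auto
qed

section \<open>Optional stopping and sharpness\<close>

text \<open>A bound in L2 gives uniform integrability. The inequality
  \<open>d \<le> min d R + d\<^sup>2 / R\<close> splits the distance \<open>d\<close> of
  \<open>Y n\<close> and \<open>Z\<close> into a bounded part, which tends to \<open>0\<close> in
  mean by dominated convergence, and a part whose mean is at most \<open>4 * K / R\<close> for all
  \<open>n\<close>. Fatou's lemma puts the limit into the same L2 ball.\<close>

lemma (in prob_space) L2_bounded_limit: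
  fixes Y :: "nat \<Rightarrow> 'a \<Rightarrow> real"
  assumes Y: "\<And>n. Y n \<in> borel_measurable M" "\<And>n. integrable M (\<lambda>\<omega>. (Y n \<omega>)\<^sup>2)" "\<And>n. (\<integral>\<omega>. (Y n \<omega>)\<^sup>2 \<partial>M) \<le> K"
    and Z: "Z \<in> borel_measurable M" and lim: "AE \<omega> in M. (\<lambda>n. Y n \<omega>) \<longlonglongrightarrow> Z \<omega>"
  shows "integrable M Z" "(\<lambda>n. \<integral>\<omega>. Y n \<omega> \<partial>M) \<longlonglongrightarrow> (\<integral>\<omega>. Z \<omega> \<partial>M)"
proof -
  note [measurable] = Y(1) Z
  have K0: "0 \<le> K" using Y(3)[of 0] by (rule order_trans[rotated]) simp
  have "(\<integral>\<^sup>+\<omega>. ennreal ((Z \<omega>)\<^sup>2) \<partial>M) = (\<integral>\<^sup>+\<omega>. liminf (\<lambda>n. ennreal ((Y n \<omega>)\<^sup>2)) \<partial>M)"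
  proof (rule nn_integral_cong_AE)
    show "AE \<omega> in M. ennreal ((Z \<omega>)\<^sup>2) = liminf (\<lambda>n. ennreal ((Y n \<omega>)\<^sup>2))"
      using lim
    proof eventually_elim
      case (elim \<omega>)
      have "(\<lambda>n. ennreal ((Y n \<omega>)\<^sup>2)) \<longlonglongrightarrow> ennreal ((Z \<omega>)\<^sup>2)"
        by (intro tendsto_ennrealI tendsto_power elim)
      then show ?case by (intro lim_imp_Liminf[symmetric]) simp_all
    qed
  qed
  also have "\<dots> \<le> liminf (\<lambda>n. \<integral>\<^sup>+\<omega>. ennreal ((Y n \<omega>)\<^sup>2) \<partial>M)"
    by (rule nn_integral_liminf) measurable
  also have "\<dots> \<le> ennreal K"
  proof (rule Liminf_le)
    show "\<forall>\<^sub>F n in sequentially. (\<integral>\<^sup>+\<omega>. ennreal ((Y n \<omega>)\<^sup>2) \<partial>M) \<le> ennreal K"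
      using Y by (intro always_eventually allI) (simp add: nn_integral_eq_integral ennreal_leI)
  qed simp
  finally have Z2: "(\<integral>\<^sup>+\<omega>. ennreal ((Z \<omega>)\<^sup>2) \<partial>M) \<le> ennreal K" .
  then have iZ2: "integrable M (\<lambda>\<omega>. (Z \<omega>)\<^sup>2)"
    by (intro integrableI_bounded) (auto simp: less_top[symmetric] top_unique)
  have Z2': "(\<integral>\<omega>. (Z \<omega>)\<^sup>2 \<partial>M) \<le> K"
    using Z2 nn_integral_eq_integral[OF iZ2] K0 by simp
  show iZ: "integrable M Z"
    using iZ2 by (rule square_integrable_imp_integrable[rotated]) simp
  have iY: "integrable M (Y n)" for n
    using Y(2) by (rule square_integrable_imp_integrable[rotated]) simp
  have iD: "integrable M (\<lambda>\<omega>. \<bar>Y n \<omega> - Z \<omega>\<bar>)" for n using iY iZ by auto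
  have iD2: "integrable M (\<lambda>\<omega>. (Y n \<omega>)\<^sup>2 + (Z \<omega>)\<^sup>2)" for n using Y(2) iZ2 by auto
  have im: "integrable M (\<lambda>\<omega>. min \<bar>Y n \<omega> - Z \<omega>\<bar> R)" if "0 < R" for n R
    by (rule integrable_const_bound[where B=R]) (use that in auto)
  have bound: "(\<integral>\<omega>. \<bar>Y n \<omega> - Z \<omega>\<bar> \<partial>M) \<le> (\<integral>\<omega>. min \<bar>Y n \<omega> - Z \<omega>\<bar> R \<partial>M) + 4 * K / R" if R: "0 < R" for n R
  proof -
    have pw: "d \<le> min d R + d\<^sup>2 / R" if "0 \<le> d" for d
    proof (cases "d \<le> R")
      case False
      then have "d * R \<le> d * d" by (intro mult_left_mono) (use that in auto)
      then have "d \<le> d\<^sup>2 / R" using R by (simp add: pos_le_divide_eq power2_eq_square)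
      then show ?thesis using that R by (simp add: min_def)
    qed (use R in \<open>simp add: min_def\<close>)
    have iS: "integrable M (\<lambda>\<omega>. 2 * ((Y n \<omega>)\<^sup>2 + (Z \<omega>)\<^sup>2) / R)"
      by (intro integrable_divide integrable_mult_right iD2)
    have "(\<integral>\<omega>. \<bar>Y n \<omega> - Z \<omega>\<bar> \<partial>M) \<le> (\<integral>\<omega>. min \<bar>Y n \<omega> - Z \<omega>\<bar> R + 2 * ((Y n \<omega>)\<^sup>2 + (Z \<omega>)\<^sup>2) / R \<partial>M)"
    proof (rule integral_mono)
      fix \<omega>
      have "\<bar>Y n \<omega> - Z \<omega>\<bar>\<^sup>2 \<le> 2 * ((Y n \<omega>)\<^sup>2 + (Z \<omega>)\<^sup>2)"
        using zero_le_power2[of "Y n \<omega> + Z \<omega>"] by (simp add: power2_eq_square algebra_simps)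
      then have "\<bar>Y n \<omega> - Z \<omega>\<bar>\<^sup>2 / R \<le> 2 * ((Y n \<omega>)\<^sup>2 + (Z \<omega>)\<^sup>2) / R"
        using R by (intro divide_right_mono) auto
      with pw[of "\<bar>Y n \<omega> - Z \<omega>\<bar>"]
      show "\<bar>Y n \<omega> - Z \<omega>\<bar> \<le> min \<bar>Y n \<omega> - Z \<omega>\<bar> R + 2 * ((Y n \<omega>)\<^sup>2 + (Z \<omega>)\<^sup>2) / R" by simp
    qed (intro iD Bochner_Integration.integrable_add im[OF R] iS)+
    also have "\<dots> = (\<integral>\<omega>. min \<bar>Y n \<omega> - Z \<omega>\<bar> R \<partial>M) + 2 * ((\<integral>\<omega>. (Y n \<omega>)\<^sup>2 \<partial>M) + (\<integral>\<omega>. (Z \<omega>)\<^sup>2 \<partial>M)) / R"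
      using Y(2)[of n] iZ2 by (subst Bochner_Integration.integral_add[OF im[OF R] iS]) simp
    also have "\<dots> \<le> (\<integral>\<omega>. min \<bar>Y n \<omega> - Z \<omega>\<bar> R \<partial>M) + 2 * (K + K) / R"
      using Y(3)[of n] Z2' R by (intro add_left_mono divide_right_mono mult_left_mono add_mono) auto
    finally show ?thesis by simp
  qed
  have trunc: "(\<lambda>n. \<integral>\<omega>. min \<bar>Y n \<omega> - Z \<omega>\<bar> R \<partial>M) \<longlonglongrightarrow> (\<integral>\<omega>. 0 \<partial>M)" if R: "0 < R" for R
  proof (rule integral_dominated_convergence[where w="\<lambda>_. R"])
    show "AE \<omega> in M. (\<lambda>n. min \<bar>Y n \<omega> - Z \<omega>\<bar> R) \<longlonglongrightarrow> 0"
      using lim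
    proof eventually_elim
      case (elim \<omega>)
      have "(\<lambda>n. min \<bar>Y n \<omega> - Z \<omega>\<bar> R) \<longlonglongrightarrow> min \<bar>Z \<omega> - Z \<omega>\<bar> R"
        by (intro tendsto_intros elim)
      then show ?case using R by simp
    qed
  qed (use R in auto)
  have "(\<lambda>n. \<integral>\<omega>. \<bar>Y n \<omega> - Z \<omega>\<bar> \<partial>M) \<longlonglongrightarrow> 0"
  proof (rule order_tendstoI)
    fix e :: real assume e: "0 < e"
    \<comment> \<open>This \<open>R\<close> makes the uniform remainder \<open>4 * K / R\<close>
      smaller than \<open>e\<close>; the \<open>+ 1\<close> keeps \<open>R\<close> positive when
      \<open>K = 0\<close>.\<close>
    define R where "R = 8 * (K + 1) / e"
    have R: "0 < R" using e K0 by (simp add: R_def)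
    have "e * R = 8 * (K + 1)" using e by (simp add: R_def)
    then have "4 * K < e * R" using K0 by simp
    then have "4 * K / R < e" using R by (simp add: pos_divide_less_eq)
    then have "\<forall>\<^sub>F n in sequentially. (\<integral>\<omega>. min \<bar>Y n \<omega> - Z \<omega>\<bar> R \<partial>M) < e - 4 * K / R"
      using trunc[OF R] by (intro order_tendstoD(2)) auto
    then show "\<forall>\<^sub>F n in sequentially. (\<integral>\<omega>. \<bar>Y n \<omega> - Z \<omega>\<bar> \<partial>M) < e"
    proof eventually_elim
      case (elim n)
      then show ?case using bound[OF R, of n] by simp
    qed
  next
    fix e :: real assume e: "e < 0"
    show "\<forall>\<^sub>F n in sequentially. e < (\<integral>\<omega>. \<bar>Y n \<omega> - Z \<omega>\<bar> \<partial>M)"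
      by (intro always_eventually allI less_le_trans[OF e]) simp
  qed
  note L1 = this
  have "norm ((\<integral>\<omega>. Y n \<omega> \<partial>M) - (\<integral>\<omega>. Z \<omega> \<partial>M)) \<le> (\<integral>\<omega>. \<bar>Y n \<omega> - Z \<omega>\<bar> \<partial>M)" for n
    using iY[of n] iZ integral_norm_bound[of M "\<lambda>\<omega>. Y n \<omega> - Z \<omega>"] by simp
  then have ev: "\<forall>\<^sub>F n in sequentially. norm ((\<integral>\<omega>. Y n \<omega> \<partial>M) - (\<integral>\<omega>. Z \<omega> \<partial>M))
    \<le> (\<integral>\<omega>. \<bar>Y n \<omega> - Z \<omega>\<bar> \<partial>M)" by (intro always_eventually allI)
  have "(\<lambda>n. (\<integral>\<omega>. Y n \<omega> \<partial>M) - (\<integral>\<omega>. Z \<omega> \<partial>M)) \<longlonglongrightarrow> 0"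
    by (rule Lim_null_comparison[OF ev L1])
  then show "(\<lambda>n. \<integral>\<omega>. Y n \<omega> \<partial>M) \<longlonglongrightarrow> (\<integral>\<omega>. Z \<omega> \<partial>M)" by (rule LIM_zero_cancel)
qed

lemma ennreal_less_enn2real_min:
  assumes "0 \<le> r" "r < t"
  shows "ennreal r < \<eta> \<longleftrightarrow> r < enn2real (min \<eta> (ennreal t))"
proof (cases \<eta>)
  case (real x)
  then show ?thesis using assms by (auto simp: min_def ennreal_less_iff)
next
  case top
  then show ?thesis using assms by simp
qed

lemma enn2real_min_bounds: "0 \<le> t \<Longrightarrow> enn2real (min \<eta> (ennreal t)) \<in> {0..t}"
  by (auto intro: enn2real_leI)

lemma grid_points_dense_right:
  fixes f :: "real \<Rightarrow> real"
  assumes f: "\<forall>t\<ge>0. (f \<longlongrightarrow> f t) (at_right t)" and r: "r \<in> {0..t}" and U: "open U" "f r \<in> U"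
  shows "\<exists>d\<in>grid_points t. r \<le> d \<and> f d \<in> U"
proof -
  obtain n k where "k \<le> Suc n" "r \<le> t * real k / real (Suc n)" "f (t * real k / real (Suc n)) \<in> U"
    using grid_hits_open_right[OF f r U] unfolding eventually_sequentially by blast
  then show ?thesis unfolding grid_points_def by blast
qed

lemma stopped_process_at:
  assumes "\<eta> \<omega> = ennreal r" "0 \<le> r" "r \<le> t"
  shows "stopped_process B \<eta> t \<omega> = B r \<omega>"
proof -
  have "min (ennreal r) (ennreal t) = ennreal r" using assms by (intro min.absorb1 ennreal_leI)
  then show ?thesis using assms by (simp add: stopped_process_def)
qed

lemma stopped_process_before:
  assumes "ennreal t \<le> \<eta> \<omega>" "0 \<le> t"
  shows "stopped_process B \<eta> t \<omega> = B t \<omega>"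
  using assms by (simp add: stopped_process_def min.absorb2)

text \<open>With \<open>h = p * (1 - 1 / q)\<close> the summands form a geometric progression of
  ratio \<open>r = (1 - h) * q powr p\<close>, and the left side is \<open>r ^ K\<close>. The
  first-order terms of \<open>r\<close> at \<open>q = 1\<close> cancel, so \<open>r - 1\<close> is
  of smaller order than \<open>h\<close>; this is the criticality behind the choice of
  \<open>1 / p - 1\<close>. If \<open>r \<le> 1\<close>, every power in the sum is at least
  \<open>r ^ K\<close> and a large \<open>K\<close> suffices. If \<open>r > 1\<close>, the sum is
  \<open>h * q powr p * (r ^ K - 1) / (r - 1)\<close>, which is large compared with
  \<open>r ^ K\<close> as soon as \<open>r ^ K > 2\<close>.\<close>

lemma geometric_remainder_small:
  fixes p \<epsilon> :: real
  assumes p: "0 < p" "p < 1" and \<epsilon>: "0 < \<epsilon>"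
  obtains q :: real and K :: nat where "1 < q" "0 < K"
    "(1 - p * (1 - 1 / q)) ^ K * (q ^ K) powr p
      \<le> \<epsilon> * (\<Sum>j<K. (1 - p * (1 - 1 / q)) ^ j * (p * (1 - 1 / q)) * (q ^ Suc j) powr p)"
proof -
  have "((\<lambda>q. ((1 - p * (1 - 1 / q)) * q powr p - 1) / (p * (1 - 1 / q) * q powr p)) \<longlongrightarrow> 0) (at_right 1)"
    using p by real_asymp
  then have "eventually (\<lambda>q. ((1 - p * (1 - 1 / q)) * q powr p - 1) / (p * (1 - 1 / q) * q powr p) < \<epsilon> / 2) (at_right 1)"
    using \<epsilon> by (intro order_tendstoD(2)) auto
  then obtain b where b: "b > 1" "\<And>q. 1 < q \<Longrightarrow> q < b \<Longrightarrow>
      ((1 - p * (1 - 1 / q)) * q powr p - 1) / (p * (1 - 1 / q) * q powr p) < \<epsilon> / 2"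
    unfolding eventually_at_right_field by blast
  define q where "q = (1 + b) / 2"
  have q: "1 < q" "q < b" using b(1) by (auto simp: q_def)
  define h where "h = p * (1 - 1 / q)"
  define d where "d = q powr p"
  define r where "r = (1 - h) * d"
  have x: "0 < 1 - 1 / q" "1 - 1 / q < 1" using q by auto
  have h: "0 < h" "h < 1"
    unfolding h_def using p x mult_strict_mono[of p 1 "1 - 1 / q" 1] by auto
  have d: "0 < d" using q by (simp add: d_def)
  have r0: "0 < r" using h d by (simp add: r_def)
  have r1: "(r - 1) / (h * d) < \<epsilon> / 2" using b(2)[OF q] by (simp add: r_def h_def d_def)
  have qd: "(q ^ j) powr p = d ^ j" for j
    using q by (simp add: d_def powr_realpow[symmetric] powr_powr mult.commute)
  have rem: "(1 - h) ^ K * (q ^ K) powr p = r ^ K" for K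
    by (simp add: qd r_def power_mult_distrib)
  have S: "(\<Sum>j<K. (1 - h) ^ j * h * (q ^ Suc j) powr p) = h * d * (\<Sum>j<K. r ^ j)" for K
    unfolding qd r_def by (simp add: sum_distrib_left power_mult_distrib mult_ac)
  have "\<exists>K>0. r ^ K \<le> \<epsilon> * (h * d * (\<Sum>j<K. r ^ j))"
  proof (cases "r \<le> 1")
    case True
    obtain K :: nat where K: "1 / (\<epsilon> * (h * d)) < real K" using reals_Archimedean2 by blast
    have pos: "0 < \<epsilon> * (h * d)" using \<epsilon> h d by simp
    have K0: "0 < K" using K pos by (cases K) (auto simp: not_less)
    have "real K * r ^ K \<le> (\<Sum>j<K. r ^ j)"
    proof -
      have "(\<Sum>j<K. r ^ K) \<le> (\<Sum>j<K. r ^ j)"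
        using r0 True by (intro sum_mono power_decreasing) auto
      then show ?thesis by simp
    qed
    then have "\<epsilon> * (h * d) * (real K * r ^ K) \<le> \<epsilon> * (h * d) * (\<Sum>j<K. r ^ j)"
      using pos by (intro mult_left_mono) auto
    moreover have "1 * r ^ K \<le> (\<epsilon> * (h * d) * real K) * r ^ K"
      using K pos r0 by (intro mult_right_mono) (auto simp: pos_divide_less_eq mult.commute)
    ultimately have "r ^ K \<le> \<epsilon> * (h * d * (\<Sum>j<K. r ^ j))" by (simp only: mult.assoc mult_1)
    then show ?thesis using K0 by blast
  next
    case False
    then have r: "1 < r" by simp
    obtain K where K: "2 < r ^ K" using real_arch_pow[OF r] by blast
    have K0: "0 < K" using K by (cases K) auto
    have sum: "(\<Sum>j<K. r ^ j) = (r ^ K - 1) / (r - 1)" using r by (intro geometric_sum) simp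
    have "(r - 1) < \<epsilon> / 2 * (h * d)" using r1 h d by (simp add: pos_divide_less_eq)
    \<comment> \<open>With \<open>r ^ K > 2\<close> half of \<open>r ^ K\<close> is below
      \<open>r ^ K - 1\<close>; this is where the other half of \<open>\<epsilon>\<close> is
      spent.\<close>
    then have "(r - 1) * r ^ K \<le> \<epsilon> / 2 * (h * d) * r ^ K" using r0 by (intro mult_right_mono) auto
    also have "\<dots> = \<epsilon> * (h * d) * (r ^ K / 2)" by simp
    also have "\<dots> \<le> \<epsilon> * (h * d) * (r ^ K - 1)" using K \<epsilon> h d by (intro mult_left_mono) auto
    finally have "r ^ K \<le> \<epsilon> * (h * d * (\<Sum>j<K. r ^ j))"
      unfolding sum using r by (simp add: pos_le_divide_eq mult_ac)
    then show ?thesis using K0 by blast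
  qed
  then obtain K where K: "0 < K" "r ^ K \<le> \<epsilon> * (h * d * (\<Sum>j<K. r ^ j))" by blast
  show ?thesis
    by (rule that[OF q(1) K(1)]) (use K(2) in \<open>simp only: h_def[symmetric] rem S\<close>)
qed

lemma nn_integral_powr_layer_closed:
  fixes p y v :: real
  assumes "0 < p" "0 \<le> y" "y \<le> v"
  shows "ennreal (v powr p)
    = ennreal (y powr p) + (\<integral>\<^sup>+ s. ennreal (p * s powr (p - 1)) * (if y \<le> s \<and> s \<le> v then 1 else 0) \<partial>lborel)"
proof -
  have "(\<integral>\<^sup>+ s. ennreal (p * s powr (p - 1)) * indicator {y..<v} s \<partial>lborel)
    = (\<integral>\<^sup>+ s. ennreal (p * s powr (p - 1)) * (if y \<le> s \<and> s \<le> v then 1 else 0) \<partial>lborel)"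
    by (intro nn_integral_cong_AE eventually_mono[OF AE_lborel_singleton[of v]]) (auto simp: indicator_def)
  then show ?thesis using nn_integral_powr_layer[OF assms] by simp
qed

lemma ennreal_powr_le_imp:
  assumes "ennreal_powr x (1 / p) \<le> ennreal y" "0 \<le> y" "0 < p"
  shows "x \<le> ennreal (y powr p)"
proof (cases x)
  case (real r)
  then have "r powr (1 / p) \<le> y" using assms by (simp add: ennreal_powr_def)
  then have "(r powr (1 / p)) powr p \<le> y powr p" using assms by (intro powr_mono2) auto
  then have "r \<le> y powr p" using real assms by (simp add: powr_powr)
  then show ?thesis unfolding real by (rule ennreal_leI)
next
  case top
  then show ?thesis using assms by (simp add: ennreal_powr_def top_unique)
qed

text \<open>Continuity and the start at \<open>0\<close> hold for every outcome, as the construction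
  provides, so hitting times and stopped paths can be treated without exceptional sets. Independence
  is demanded from the augmented filtration, because the stopping times refer to it.\<close>

locale brownian = prob_space M for M :: "'a measure" +
  fixes B :: "real \<Rightarrow> 'a \<Rightarrow> real"
  assumes complete: "complete_measure M"
    and B_measurable: "\<And>t. B t \<in> borel_measurable M"
    and B_0: "\<And>\<omega>. B 0 \<omega> = 0"
    and B_continuous: "\<And>\<omega>. continuous_on {0..} (\<lambda>t. B t \<omega>)"
    and B_normal: "\<And>s t. 0 \<le> s \<Longrightarrow> s < t \<Longrightarrow>
        distributed M lborel (\<lambda>\<omega>. B t \<omega> - B s \<omega>) (\<lambda>x. ennreal (normal_density 0 (sqrt (t - s)) x))"
    and B_indep: "\<And>s t A C. 0 \<le> s \<Longrightarrow> s \<le> t \<Longrightarrow> A \<in> sets (natural_filtration M B s) \<Longrightarrow> C \<in> sets borel \<Longrightarrow>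
        prob (A \<inter> {\<omega>\<in>space M. B t \<omega> - B s \<omega> \<in> C}) = prob A * prob {\<omega>\<in>space M. B t \<omega> - B s \<omega> \<in> C}"
begin

abbreviation F :: "real \<Rightarrow> 'a measure" where
  "F \<equiv> natural_filtration M B"

lemma F_subalgebra: "subalgebra M (F t)"
  by (rule subalgebra_natural_filtration) (rule B_measurable)

lemma F_sets: "A \<in> sets (F t) \<Longrightarrow> A \<in> sets M"
  using F_subalgebra[of t] by (auto simp: subalgebra_def)

lemma F_mono: "s \<le> t \<Longrightarrow> A \<in> sets (F s) \<Longrightarrow> A \<in> sets (F t)"
  using natural_filtration_mono by blast

lemma F_measurable: "f \<in> borel_measurable (F t) \<Longrightarrow> f \<in> borel_measurable M"
  using F_subalgebra by (rule measurable_from_subalg)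

section \<open>Moments of increments and of predictable sums\<close>

lemma increment_moments:
  assumes st: "0 \<le> s" "s \<le> t"
  shows "integrable M (\<lambda>\<omega>. (B t \<omega> - B s \<omega>)\<^sup>2)" "(\<integral>\<omega>. (B t \<omega> - B s \<omega>)\<^sup>2 \<partial>M) = t - s"
    "integrable M (\<lambda>\<omega>. B t \<omega> - B s \<omega>)" "(\<integral>\<omega>. B t \<omega> - B s \<omega> \<partial>M) = 0"
proof -
  let ?D = "\<lambda>\<omega>. B t \<omega> - B s \<omega>"
  have [measurable]: "?D \<in> borel_measurable M" by (intro borel_measurable_diff B_measurable)
  have "integrable M (\<lambda>\<omega>. (?D \<omega>)\<^sup>2) \<and> (\<integral>\<omega>. (?D \<omega>)\<^sup>2 \<partial>M) = t - s \<and> (\<integral>\<omega>. ?D \<omega> \<partial>M) = 0"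
  proof (cases "s = t")
    case False
    then have lt: "s < t" using st by simp
    note D = B_normal[OF st(1) lt]
    have \<sigma>: "0 < sqrt (t - s)" using lt by simp
    have e: "(\<integral>\<omega>. ?D \<omega> \<partial>M) = 0" by (rule normal_distributed_expectation[OF \<sigma> D])
    have "variance ?D = (sqrt (t - s))\<^sup>2" by (rule normal_distributed_variance[OF \<sigma> D])
    have v: "(\<integral>\<omega>. (?D \<omega>)\<^sup>2 \<partial>M) = t - s" using \<open>variance ?D = (sqrt (t - s))\<^sup>2\<close> e lt by simp
    \<comment> \<open>A function that is not integrable has integral \<open>0\<close> by convention,
      whereas this integral is \<open>t - s > 0\<close>.\<close>
    have "integrable M (\<lambda>\<omega>. (?D \<omega>)\<^sup>2)"
    proof (rule ccontr)
      assume "\<not> ?thesis"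
      then have "(\<integral>\<omega>. (?D \<omega>)\<^sup>2 \<partial>M) = 0" by (rule not_integrable_integral_eq)
      then show False using v lt by simp
    qed
    then show ?thesis using e v by simp
  qed simp
  then show 1: "integrable M (\<lambda>\<omega>. (?D \<omega>)\<^sup>2)" "(\<integral>\<omega>. (?D \<omega>)\<^sup>2 \<partial>M) = t - s" "(\<integral>\<omega>. ?D \<omega> \<partial>M) = 0" by auto
  show "integrable M ?D" using 1(1) by (rule square_integrable_imp_integrable[rotated]) simp
qed

lemma indep_increment:
  assumes st: "0 \<le> s" "s \<le> t" and Y: "Y \<in> borel_measurable (F s)"
  shows "indep_var borel Y borel (\<lambda>\<omega>. B t \<omega> - B s \<omega>)"
proof -
  have m: "(\<lambda>\<omega>. B t \<omega> - B s \<omega>) \<in> borel_measurable M" by (intro borel_measurable_diff B_measurable)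
  have "indep_set {Y -` A \<inter> space M | A. A \<in> sets borel} {(\<lambda>\<omega>. B t \<omega> - B s \<omega>) -` A \<inter> space M | A. A \<in> sets borel}"
    unfolding indep_sets2_eq
  proof (intro conjI ballI)
    show "{Y -` A \<inter> space M | A. A \<in> sets borel} \<subseteq> events"
      using F_measurable[OF Y] by (auto intro: measurable_sets)
    show "{(\<lambda>\<omega>. B t \<omega> - B s \<omega>) -` A \<inter> space M | A. A \<in> sets borel} \<subseteq> events"
      using m by (auto intro: measurable_sets)
    fix a b assume "a \<in> {Y -` A \<inter> space M | A. A \<in> sets borel}"
      "b \<in> {(\<lambda>\<omega>. B t \<omega> - B s \<omega>) -` A \<inter> space M | A. A \<in> sets borel}"
    then obtain A C where AC: "a = Y -` A \<inter> space M" "A \<in> sets borel"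
      "b = {\<omega>\<in>space M. B t \<omega> - B s \<omega> \<in> C}" "C \<in> sets borel"
      by (auto simp: vimage_def Int_def conj_commute)
    have "a \<in> sets (F s)" using measurable_sets[OF Y AC(2)] by (simp add: AC)
    then show "prob (a \<inter> b) = prob a * prob b" unfolding AC(3) by (rule B_indep[OF st _ AC(4)])
  qed
  moreover have "Int_stable {f -` A \<inter> space M | A. A \<in> sets borel}" for f :: "'a \<Rightarrow> real"
  proof (rule Int_stableI, clarify)
    fix A C :: "real set" assume "A \<in> sets borel" "C \<in> sets borel"
    then show "\<exists>D. f -` A \<inter> space M \<inter> (f -` C \<inter> space M) = f -` D \<inter> space M \<and> D \<in> sets borel"
      by (intro exI[of _ "A \<inter> C"]) auto
  qed
  ultimately have "indep_set (sigma_sets (space M) {Y -` A \<inter> space M | A. A \<in> sets borel})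
    (sigma_sets (space M) {(\<lambda>\<omega>. B t \<omega> - B s \<omega>) -` A \<inter> space M | A. A \<in> sets borel})"
    by (intro indep_set_sigma_sets)
  then show ?thesis unfolding indep_var_eq using F_measurable[OF Y] m by simp
qed

text \<open>\<open>X n\<close> times the next indicator is known at time \<open>t n\<close>, and the
  increment after \<open>t n\<close> is independent of it with mean \<open>0\<close>; so the cross
  terms vanish. The squares contribute at most the lengths of the time intervals, which makes the L2
  bound independent of the mesh.\<close>

lemma predictable_sum_moments:
  fixes t :: "nat \<Rightarrow> real"
  assumes t: "0 \<le> t 0" "\<And>i. t i \<le> t (Suc i)" and A: "\<And>i. A i \<in> sets (F (t i))"
  defines "X \<equiv> \<lambda>n \<omega>. \<Sum>i<n. indicator (A i) \<omega> * (B (t (Suc i)) \<omega> - B (t i) \<omega>)"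
  shows "X n \<in> borel_measurable (F (t n))" "integrable M (\<lambda>\<omega>. (X n \<omega>)\<^sup>2)" "(\<integral>\<omega>. X n \<omega> \<partial>M) = 0"
    "(\<integral>\<omega>. (X n \<omega>)\<^sup>2 \<partial>M) \<le> t n - t 0"
proof -
  have mono: "t i \<le> t j" if "i \<le> j" for i j using t(2) that by (rule lift_Suc_mono_le)
  have t0: "0 \<le> t i" for i using t(1) mono[of 0 i] by simp
  have meas: "X n \<in> borel_measurable (F (t n))" for n
    unfolding X_def
  proof (rule borel_measurable_sum)
    fix i assume "i \<in> {..<n}"
    then have i: "t i \<le> t n" "t (Suc i) \<le> t n" using mono[of i n] mono[of "Suc i" n] by auto
    have "indicator (A i) \<in> borel_measurable (F (t n))"
      using F_mono[OF i(1) A] by (rule borel_measurable_indicator)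
    then show "(\<lambda>\<omega>. indicator (A i) \<omega> * (B (t (Suc i)) \<omega> - B (t i) \<omega>)) \<in> borel_measurable (F (t n))"
      by (intro borel_measurable_times borel_measurable_diff measurable_natural_filtration t0 i)
  qed
  then show "X n \<in> borel_measurable (F (t n))" .
  have "integrable M (\<lambda>\<omega>. (X n \<omega>)\<^sup>2) \<and> (\<integral>\<omega>. X n \<omega> \<partial>M) = 0 \<and> (\<integral>\<omega>. (X n \<omega>)\<^sup>2 \<partial>M) \<le> t n - t 0"
  proof (induction n)
    case 0
    then show ?case by (simp add: X_def)
  next
    case (Suc n)
    define D where "D \<omega> = B (t (Suc n)) \<omega> - B (t n) \<omega>" for \<omega>
    define I where "I = (indicator (A n) :: 'a \<Rightarrow> real)"
    note D = increment_moments[OF t0 t(2), of n, folded D_def]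
    have An[measurable]: "A n \<in> sets M" by (rule F_sets[OF A])
    have [measurable]: "I \<in> borel_measurable M"
      unfolding I_def using An by (rule borel_measurable_indicator)
    have [measurable]: "X n \<in> borel_measurable M" "D \<in> borel_measurable M"
      using F_measurable[OF meas] D(3) by simp_all
    have ID: "I \<in> borel_measurable (F (t n))" unfolding I_def using A by (rule borel_measurable_indicator)
    have I01: "I \<omega> = 0 \<or> I \<omega> = 1" for \<omega> by (simp add: I_def indicator_def)
    have iX2: "integrable M (\<lambda>\<omega>. (X n \<omega>)\<^sup>2)" using Suc by simp
    then have iX: "integrable M (X n)" by (rule square_integrable_imp_integrable[rotated]) simp
    have iI: "integrable M I" by (rule integrable_const_bound[where B=1]) (auto simp: I_def)
    have iXI: "integrable M (\<lambda>\<omega>. X n \<omega> * I \<omega>)"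
      by (rule Bochner_Integration.integrable_bound[OF iX]) (auto simp: I_def indicator_def)
    have iD2: "integrable M (\<lambda>\<omega>. I \<omega> * (D \<omega>)\<^sup>2)"
      by (rule Bochner_Integration.integrable_bound[OF D(1)]) (auto simp: I_def indicator_def)
    have "indep_var borel I borel D"
      unfolding D_def[abs_def] by (rule indep_increment[OF t0 t(2) ID])
    from indep_var_lebesgue_integral[OF this iI D(3)] indep_var_integrable[OF this iI D(3)]
    have 1: "(\<integral>\<omega>. I \<omega> * D \<omega> \<partial>M) = 0" "integrable M (\<lambda>\<omega>. I \<omega> * D \<omega>)" using D(4) by auto
    have "indep_var borel (\<lambda>\<omega>. X n \<omega> * I \<omega>) borel D"
      unfolding D_def[abs_def] by (rule indep_increment[OF t0 t(2)]) (intro borel_measurable_times meas ID)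
    from indep_var_lebesgue_integral[OF this iXI D(3)] indep_var_integrable[OF this iXI D(3)]
    have 2: "(\<integral>\<omega>. X n \<omega> * I \<omega> * D \<omega> \<partial>M) = 0" "integrable M (\<lambda>\<omega>. X n \<omega> * I \<omega> * D \<omega>)" using D(4) by auto
    have X_Suc: "X (Suc n) \<omega> = X n \<omega> + I \<omega> * D \<omega>" for \<omega> unfolding X_def I_def D_def by (rule sum.lessThan_Suc)
    have sq: "(X (Suc n) \<omega>)\<^sup>2 = (X n \<omega>)\<^sup>2 + 2 * (X n \<omega> * I \<omega> * D \<omega>) + I \<omega> * (D \<omega>)\<^sup>2" for \<omega>
      using I01[of \<omega>] by (auto simp: X_Suc power2_eq_square algebra_simps)
    have "integrable M (\<lambda>\<omega>. (X (Suc n) \<omega>)\<^sup>2)" unfolding sq using iX2 2 iD2 by auto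
    moreover have "(\<integral>\<omega>. X (Suc n) \<omega> \<partial>M) = 0" unfolding X_Suc using iX 1 Suc by simp
    moreover have "(\<integral>\<omega>. (X (Suc n) \<omega>)\<^sup>2 \<partial>M) \<le> t (Suc n) - t 0"
    proof -
      have "(\<integral>\<omega>. (X (Suc n) \<omega>)\<^sup>2 \<partial>M) = (\<integral>\<omega>. (X n \<omega>)\<^sup>2 \<partial>M) + (\<integral>\<omega>. I \<omega> * (D \<omega>)\<^sup>2 \<partial>M)"
        unfolding sq using iX2 2 iD2 by simp
      also have "(\<integral>\<omega>. I \<omega> * (D \<omega>)\<^sup>2 \<partial>M) \<le> (\<integral>\<omega>. (D \<omega>)\<^sup>2 \<partial>M)"
        by (intro integral_mono iD2 D(1)) (auto simp: I_def indicator_def)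
      finally show ?thesis using Suc D(2) by simp
    qed
    ultimately show ?case by simp
  qed
  then show "integrable M (\<lambda>\<omega>. (X n \<omega>)\<^sup>2)" "(\<integral>\<omega>. X n \<omega> \<partial>M) = 0" "(\<integral>\<omega>. (X n \<omega>)\<^sup>2 \<partial>M) \<le> t n - t 0" by auto
qed

section \<open>Stopping times and optional stopping\<close>

abbreviation stopping :: "('a \<Rightarrow> ennreal) \<Rightarrow> bool" where
  "stopping \<equiv> ext_stopping_time M F"

lemma stopping_less:
  assumes "stopping \<eta>" "0 \<le> t"
  shows "{\<omega>\<in>space M. ennreal t < \<eta> \<omega>} \<in> sets (F t)"
proof -
  have "{\<omega>\<in>space M. \<eta> \<omega> \<le> ennreal t} \<in> sets (F t)"
    using assms by (simp add: ext_stopping_time_def)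
  then have "space (F t) - {\<omega>\<in>space M. \<eta> \<omega> \<le> ennreal t} \<in> sets (F t)" by (rule sets.compl_sets)
  also have "space (F t) - {\<omega>\<in>space M. \<eta> \<omega> \<le> ennreal t} = {\<omega>\<in>space M. ennreal t < \<eta> \<omega>}"
    by (auto simp: not_le)
  finally show ?thesis .
qed

text \<open>Each grid step is weighted with the event that \<open>\<eta>\<close> has not occurred by
  its left endpoint. This event is known there, so the moment bounds for predictable sums
  apply.\<close>

definition stop_approx :: "('a \<Rightarrow> ennreal) \<Rightarrow> real \<Rightarrow> nat \<Rightarrow> 'a \<Rightarrow> real" where
  "stop_approx \<eta> t N \<omega> = (\<Sum>i<Suc N. indicator {\<omega>\<in>space M. ennreal (t * real i / Suc N) < \<eta> \<omega>} \<omega> *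
     (B (t * real (Suc i) / Suc N) \<omega> - B (t * real i / Suc N) \<omega>))"

text \<open>The sum telescopes to the value of \<open>B\<close> at the first grid point after \<open>\<eta>\<close>.\<close>

lemma stop_approx_eq:
  assumes t: "0 < t" and \<omega>: "\<omega> \<in> space M"
  shows "\<exists>r. stop_approx \<eta> t N \<omega> = B r \<omega> \<and> 0 \<le> r \<and> \<bar>r - enn2real (min (\<eta> \<omega>) (ennreal t))\<bar> \<le> t / Suc N"
proof -
  define \<rho> where "\<rho> = enn2real (min (\<eta> \<omega>) (ennreal t))"
  have \<rho>: "0 \<le> \<rho>" "\<rho> \<le> t" using enn2real_min_bounds[of t "\<eta> \<omega>"] t by (auto simp: \<rho>_def)
  define j where "j = nat \<lceil>\<rho> * Suc N / t\<rceil>"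
  have q0: "0 \<le> \<rho> * Suc N / t" using \<rho> t by auto
  have "\<rho> * Suc N / t \<le> Suc N"
    using \<rho> t by (simp add: pos_divide_le_eq mult.commute[of _ t] mult_right_mono del: of_nat_Suc)
  then have jN: "j \<le> Suc N" unfolding j_def by (simp add: nat_le_iff ceiling_le_iff)
  have lt_iff: "ennreal (t * real i / Suc N) < \<eta> \<omega> \<longleftrightarrow> i < j" if i: "i < Suc N" for i
  proof -
    have "t * real i / Suc N < t" using t i by (simp add: divide_less_eq)
    then have "ennreal (t * real i / Suc N) < \<eta> \<omega> \<longleftrightarrow> t * real i / Suc N < \<rho>"
      unfolding \<rho>_def using t by (intro ennreal_less_enn2real_min) auto
    also have "\<dots> \<longleftrightarrow> real i < \<rho> * Suc N / t"
      using t by (simp add: pos_less_divide_eq pos_divide_less_eq mult.commute del: of_nat_Suc)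
    also have "\<dots> \<longleftrightarrow> i < j" unfolding j_def by linarith
    finally show ?thesis .
  qed
  have "stop_approx \<eta> t N \<omega> = (\<Sum>i<Suc N. if i < j then B (t * real (Suc i) / Suc N) \<omega> - B (t * real i / Suc N) \<omega> else 0)"
    unfolding stop_approx_def using lt_iff \<omega> by (intro sum.cong refl) (auto simp: indicator_def)
  also have "\<dots> = (\<Sum>i\<in>{..<Suc N} \<inter> {i. i < j}. B (t * real (Suc i) / Suc N) \<omega> - B (t * real i / Suc N) \<omega>)"
    by (subst sum.inter_restrict) (simp_all del: sum.lessThan_Suc of_nat_Suc)
  also have "{..<Suc N} \<inter> {i. i < j} = {..<j}" using jN by auto
  also have "(\<Sum>i<j. B (t * real (Suc i) / Suc N) \<omega> - B (t * real i / Suc N) \<omega>) = B (t * real j / Suc N) \<omega>"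
    by (subst sum_lessThan_telescope) (simp add: B_0)
  finally have 1: "stop_approx \<eta> t N \<omega> = B (t * real j / Suc N) \<omega>" .
  have j1: "\<rho> * Suc N / t \<le> j" unfolding j_def by linarith
  have j2: "real j \<le> \<rho> * Suc N / t + 1" unfolding j_def using q0 by linarith
  have "\<rho> = t * (\<rho> * Suc N / t) / Suc N" using t by simp
  also have "\<dots> \<le> t * real j / Suc N" using j1 t by (intro divide_right_mono mult_left_mono) auto
  finally have a: "\<rho> \<le> t * real j / Suc N" .
  have "t * real j / Suc N \<le> t * (\<rho> * Suc N / t + 1) / Suc N"
    using j2 t by (intro divide_right_mono mult_left_mono) auto
  also have "\<dots> = (\<rho> * Suc N + t) / Suc N" using t by (simp add: distrib_left del: of_nat_Suc)
  also have "\<dots> = \<rho> + t / Suc N" by (simp add: add_divide_distrib del: of_nat_Suc)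
  finally have "\<bar>t * real j / Suc N - \<rho>\<bar> \<le> t / Suc N" using a by simp
  then show ?thesis using 1 t by (intro exI[of _ "t * real j / Suc N"]) (auto simp: \<rho>_def)
qed

lemma stop_approx_tendsto:
  assumes t: "0 < t" and \<omega>: "\<omega> \<in> space M"
  shows "(\<lambda>N. stop_approx \<eta> t N \<omega>) \<longlonglongrightarrow> stopped_process B \<eta> t \<omega>"
proof -
  define \<rho> where "\<rho> = enn2real (min (\<eta> \<omega>) (ennreal t))"
  have \<rho>: "0 \<le> \<rho>" by (simp add: \<rho>_def)
  obtain r where r: "\<And>N. stop_approx \<eta> t N \<omega> = B (r N) \<omega>" "\<And>N. 0 \<le> r N" "\<And>N. \<bar>r N - \<rho>\<bar> \<le> t / Suc N"
    using stop_approx_eq[OF t \<omega>, of \<eta>] unfolding \<rho>_def by metis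
  have "(\<lambda>N. t / real (Suc N)) \<longlonglongrightarrow> 0" by real_asymp
  then have "(\<lambda>N. r N - \<rho>) \<longlonglongrightarrow> 0"
    by (rule Lim_null_comparison[rotated]) (use r(3) in auto)
  then have "r \<longlonglongrightarrow> \<rho>" by (rule LIM_zero_cancel)
  then have "(\<lambda>N. B (r N) \<omega>) \<longlonglongrightarrow> B \<rho> \<omega>"
    by (rule continuous_on_tendsto_compose[OF B_continuous]) (use r(2) \<rho> in auto)
  then show ?thesis by (simp add: r(1) stopped_process_def \<rho>_def)
qed

lemma stop_approx_measurable:
  assumes \<eta>: "stopping \<eta>" and t: "0 < t"
  shows "stop_approx \<eta> t N \<in> borel_measurable (F t)"
    "integrable M (\<lambda>\<omega>. (stop_approx \<eta> t N \<omega>)\<^sup>2)" "(\<integral>\<omega>. stop_approx \<eta> t N \<omega> \<partial>M) = 0"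
    "(\<integral>\<omega>. (stop_approx \<eta> t N \<omega>)\<^sup>2 \<partial>M) \<le> t"
proof -
  define \<tau> where "\<tau> i = t * real i / Suc N" for i
  define A where "A i = {\<omega>\<in>space M. ennreal (\<tau> i) < \<eta> \<omega>}" for i
  have e: "stop_approx \<eta> t N = (\<lambda>\<omega>. \<Sum>i<Suc N. indicator (A i) \<omega> * (B (\<tau> (Suc i)) \<omega> - B (\<tau> i) \<omega>))"
    unfolding A_def \<tau>_def by (rule ext) (rule stop_approx_def)
  have \<tau>: "0 \<le> \<tau> i" "\<tau> i \<le> \<tau> (Suc i)" for i
    using t unfolding \<tau>_def by (auto intro!: divide_right_mono mult_left_mono)
  have A: "A i \<in> sets (F (\<tau> i))" for i
    unfolding A_def using \<tau>(1) by (rule stopping_less[OF \<eta>])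
  have end_point: "\<tau> (Suc N) = t" "\<tau> 0 = 0" by (simp_all add: \<tau>_def del: of_nat_Suc)
  note m = predictable_sum_moments[of \<tau> A "Suc N", OF \<tau>(1) \<tau>(2) A]
  show "stop_approx \<eta> t N \<in> borel_measurable (F t)" using m(1) unfolding end_point e .
  show "integrable M (\<lambda>\<omega>. (stop_approx \<eta> t N \<omega>)\<^sup>2)" using m(2) unfolding e .
  show "(\<integral>\<omega>. stop_approx \<eta> t N \<omega> \<partial>M) = 0" using m(3) unfolding e .
  show "(\<integral>\<omega>. (stop_approx \<eta> t N \<omega>)\<^sup>2 \<partial>M) \<le> t" using m(4) unfolding end_point e by (simp only: diff_zero)
qed

text \<open>The approximations at horizon \<open>t\<close> use grid points of \<open>{0..t}\<close>
  only. They are \<open>F t\<close>-measurable, even though they evaluate the path slightly after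
  \<open>\<eta>\<close>.\<close>

lemma stopped_process_measurable:
  assumes \<eta>: "stopping \<eta>" and t: "0 \<le> t"
  shows "stopped_process B \<eta> t \<in> borel_measurable (F t)"
proof (cases "t = 0")
  case True
  then have "stopped_process B \<eta> t = (\<lambda>_. 0)" by (auto simp: stopped_process_def B_0 fun_eq_iff)
  then show ?thesis by simp
next
  case False
  then have t': "0 < t" using t by simp
  show ?thesis
  proof (rule borel_measurable_LIMSEQ_metric)
    show "stop_approx \<eta> t N \<in> borel_measurable (F t)" for N
      by (rule stop_approx_measurable(1)[OF \<eta> t'])
    show "(\<lambda>N. stop_approx \<eta> t N \<omega>) \<longlonglongrightarrow> stopped_process B \<eta> t \<omega>" if "\<omega> \<in> space (F t)" for \<omega>
      using that by (intro stop_approx_tendsto[OF t']) simp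
  qed
qed

text \<open>The approximations have mean \<open>0\<close> and second moment at most
  \<open>t\<close>, whatever the mesh. The bounded horizon \<open>t\<close> makes this work for
  unbounded and infinite stopping times.\<close>

lemma optional_stopping:
  assumes \<eta>: "stopping \<eta>" and t: "0 \<le> t"
  shows "integrable M (stopped_process B \<eta> t)" "(\<integral>\<omega>. stopped_process B \<eta> t \<omega> \<partial>M) = 0"
proof -
  have "integrable M (stopped_process B \<eta> t) \<and> (\<integral>\<omega>. stopped_process B \<eta> t \<omega> \<partial>M) = 0"
  proof (cases "t = 0")
    case True
    then have "stopped_process B \<eta> t = (\<lambda>_. 0)" by (auto simp: stopped_process_def B_0 fun_eq_iff)
    then show ?thesis by simp
  next
    case False
    then have t': "0 < t" using t by simp
    note m = stop_approx_measurable[OF \<eta> t']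
    have AE: "AE \<omega> in M. (\<lambda>N. stop_approx \<eta> t N \<omega>) \<longlonglongrightarrow> stopped_process B \<eta> t \<omega>"
      using stop_approx_tendsto[OF t'] by (intro AE_I2)
    note L = L2_bounded_limit[OF F_measurable[OF m(1)] m(2) m(4) F_measurable[OF stopped_process_measurable[OF \<eta> t]] AE]
    have "(\<lambda>N. 0) \<longlonglongrightarrow> (\<integral>\<omega>. stopped_process B \<eta> t \<omega> \<partial>M)"
      using L(2) unfolding m(3) .
    then show ?thesis using L(1) by (simp add: LIMSEQ_const_iff)
  qed
  then show "integrable M (stopped_process B \<eta> t)" "(\<integral>\<omega>. stopped_process B \<eta> t \<omega> \<partial>M) = 0" by auto
qed

text \<open>Hybrid rule: at time \<open>\<tau>\<close> continue to \<open>\<sigma>\<close> exactly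
  on \<open>G\<close>. The condition on \<open>G\<close> says that it belongs to the events known at
  \<open>\<tau>\<close>. Such rules turn integrals over \<open>G\<close> into expectations at
  stopping times and stand in for conditioning on the past of \<open>\<tau>\<close>.\<close>

lemma stopping_if:
  assumes \<tau>: "stopping \<tau>" and \<sigma>: "stopping \<sigma>" and le: "\<And>\<omega>. \<omega> \<in> space M \<Longrightarrow> \<tau> \<omega> \<le> \<sigma> \<omega>"
    and G: "G \<subseteq> space M" "\<And>t. 0 \<le> t \<Longrightarrow> G \<inter> {\<omega>\<in>space M. \<tau> \<omega> \<le> ennreal t} \<in> sets (F t)"
  shows "stopping (\<lambda>\<omega>. if \<omega> \<in> G then \<sigma> \<omega> else \<tau> \<omega>)"
  unfolding ext_stopping_time_def
proof (intro allI impI)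
  fix t :: real assume t: "0 \<le> t"
  have "{\<omega>\<in>space M. (if \<omega> \<in> G then \<sigma> \<omega> else \<tau> \<omega>) \<le> ennreal t}
    = (G \<inter> {\<omega>\<in>space M. \<tau> \<omega> \<le> ennreal t}) \<inter> {\<omega>\<in>space M. \<sigma> \<omega> \<le> ennreal t}
      \<union> ({\<omega>\<in>space M. \<tau> \<omega> \<le> ennreal t} - (G \<inter> {\<omega>\<in>space M. \<tau> \<omega> \<le> ennreal t}))"
    using le by (auto intro: order_trans)
  moreover have "{\<omega>\<in>space M. \<tau> \<omega> \<le> ennreal t} \<in> sets (F t)" "{\<omega>\<in>space M. \<sigma> \<omega> \<le> ennreal t} \<in> sets (F t)"
    using \<tau> \<sigma> t by (auto simp: ext_stopping_time_def)
  ultimately show "{\<omega>\<in>space M. (if \<omega> \<in> G then \<sigma> \<omega> else \<tau> \<omega>) \<le> ennreal t} \<in> sets (F t)"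
    using G(2)[OF t] by (simp add: sets.Int sets.Un sets.Diff)
qed

lemma stopping_min_const:
  assumes "stopping \<eta>" "0 \<le> s"
  shows "stopping (\<lambda>\<omega>. min (\<eta> \<omega>) (ennreal s))"
  unfolding ext_stopping_time_def
proof (intro allI impI)
  fix t :: real assume t: "0 \<le> t"
  show "{\<omega>\<in>space M. min (\<eta> \<omega>) (ennreal s) \<le> ennreal t} \<in> sets (F t)"
  proof (cases "s \<le> t")
    case True
    then have "{\<omega>\<in>space M. min (\<eta> \<omega>) (ennreal s) \<le> ennreal t} = space (F t)"
      by (auto simp: min_le_iff_disj ennreal_leI)
    then show ?thesis using sets.top[of "F t"] by simp
  next
    case False
    then have "{\<omega>\<in>space M. min (\<eta> \<omega>) (ennreal s) \<le> ennreal t} = {\<omega>\<in>space M. \<eta> \<omega> \<le> ennreal t}"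
      using t by (auto simp: min_le_iff_disj)
    then show ?thesis using assms(1) t by (simp add: ext_stopping_time_def)
  qed
qed

text \<open>The hybrid time follows \<open>\<sigma>\<close> on \<open>G\<close> and
  \<open>\<tau>\<close> elsewhere; so the integral is the difference of the means at the hybrid time
  and at \<open>\<tau>\<close>, both of which are \<open>0\<close>.\<close>

lemma stopped_increment_zero:
  assumes \<tau>: "stopping \<tau>" and \<sigma>: "stopping \<sigma>" and le: "\<And>\<omega>. \<omega> \<in> space M \<Longrightarrow> \<tau> \<omega> \<le> \<sigma> \<omega>"
    and G: "G \<in> sets M" "\<And>t. 0 \<le> t \<Longrightarrow> G \<inter> {\<omega>\<in>space M. \<tau> \<omega> \<le> ennreal t} \<in> sets (F t)" and t: "0 \<le> t"
  shows "(\<integral>\<omega>. indicator G \<omega> * (stopped_process B \<sigma> t \<omega> - stopped_process B \<tau> t \<omega>) \<partial>M) = 0"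
proof -
  define \<theta> where "\<theta> \<omega> = (if \<omega> \<in> G then \<sigma> \<omega> else \<tau> \<omega>)" for \<omega>
  have \<theta>: "stopping \<theta>" unfolding \<theta>_def
    using G by (intro stopping_if \<tau> \<sigma> le) (auto dest: sets.sets_into_space)
  have "(\<integral>\<omega>. indicator G \<omega> * (stopped_process B \<sigma> t \<omega> - stopped_process B \<tau> t \<omega>) \<partial>M)
    = (\<integral>\<omega>. stopped_process B \<theta> t \<omega> - stopped_process B \<tau> t \<omega> \<partial>M)"
    by (intro Bochner_Integration.integral_cong) (auto simp: \<theta>_def stopped_process_def indicator_def)
  also have "\<dots> = 0"
    using optional_stopping[OF \<theta> t] optional_stopping[OF \<tau> t] by simp
  finally show ?thesis .
qed

lemma stopped_process_eq_min:
  assumes "0 \<le> s" "s \<le> t"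
  shows "stopped_process B (\<lambda>\<omega>. min (\<eta> \<omega>) (ennreal s)) t = stopped_process B \<eta> s"
proof -
  have "min (min x (ennreal s)) (ennreal t) = min x (ennreal s)" for x
    using assms by (metis ennreal_leI min.absorb1 min.assoc)
  then show ?thesis by (simp add: stopped_process_def fun_eq_iff)
qed

text \<open>For \<open>A\<close> in \<open>F s\<close> the increment from \<open>s\<close> to
  \<open>t\<close> vanishes where \<open>\<eta> \<le> s\<close>. On the rest of \<open>A\<close> it
  is the increment from \<open>min (\<eta> \<omega>) (ennreal s)\<close> to
  \<open>\<eta> \<omega>\<close>, over an event known at the former time. This gives equality of
  conditional expectations, hence the inequality.\<close>

lemma stopped_supermartingale:
  assumes \<eta>: "stopping \<eta>"
  shows "supermartingale M F (stopped_process B \<eta>)"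
  unfolding supermartingale_def adapted_def
proof (intro conjI allI impI)
  fix s t :: real assume st: "0 \<le> s \<and> s \<le> t"
  interpret S: finite_measure_subalgebra M "F s" by unfold_locales (rule F_subalgebra)
  let ?X = "stopped_process B \<eta>"
  have "AE \<omega> in M. real_cond_exp M (F s) (?X t) \<omega> = ?X s \<omega>"
  proof (rule S.real_cond_exp_charact)
    fix A assume A: "A \<in> sets (F s)"
    have AM: "A \<in> sets M" by (rule F_sets[OF A])
    let ?\<tau> = "\<lambda>\<omega>. min (\<eta> \<omega>) (ennreal s)"
    have eq: "stopped_process B ?\<tau> t = ?X s" using st by (intro stopped_process_eq_min) auto
    define G where "G = A \<inter> {\<omega>\<in>space M. ennreal s < \<eta> \<omega>}"
    have G: "G \<in> sets (F s)"
      unfolding G_def using A stopping_less[OF \<eta>, of s] st by (intro sets.Int) auto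
    have int: "integrable M (?X t)" "integrable M (?X s)" using optional_stopping[OF \<eta>] st by auto
    have "(\<integral>\<omega>. indicator A \<omega> * (?X t \<omega> - ?X s \<omega>) \<partial>M) = (\<integral>\<omega>. indicator G \<omega> * (?X t \<omega> - ?X s \<omega>) \<partial>M)"
    proof (intro Bochner_Integration.integral_cong refl)
      fix \<omega> assume "\<omega> \<in> space M"
      have "?X t \<omega> = ?X s \<omega>" if "\<not> ennreal s < \<eta> \<omega>"
      proof -
        have "\<eta> \<omega> \<le> ennreal s" "\<eta> \<omega> \<le> ennreal t"
          using that st by (auto simp: not_less intro: order_trans ennreal_leI)
        then show ?thesis by (simp add: stopped_process_def min.absorb1)
      qed
      then show "indicator A \<omega> * (?X t \<omega> - ?X s \<omega>) = indicator G \<omega> * (?X t \<omega> - ?X s \<omega>)"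
        using \<open>\<omega> \<in> space M\<close> by (auto simp: G_def indicator_def)
    qed
    also have "\<dots> = (\<integral>\<omega>. indicator G \<omega> * (?X t \<omega> - stopped_process B ?\<tau> t \<omega>) \<partial>M)"
      unfolding eq ..
    also have "\<dots> = 0"
    proof (rule stopped_increment_zero[OF stopping_min_const[OF \<eta>] \<eta>])
      fix r :: real assume r: "0 \<le> r"
      show "G \<inter> {\<omega>\<in>space M. min (\<eta> \<omega>) (ennreal s) \<le> ennreal r} \<in> sets (F r)"
      proof (cases "s \<le> r")
        case True
        then have "G \<inter> {\<omega>\<in>space M. min (\<eta> \<omega>) (ennreal s) \<le> ennreal r} = G"
          using sets.sets_into_space[OF G] by (auto simp: min_le_iff_disj ennreal_leI)
        then show ?thesis using F_mono[OF True G] by simp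
      next
        case False
        then have "\<not> ennreal s \<le> ennreal r" using r by simp
        moreover have "ennreal r \<le> ennreal s" using False by (intro ennreal_leI) simp
        ultimately have "G \<inter> {\<omega>\<in>space M. min (\<eta> \<omega>) (ennreal s) \<le> ennreal r} = {}"
          unfolding G_def by (auto simp: min_le_iff_disj)
        then show ?thesis by simp
      qed
    qed (use st F_sets[OF G] in auto)
    finally have "(\<integral>\<omega>. indicator A \<omega> * (?X t \<omega> - ?X s \<omega>) \<partial>M) = 0" .
    moreover have "integrable M (\<lambda>\<omega>. indicator A \<omega> * ?X t \<omega>)" "integrable M (\<lambda>\<omega>. indicator A \<omega> * ?X s \<omega>)"
      using integrable_mult_indicator[OF AM int(1)] integrable_mult_indicator[OF AM int(2)] by simp_all
    ultimately show "(\<integral>\<omega>\<in>A. ?X t \<omega> \<partial>M) = (\<integral>\<omega>\<in>A. ?X s \<omega> \<partial>M)"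
      by (simp add: set_lebesgue_integral_def right_diff_distrib)
  qed (use optional_stopping[OF \<eta>] stopped_process_measurable[OF \<eta>] st in auto)
  then show "AE \<omega> in M. real_cond_exp M (F s) (?X t) \<omega> \<le> ?X s \<omega>"
    by eventually_elim simp
qed (use optional_stopping[OF \<eta>] stopped_process_measurable[OF \<eta>] in auto)

section \<open>Hitting times of levels\<close>

definition hit :: "('a \<Rightarrow> ennreal) \<Rightarrow> real \<Rightarrow> 'a \<Rightarrow> ennreal" where
  "hit \<rho> c \<omega> = Inf {ennreal r | r. 0 \<le> r \<and> \<rho> \<omega> \<le> ennreal r \<and> B r \<omega> = c}"

lemma B_right: "\<forall>t\<ge>0. ((\<lambda>t. B t \<omega>) \<longlongrightarrow> B t \<omega>) (at_right t)"
proof (intro allI impI)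
  fix t :: real assume "0 \<le> t"
  have "((\<lambda>t. B t \<omega>) \<longlongrightarrow> B t \<omega>) (at t within {0..})"
    using B_continuous[of \<omega>] \<open>0 \<le> t\<close> by (simp add: continuous_on_def)
  then show "((\<lambda>t. B t \<omega>) \<longlongrightarrow> B t \<omega>) (at_right t)"
    by (rule tendsto_within_subset) (use \<open>0 \<le> t\<close> in auto)
qed

lemma B_continuous': "0 \<le> a \<Longrightarrow> continuous_on {a..b} (\<lambda>t. B t \<omega>)"
  by (rule continuous_on_subset[OF B_continuous]) auto

text \<open>From a finite time \<open>\<rho> \<omega>\<close> on, the visits to \<open>c\<close>
  form a closed set by continuity, so the infimum is attained if there is a visit. Otherwise, in
  particular for infinite \<open>\<rho> \<omega>\<close>, it is the infimum of the empty set, which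
  is \<open>top\<close>.\<close>

lemma hit_cases:
  obtains (never) "hit \<rho> c \<omega> = top" "\<And>r. 0 \<le> r \<Longrightarrow> \<rho> \<omega> \<le> ennreal r \<Longrightarrow> B r \<omega> \<noteq> c"
  | (at) r where "0 \<le> r" "hit \<rho> c \<omega> = ennreal r" "\<rho> \<omega> \<le> ennreal r" "B r \<omega> = c"
      "\<And>r'. 0 \<le> r' \<Longrightarrow> r' < r \<Longrightarrow> \<rho> \<omega> \<le> ennreal r' \<Longrightarrow> B r' \<omega> \<noteq> c"
proof (cases "\<exists>r. 0 \<le> r \<and> \<rho> \<omega> \<le> ennreal r \<and> B r \<omega> = c")
  case False
  then have "{ennreal r | r. 0 \<le> r \<and> \<rho> \<omega> \<le> ennreal r \<and> B r \<omega> = c} = {}" by auto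
  then have "hit \<rho> c \<omega> = top" unfolding hit_def by (simp only: Inf_empty)
  then show ?thesis using never False by blast
next
  case True
  then obtain r1 where r1: "0 \<le> r1" "\<rho> \<omega> \<le> ennreal r1" "B r1 \<omega> = c" by blast
  define a where "a = enn2real (\<rho> \<omega>)"
  have "\<rho> \<omega> < top" using r1(2) by (rule le_less_trans) simp
  then have a: "0 \<le> a" "\<rho> \<omega> = ennreal a" by (simp_all add: a_def)
  define S where "S = {r \<in> {a..}. B r \<omega> = c}"
  have S_iff: "r \<in> S \<longleftrightarrow> 0 \<le> r \<and> \<rho> \<omega> \<le> ennreal r \<and> B r \<omega> = c" for r
  proof (cases "0 \<le> r")
    case False
    then show ?thesis using a(1) by (auto simp: S_def)
  next
    case True
    then show ?thesis using a by (simp add: S_def)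
  qed
  have S: "r1 \<in> S" using r1 S_iff by blast
  have clS: "closed S"
    unfolding S_def
    by (rule continuous_closed_preimage_constant) (auto intro: continuous_on_subset[OF B_continuous] simp: a(1))
  have bdd: "bdd_below S" by (rule bdd_belowI[of _ a]) (auto simp: S_def)
  define r where "r = Inf S"
  have rS: "r \<in> S" unfolding r_def using S clS bdd by (intro closed_contains_Inf) auto
  have low: "r \<le> r'" if "r' \<in> S" for r' unfolding r_def using that bdd by (rule cInf_lower)
  have "hit \<rho> c \<omega> = ennreal r"
    unfolding hit_def
  proof (rule antisym)
    show "Inf {ennreal r | r. 0 \<le> r \<and> \<rho> \<omega> \<le> ennreal r \<and> B r \<omega> = c} \<le> ennreal r"
      using rS unfolding S_iff by (intro Inf_lower) blast
    show "ennreal r \<le> Inf {ennreal r | r. 0 \<le> r \<and> \<rho> \<omega> \<le> ennreal r \<and> B r \<omega> = c}"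
    proof (rule Inf_greatest, clarify)
      fix r' assume "0 \<le> r'" "\<rho> \<omega> \<le> ennreal r'" "c = B r' \<omega>"
      then show "ennreal r \<le> ennreal r'" using low[of r'] S_iff[of r'] by (intro ennreal_leI) simp
    qed
  qed
  then show ?thesis
  proof (rule at[rotated])
    show "B r' \<omega> \<noteq> c" if "0 \<le> r'" "r' < r" "\<rho> \<omega> \<le> ennreal r'" for r'
      using that low[of r'] S_iff[of r'] by auto
  qed (use rS S_iff in auto)
qed

lemma hit_ge: "\<rho> \<omega> \<le> hit \<rho> c \<omega>"
  by (cases rule: hit_cases[of \<rho> c \<omega>]) auto

lemma hit_le_iff:
  assumes "0 \<le> t"
  shows "hit \<rho> c \<omega> \<le> ennreal t \<longleftrightarrow> (\<exists>r\<in>{0..t}. \<rho> \<omega> \<le> ennreal r \<and> B r \<omega> = c)"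
proof (cases rule: hit_cases[of \<rho> c \<omega>])
  case never
  then show ?thesis by (auto simp: top_unique)
next
  case (at r)
  show ?thesis
  proof
    assume "hit \<rho> c \<omega> \<le> ennreal t"
    then show "\<exists>r\<in>{0..t}. \<rho> \<omega> \<le> ennreal r \<and> B r \<omega> = c"
      using at assms by (intro bexI[of _ r]) auto
  next
    assume "\<exists>r\<in>{0..t}. \<rho> \<omega> \<le> ennreal r \<and> B r \<omega> = c"
    then obtain r' where r': "0 \<le> r'" "r' \<le> t" "\<rho> \<omega> \<le> ennreal r'" "B r' \<omega> = c" by auto
    then have "r \<le> r'" using at(5)[of r'] by (meson not_le)
    then show "hit \<rho> c \<omega> \<le> ennreal t" unfolding at(2) using r'(2) by (intro ennreal_leI) simp
  qed
qed

text \<open>A visit to \<open>c\<close> before \<open>t\<close> concerns uncountably many times.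
  Compactness of the interval from \<open>\<rho> \<omega>\<close> to \<open>t\<close> makes it
  equivalent to arbitrarily close approaches; these can be observed at the countably many grid
  points, and right-continuity supplies grid points that still lie after
  \<open>\<rho> \<omega>\<close>.\<close>

lemma stopping_hit:
  assumes \<rho>: "stopping \<rho>"
  shows "stopping (hit \<rho> c)"
  unfolding ext_stopping_time_def
proof (intro allI impI)
  fix t :: real assume t: "0 \<le> t"
  have iff: "hit \<rho> c \<omega> \<le> ennreal t \<longleftrightarrow>
      (\<forall>n. \<exists>d\<in>grid_points t. \<rho> \<omega> \<le> ennreal d \<and> \<bar>B d \<omega> - c\<bar> < 1 / real (Suc n))" for \<omega>
    unfolding hit_le_iff[OF t]
  proof
    assume "\<exists>r\<in>{0..t}. \<rho> \<omega> \<le> ennreal r \<and> B r \<omega> = c"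
    then obtain r where r: "r \<in> {0..t}" "\<rho> \<omega> \<le> ennreal r" "B r \<omega> = c" by blast
    show "\<forall>n. \<exists>d\<in>grid_points t. \<rho> \<omega> \<le> ennreal d \<and> \<bar>B d \<omega> - c\<bar> < 1 / real (Suc n)"
    proof
      fix n
      have "B r \<omega> \<in> ball c (1 / real (Suc n))" using r(3) by simp
      from grid_points_dense_right[OF B_right r(1) open_ball this]
      obtain d where d: "d \<in> grid_points t" "r \<le> d" "B d \<omega> \<in> ball c (1 / real (Suc n))" by blast
      have "\<rho> \<omega> \<le> ennreal d" using r(2) ennreal_leI[OF d(2)] by (rule order_trans)
      then show "\<exists>d\<in>grid_points t. \<rho> \<omega> \<le> ennreal d \<and> \<bar>B d \<omega> - c\<bar> < 1 / real (Suc n)"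
        using d by (intro bexI[of _ d]) (auto simp: dist_real_def abs_minus_commute)
    qed
  next
    assume *: "\<forall>n. \<exists>d\<in>grid_points t. \<rho> \<omega> \<le> ennreal d \<and> \<bar>B d \<omega> - c\<bar> < 1 / real (Suc n)"
    obtain d0 where d0: "d0 \<in> grid_points t" "\<rho> \<omega> \<le> ennreal d0" using * by blast
    define a where "a = enn2real (\<rho> \<omega>)"
    have "\<rho> \<omega> < top" using d0(2) by (rule le_less_trans) simp
    then have a: "0 \<le> a" "\<rho> \<omega> = ennreal a" by (simp_all add: a_def)
    have in_iff: "d \<in> {a..t}" if "d \<in> grid_points t" "\<rho> \<omega> \<le> ennreal d" for d
      using grid_points_subset[OF t] that a by auto
    have cont: "continuous_on {a..t} (\<lambda>r. \<bar>B r \<omega> - c\<bar>)"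
      using B_continuous'[OF a(1), of t \<omega>] by (intro continuous_intros)
    have ne: "{a..t} \<noteq> {}" using in_iff[OF d0] by auto
    obtain r where r: "r \<in> {a..t}" "\<forall>y\<in>{a..t}. \<bar>B r \<omega> - c\<bar> \<le> \<bar>B y \<omega> - c\<bar>"
      using continuous_attains_inf[OF compact_Icc ne cont] by blast
    have "\<bar>B r \<omega> - c\<bar> \<le> 1 / real (Suc n)" for n
    proof -
      obtain d where d: "d \<in> grid_points t" "\<rho> \<omega> \<le> ennreal d" "\<bar>B d \<omega> - c\<bar> < 1 / real (Suc n)" using * by blast
      have "\<bar>B r \<omega> - c\<bar> \<le> \<bar>B d \<omega> - c\<bar>" using r(2) in_iff[OF d(1,2)] by blast
      then show ?thesis using d(3) by simp
    qed
    moreover have "(\<lambda>n. 1 / real (Suc n)) \<longlonglongrightarrow> 0" using LIMSEQ_inverse_real_of_nat by (simp add: inverse_eq_divide)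
    ultimately have "\<bar>B r \<omega> - c\<bar> \<le> 0" by (intro LIMSEQ_le_const) auto
    then show "\<exists>r\<in>{0..t}. \<rho> \<omega> \<le> ennreal r \<and> B r \<omega> = c"
      using r(1) a by (intro bexI[of _ r]) (auto intro: ennreal_leI)
  qed
  define U where "U n = (\<Union>d\<in>grid_points t.
    {\<omega>\<in>space M. \<rho> \<omega> \<le> ennreal d} \<inter> {\<omega>\<in>space M. \<bar>B d \<omega> - c\<bar> < 1 / real (Suc n)})" for n
  have "U n \<in> sets (F t)" for n
    unfolding U_def
  proof (rule sets.countable_UN''[OF countable_grid_points])
    fix d assume d: "d \<in> grid_points t"
    then have d': "0 \<le> d" "d \<le> t" using grid_points_subset[OF t] by auto
    have 1: "{\<omega>\<in>space M. \<rho> \<omega> \<le> ennreal d} \<in> sets (F t)"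
      using \<rho> d' by (intro F_mono[OF d'(2)]) (simp add: ext_stopping_time_def)
    have [measurable]: "B d \<in> borel_measurable (F t)" using d' by (rule measurable_natural_filtration)
    have "{\<omega>\<in>space (F t). \<bar>B d \<omega> - c\<bar> < 1 / real (Suc n)} \<in> sets (F t)" by measurable
    then show "{\<omega>\<in>space M. \<rho> \<omega> \<le> ennreal d} \<inter> {\<omega>\<in>space M. \<bar>B d \<omega> - c\<bar> < 1 / real (Suc n)} \<in> sets (F t)"
      unfolding space_natural_filtration by (rule sets.Int[OF 1])
  qed
  then have "(\<Inter>n. U n) \<in> sets (F t)" by (intro sets.countable_INT) auto
  also have "(\<Inter>n. U n) = {\<omega>\<in>space M. hit \<rho> c \<omega> \<le> ennreal t}"
    unfolding iff U_def by auto
  finally show "{\<omega>\<in>space M. hit \<rho> c \<omega> \<le> ennreal t} \<in> sets (F t)" .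
qed

lemma no_cross:
  assumes "0 \<le> u" "u \<le> v" and ne: "\<And>r. u \<le> r \<Longrightarrow> r \<le> v \<Longrightarrow> B r \<omega> \<noteq> c"
  shows "c < B u \<omega> \<Longrightarrow> c < B v \<omega>" "B u \<omega> < c \<Longrightarrow> B v \<omega> < c"
proof -
  note cont = B_continuous'[OF assms(1), of v \<omega>]
  show "c < B v \<omega>" if "c < B u \<omega>"
  proof (rule ccontr)
    assume "\<not> c < B v \<omega>"
    then have "B v \<omega> \<le> c" "c \<le> B u \<omega>" using that by auto
    from IVT2'[of "\<lambda>t. B t \<omega>" v c u, OF this assms(2) cont]
    obtain r where "u \<le> r" "r \<le> v" "B r \<omega> = c" by blast
    then show False using ne by blast
  qed
  show "B v \<omega> < c" if "B u \<omega> < c"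
  proof (rule ccontr)
    assume "\<not> B v \<omega> < c"
    then have "B u \<omega> \<le> c" "c \<le> B v \<omega>" using that by auto
    from IVT'[of "\<lambda>t. B t \<omega>" u c v, OF this assms(2) cont]
    obtain r where "u \<le> r" "r \<le> v" "B r \<omega> = c" by blast
    then show False using ne by blast
  qed
qed

lemma stopping_sets:
  assumes "stopping \<eta>"
  shows "{\<omega>\<in>space M. \<eta> \<omega> \<le> ennreal t} \<in> sets M"
proof (cases "0 \<le> t")
  case True
  then show ?thesis using assms by (intro F_sets[of _ t]) (simp add: ext_stopping_time_def)
next
  case False
  then have "{\<omega>\<in>space M. \<eta> \<omega> \<le> ennreal t} = {\<omega>\<in>space M. \<eta> \<omega> \<le> ennreal 0}"
    by (simp add: ennreal_neg)
  moreover have "{\<omega>\<in>space M. \<eta> \<omega> \<le> ennreal 0} \<in> sets M"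
    using assms unfolding ext_stopping_time_def by (intro F_sets[of _ 0]) blast
  ultimately show ?thesis by (simp only:)
qed

lemma stopping_measurable: "stopping \<eta> \<Longrightarrow> \<eta> \<in> borel_measurable M"
proof (rule borel_measurableI_le)
  fix y :: ennreal assume \<eta>: "stopping \<eta>"
  show "{\<omega>\<in>space M. \<eta> \<omega> \<le> y} \<in> sets M"
  proof (cases y)
    case (real r)
    then show ?thesis using stopping_sets[OF \<eta>] by simp
  qed simp
qed

lemma stopping_min:
  assumes "stopping \<sigma>" "stopping \<tau>"
  shows "stopping (\<lambda>\<omega>. min (\<sigma> \<omega>) (\<tau> \<omega>))"
  unfolding ext_stopping_time_def
proof (intro allI impI)
  fix t :: real assume "0 \<le> t"
  then have "{\<omega>\<in>space M. \<sigma> \<omega> \<le> ennreal t} \<in> sets (F t)" "{\<omega>\<in>space M. \<tau> \<omega> \<le> ennreal t} \<in> sets (F t)"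
    using assms by (simp_all add: ext_stopping_time_def)
  then have "{\<omega>\<in>space M. \<sigma> \<omega> \<le> ennreal t} \<union> {\<omega>\<in>space M. \<tau> \<omega> \<le> ennreal t} \<in> sets (F t)"
    by (rule sets.Un)
  also have "{\<omega>\<in>space M. \<sigma> \<omega> \<le> ennreal t} \<union> {\<omega>\<in>space M. \<tau> \<omega> \<le> ennreal t}
    = {\<omega>\<in>space M. min (\<sigma> \<omega>) (\<tau> \<omega>) \<le> ennreal t}"
    by (auto simp: min_le_iff_disj)
  finally show "{\<omega>\<in>space M. min (\<sigma> \<omega>) (\<tau> \<omega>) \<le> ennreal t} \<in> sets (F t)" .
qed

text \<open>A rational \<open>r \<le> t\<close> between the two times decides the comparison through
  the events \<open>\<sigma> \<omega> \<le> ennreal r\<close> and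
  \<open>ennreal r < \<tau> \<omega>\<close>, both known at time \<open>r\<close>.\<close>

lemma stopping_less_stopping:
  assumes \<sigma>: "stopping \<sigma>" and \<tau>: "stopping \<tau>" and t: "0 \<le> t"
  shows "{\<omega>\<in>space M. \<sigma> \<omega> < \<tau> \<omega>} \<inter> {\<omega>\<in>space M. \<tau> \<omega> \<le> ennreal t} \<in> sets (F t)"
proof -
  have "{\<omega>\<in>space M. \<sigma> \<omega> < \<tau> \<omega>} \<inter> {\<omega>\<in>space M. \<tau> \<omega> \<le> ennreal t}
    = (\<Union>r\<in>{r\<in>\<rat>. 0 \<le> r \<and> r \<le> t}. {\<omega>\<in>space M. \<sigma> \<omega> \<le> ennreal r} \<inter> {\<omega>\<in>space M. ennreal r < \<tau> \<omega>})
        \<inter> {\<omega>\<in>space M. \<tau> \<omega> \<le> ennreal t}" (is "?L = ?R")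
  proof
    show "?R \<subseteq> ?L" by (auto intro: le_less_trans)
    show "?L \<subseteq> ?R"
    proof
      fix \<omega> assume "\<omega> \<in> ?L"
      then have \<omega>: "\<omega> \<in> space M" "\<sigma> \<omega> < \<tau> \<omega>" "\<tau> \<omega> \<le> ennreal t" by auto
      obtain q where q: "\<sigma> \<omega> < ennreal (real_of_rat q)" "ennreal (real_of_rat q) < \<tau> \<omega>"
        using ennreal_rat_dense[OF \<omega>(2)] by blast
      \<comment> \<open>\<open>ennreal\<close> sends negative reals to \<open>0\<close>, so a
        negative separating rational would force \<open>\<sigma> \<omega> < 0\<close>.\<close>
      have "0 \<le> real_of_rat q"
      proof (rule ccontr)
        assume "\<not> 0 \<le> real_of_rat q"
        then have "ennreal (real_of_rat q) = 0" by (intro ennreal_neg) simp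
        then show False using q(1) by simp
      qed
      moreover have "real_of_rat q \<le> t"
        using less_le_trans[OF q(2) \<omega>(3)] t by (metis ennreal_leI leD linear)
      ultimately have "real_of_rat q \<in> {r\<in>\<rat>. 0 \<le> r \<and> r \<le> t}" by simp
      moreover have "\<omega> \<in> {\<omega>\<in>space M. \<sigma> \<omega> \<le> ennreal (real_of_rat q)} \<inter> {\<omega>\<in>space M. ennreal (real_of_rat q) < \<tau> \<omega>}"
        using q \<omega>(1) by (simp add: less_imp_le)
      ultimately have "\<omega> \<in> (\<Union>r\<in>{r\<in>\<rat>. 0 \<le> r \<and> r \<le> t}. {\<omega>\<in>space M. \<sigma> \<omega> \<le> ennreal r} \<inter> {\<omega>\<in>space M. ennreal r < \<tau> \<omega>})"
        by (rule UN_I)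
      then show "\<omega> \<in> ?R" using \<omega>(1,3) by simp
    qed
  qed
  also have "\<dots> \<in> sets (F t)"
  proof (intro sets.Int sets.countable_UN'')
    show "countable {r::real\<in>\<rat>. 0 \<le> r \<and> r \<le> t}" by (rule countable_subset[OF _ countable_rat]) auto
    fix r assume "r \<in> {r::real\<in>\<rat>. 0 \<le> r \<and> r \<le> t}"
    then have r: "0 \<le> r" "r \<le> t" by auto
    show "{\<omega>\<in>space M. \<sigma> \<omega> \<le> ennreal r} \<in> sets (F t)"
      using \<sigma> r by (intro F_mono[OF r(2)]) (simp add: ext_stopping_time_def)
    show "{\<omega>\<in>space M. ennreal r < \<tau> \<omega>} \<in> sets (F t)"
      using r by (intro F_mono[OF r(2)] stopping_less[OF \<tau>])
  qed (use \<tau> t in \<open>simp add: ext_stopping_time_def\<close>)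
  finally show ?thesis .
qed

section \<open>Gambler's ruin\<close>

lemma small_ball:
  assumes t: "0 < t" and R: "0 \<le> R"
  shows "prob {\<omega>\<in>space M. \<bar>B t \<omega>\<bar> \<le> R} \<le> 2 * R / sqrt (2 * pi * t)"
proof -
  have D: "distributed M lborel (B t) (\<lambda>x. ennreal (normal_density 0 (sqrt t) x))"
    using B_normal[of 0 t] t by (simp add: B_0)
  have nd: "normal_density 0 (sqrt t) x \<le> 1 / sqrt (2 * pi * t)" for x
    using t by (simp add: normal_density_def divide_right_mono)
  have "emeasure M (B t -` {-R..R} \<inter> space M) = (\<integral>\<^sup>+ x. ennreal (normal_density 0 (sqrt t) x) * indicator {-R..R} x \<partial>lborel)"
    using D by (rule distributed_emeasure) simp
  also have "\<dots> \<le> (\<integral>\<^sup>+ x. ennreal (1 / sqrt (2 * pi * t)) * indicator {-R..R} x \<partial>lborel)"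
    by (intro nn_integral_mono mult_right_mono ennreal_leI nd) simp
  also have "\<dots> = ennreal (1 / sqrt (2 * pi * t)) * ennreal (2 * R)"
    using R by (subst nn_integral_cmult_indicator) auto
  also have "\<dots> = ennreal (2 * R / sqrt (2 * pi * t))"
    using R t by (simp add: ennreal_mult'[symmetric])
  finally have "ennreal (prob (B t -` {-R..R} \<inter> space M)) \<le> ennreal (2 * R / sqrt (2 * pi * t))"
    by (simp add: emeasure_eq_measure)
  moreover have "B t -` {-R..R} \<inter> space M = {\<omega>\<in>space M. \<bar>B t \<omega>\<bar> \<le> R}" by auto
  ultimately show ?thesis using R t by simp
qed

text \<open>Being trapped from \<open>N\<close> on forces
  \<open>\<bar>B n \<omega>\<bar> \<le> R\<close> at every later integer \<open>n\<close>, and the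
  probability of this is of order \<open>1 / sqrt n\<close>, like the maximum of the density at time
  \<open>n\<close>.\<close>

lemma AE_not_trapped:
  assumes R: "0 \<le> R"
  shows "AE \<omega> in M. \<not> (\<exists>N. \<forall>n\<ge>N. \<bar>B (real n) \<omega>\<bar> \<le> R)"
proof -
  have "AE \<omega> in M. \<not> (\<forall>n\<ge>N. \<bar>B (real n) \<omega>\<bar> \<le> R)" for N :: nat
  proof -
    note [measurable] = B_measurable
    define E where "E = {\<omega>\<in>space M. \<forall>n\<ge>N. \<bar>B (real n) \<omega>\<bar> \<le> R}"
    have [measurable]: "E \<in> sets M" unfolding E_def by measurable
    have "prob E \<le> 2 * R / sqrt (2 * pi * real n)" if "Suc N \<le> n" for n
    proof -
      have "prob E \<le> prob {\<omega>\<in>space M. \<bar>B (real n) \<omega>\<bar> \<le> R}"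
        using that by (intro finite_measure_mono) (auto simp: E_def)
      also have "\<dots> \<le> 2 * R / sqrt (2 * pi * real n)" using that R by (intro small_ball) auto
      finally show ?thesis .
    qed
    moreover have "(\<lambda>n. 2 * R / sqrt (2 * pi * real n)) \<longlonglongrightarrow> 0" by real_asymp
    ultimately have "prob E \<le> 0" by (intro LIMSEQ_le_const) auto
    then have "E \<in> null_sets M" by (simp add: emeasure_eq_measure measure_le_0_iff null_setsI)
    then show ?thesis by (rule AE_I') (auto simp: E_def)
  qed
  then have "AE \<omega> in M. \<forall>N::nat. \<not> (\<forall>n\<ge>N. \<bar>B (real n) \<omega>\<bar> \<le> R)" by (simp add: AE_all_countable)
  then show ?thesis by eventually_elim auto
qed

lemma before_hit_not:
  assumes "\<rho> \<omega> = ennreal r0" "0 \<le> r0" "r0 \<le> r" "ennreal r < hit \<rho> c \<omega>"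
  shows "B r \<omega> \<noteq> c"
proof
  assume "B r \<omega> = c"
  then have "hit \<rho> c \<omega> \<le> ennreal r"
    using assms by (subst hit_le_iff) (auto intro!: bexI[of _ r] ennreal_leI)
  then show False using assms(4) by simp
qed

lemma at_hit:
  assumes "hit \<rho> c \<omega> = ennreal r" "0 \<le> r"
  shows "B r \<omega> = c" "\<rho> \<omega> \<le> ennreal r"
  using assms by (cases rule: hit_cases[of \<rho> c \<omega>]; simp)+

lemma before_hit:
  assumes \<rho>: "\<rho> \<omega> = ennreal r0" "0 \<le> r0" "r0 \<le> v" and v: "ennreal v \<le> hit \<rho> c \<omega>"
  shows "c < B r0 \<omega> \<Longrightarrow> c \<le> B v \<omega>" "B r0 \<omega> < c \<Longrightarrow> B v \<omega> \<le> c"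
proof -
  have v0: "0 \<le> v" using \<rho> by simp
  have *: "(c < B r0 \<omega> \<longrightarrow> c \<le> B v \<omega>) \<and> (B r0 \<omega> < c \<longrightarrow> B v \<omega> \<le> c)"
  proof (cases "ennreal v = hit \<rho> c \<omega>")
    case True
    then have "B v \<omega> = c" using at_hit(1)[OF True[symmetric] v0] by simp
    then show ?thesis by simp
  next
    case False
    then have lt: "ennreal v < hit \<rho> c \<omega>" using v by simp
    have ne: "B r \<omega> \<noteq> c" if "r0 \<le> r" "r \<le> v" for r
    proof (rule before_hit_not[of \<rho> \<omega> r0, OF \<rho>(1,2) that(1)])
      have "ennreal r \<le> ennreal v" using that(2) by (rule ennreal_leI)
      then show "ennreal r < hit \<rho> c \<omega>" using lt by (rule le_less_trans)
    qed
    show ?thesis using no_cross[OF \<rho>(2,3) ne] by (auto intro: less_imp_le)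
  qed
  show "c < B r0 \<omega> \<Longrightarrow> c \<le> B v \<omega>" "B r0 \<omega> < c \<Longrightarrow> B v \<omega> \<le> c" using * by auto
qed

lemma ennreal_real_cases:
  assumes "x < (top::ennreal)"
  obtains r where "x = ennreal r" "0 \<le> r"
  using assms by (cases x) auto

text \<open>Between \<open>\<rho>\<close> and the exit time the path stays in \<open>{l..b}\<close>,
  so the stopped increment is bounded and its zero mean survives the passage to the unbounded exit
  time. Sorting by the exit point gives
  \<open>(b - c) * prob (G \<inter> U) + (l - c) * prob (G - U) = 0\<close>, where \<open>U\<close>
  is the exit at \<open>b\<close>. The condition \<open>prior\<close> says that \<open>G\<close> is
  known at \<open>\<rho>\<close>.\<close>

lemma gambler:
  assumes \<rho>: "stopping \<rho>" and fin: "AE \<omega> in M. \<rho> \<omega> < top"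
    and start: "\<forall>\<omega> r. 0 \<le> r \<longrightarrow> \<rho> \<omega> = ennreal r \<longrightarrow> B r \<omega> = c"
    and lcb: "l < c" "c < b"
    and G: "G \<in> sets M" and prior: "\<forall>t\<ge>0. G \<inter> {\<omega>\<in>space M. \<rho> \<omega> \<le> ennreal t} \<in> sets (F t)"
  shows "AE \<omega> in M. min (hit \<rho> b \<omega>) (hit \<rho> l \<omega>) < top"
    and "prob (G \<inter> {\<omega>\<in>space M. hit \<rho> b \<omega> < hit \<rho> l \<omega>}) * (b - l) = prob G * (c - l)"
proof -
  let ?\<sigma> = "hit \<rho> b" and ?\<tau> = "hit \<rho> l"
  define \<theta> where "\<theta> \<omega> = min (?\<sigma> \<omega>) (?\<tau> \<omega>)" for \<omega>
  have \<theta>: "stopping \<theta>" unfolding \<theta>_def[abs_def] by (intro stopping_min stopping_hit \<rho>)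
  have \<rho>\<theta>: "\<rho> \<omega> \<le> \<theta> \<omega>" for \<omega> unfolding \<theta>_def by (intro min.boundedI hit_ge)
  have range: "l \<le> B v \<omega>" "B v \<omega> \<le> b"
    if "\<rho> \<omega> = ennreal r0" "0 \<le> r0" "r0 \<le> v" "ennreal v \<le> \<theta> \<omega>" for \<omega> r0 v
  proof -
    have B0: "B r0 \<omega> = c" using start that(1,2) by blast
    have v: "ennreal v \<le> ?\<sigma> \<omega>" "ennreal v \<le> ?\<tau> \<omega>" using that(4) by (auto simp: \<theta>_def)
    show "l \<le> B v \<omega>" using before_hit(1)[of \<rho> \<omega> r0 v l, OF that(1-3) v(2)] lcb B0 by simp
    show "B v \<omega> \<le> b" using before_hit(2)[of \<rho> \<omega> r0 v b, OF that(1-3) v(1)] lcb B0 by simp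
  qed
  have R0: "0 \<le> \<bar>l\<bar> + \<bar>b\<bar>" by simp
  have fin\<theta>: "AE \<omega> in M. \<theta> \<omega> < top"
    using fin AE_not_trapped[OF R0]
  proof eventually_elim
    case (elim \<omega>)
    obtain r0 where r0: "\<rho> \<omega> = ennreal r0" "0 \<le> r0" using elim(1) by (rule ennreal_real_cases)
    show ?case
    proof (rule ccontr)
      assume "\<not> \<theta> \<omega> < top"
      then have top: "\<theta> \<omega> = top" by (simp add: less_top[symmetric])
      have "\<bar>B (real n) \<omega>\<bar> \<le> \<bar>l\<bar> + \<bar>b\<bar>" if "nat \<lceil>r0\<rceil> \<le> n" for n
      proof -
        have "r0 \<le> real n" using that by linarith
        then have "l \<le> B (real n) \<omega>" "B (real n) \<omega> \<le> b" using range[OF r0] top by auto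
        then show ?thesis by linarith
      qed
      then show False using elim(2) by blast
    qed
  qed
  then show "AE \<omega> in M. min (hit \<rho> b \<omega>) (hit \<rho> l \<omega>) < top" by (simp add: \<theta>_def)
  \<comment> \<open>Before \<open>\<rho>\<close> both stopped paths agree and the difference is
    \<open>0\<close>; from \<open>\<rho>\<close> on it moves between \<open>l - c\<close> and
    \<open>b - c\<close>. This is the constant bound \<open>b - l\<close> for dominated
    convergence.\<close>
  define D where "D n \<omega> = indicator G \<omega> * (stopped_process B \<theta> (real n) \<omega> - stopped_process B \<rho> (real n) \<omega>)"
    for n :: nat and \<omega>
  define U where "U = {\<omega>\<in>space M. ?\<sigma> \<omega> < ?\<tau> \<omega>}"
  have Um: "U \<in> sets M"
    unfolding U_def using stopping_measurable[OF stopping_hit[OF \<rho>]] by (intro borel_measurable_less)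
  define f where "f \<omega> = (b - c) * indicator (G \<inter> U) \<omega> + (l - c) * indicator (G - U) \<omega>" for \<omega>
  have "(\<lambda>n. \<integral>\<omega>. D n \<omega> \<partial>M) \<longlonglongrightarrow> (\<integral>\<omega>. f \<omega> \<partial>M)"
  proof (rule integral_dominated_convergence[where w="\<lambda>_. b - l"])
    show "f \<in> borel_measurable M" unfolding f_def[abs_def] using G Um by measurable
    show "D n \<in> borel_measurable M" for n
      unfolding D_def[abs_def]
      using F_measurable[OF stopped_process_measurable[OF \<theta>, of "real n"]]
        F_measurable[OF stopped_process_measurable[OF \<rho>, of "real n"]] G by measurable
    show "AE \<omega> in M. norm (D n \<omega>) \<le> b - l" for n
      using fin
    proof eventually_elim
      case (elim \<omega>)
      obtain r0 where r0: "\<rho> \<omega> = ennreal r0" "0 \<le> r0" using elim by (rule ennreal_real_cases)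
      have "\<bar>stopped_process B \<theta> (real n) \<omega> - stopped_process B \<rho> (real n) \<omega>\<bar> \<le> b - l"
      proof (cases "r0 \<le> real n")
        case True
        have \<rho>n: "stopped_process B \<rho> (real n) \<omega> = c"
          using stopped_process_at[of \<rho> \<omega> r0 "real n"] r0 True start r0 by simp
        define v where "v = enn2real (min (\<theta> \<omega>) (ennreal (real n)))"
        have "min (\<theta> \<omega>) (ennreal (real n)) < top" by (rule le_less_trans[OF min.cobounded2]) simp
        then have v: "ennreal v = min (\<theta> \<omega>) (ennreal (real n))" "0 \<le> v" by (simp_all add: v_def)
        have "ennreal r0 \<le> ennreal v" unfolding v(1) r0(1)[symmetric]
          using \<rho>\<theta>[of \<omega>] True r0 by (intro min.boundedI) (auto intro: ennreal_leI)
        then have "r0 \<le> v" using r0(2) v(2) by simp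
        moreover have "ennreal v \<le> \<theta> \<omega>" unfolding v(1) by simp
        ultimately have "l \<le> B v \<omega>" "B v \<omega> \<le> b" using range[OF r0] by auto
        moreover have "stopped_process B \<theta> (real n) \<omega> = B v \<omega>" by (simp add: stopped_process_def v_def)
        ultimately show ?thesis using \<rho>n lcb by simp
      next
        case False
        then have "ennreal (real n) \<le> \<rho> \<omega>" unfolding r0(1) by (intro ennreal_leI) simp
        then show ?thesis
          using stopped_process_before[of "real n" \<rho> \<omega>] stopped_process_before[of "real n" \<theta> \<omega>] \<rho>\<theta>[of \<omega>] lcb
          by (simp add: order_trans)
      qed
      then show ?case using lcb by (auto simp: D_def indicator_def)
    qed
    show "AE \<omega> in M. (\<lambda>n. D n \<omega>) \<longlonglongrightarrow> f \<omega>"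
      using fin fin\<theta> AE_space
    proof eventually_elim
      case (elim \<omega>)
      obtain r0 where r0: "\<rho> \<omega> = ennreal r0" "0 \<le> r0" using elim(1) by (rule ennreal_real_cases)
      obtain v where v: "\<theta> \<omega> = ennreal v" "0 \<le> v" using elim(2) by (rule ennreal_real_cases)
      have "r0 \<le> v" using \<rho>\<theta>[of \<omega>] r0 v by simp
      have Bv: "B v \<omega> = (if \<omega> \<in> U then b else l)"
      proof (cases "\<omega> \<in> U")
        case True
        then have "?\<sigma> \<omega> = ennreal v" using v(1) by (auto simp: U_def \<theta>_def min_def split: if_splits)
        from at_hit(1)[OF this v(2)] show ?thesis using True by simp
      next
        case False
        then have "?\<tau> \<omega> \<le> ?\<sigma> \<omega>" using elim(3) by (auto simp: U_def not_less)
        then have "?\<tau> \<omega> = ennreal v" using v(1) by (simp add: \<theta>_def min.absorb2)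
        from at_hit(1)[OF this v(2)] show ?thesis using False by simp
      qed
      have "eventually (\<lambda>n. D n \<omega> = f \<omega>) sequentially"
        unfolding eventually_sequentially
      proof (intro exI allI impI)
        fix n assume "nat \<lceil>v\<rceil> \<le> n"
        then have n: "v \<le> real n" "r0 \<le> real n" using \<open>r0 \<le> v\<close> by linarith+
        have "stopped_process B \<theta> (real n) \<omega> = B v \<omega>" by (rule stopped_process_at[where \<eta>=\<theta> and \<omega>=\<omega> and B=B, OF v n(1)])
        moreover have "stopped_process B \<rho> (real n) \<omega> = c"
          using stopped_process_at[where \<eta>=\<rho> and \<omega>=\<omega> and B=B, OF r0 n(2)] start r0 by simp
        ultimately show "D n \<omega> = f \<omega>" unfolding D_def f_def Bv by (auto simp: indicator_def)
      qed
      then show ?case by (rule tendsto_eventually)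
    qed
  qed simp
  moreover have "(\<integral>\<omega>. D n \<omega> \<partial>M) = 0" for n
    unfolding D_def using \<rho>\<theta> prior by (intro stopped_increment_zero \<rho> \<theta> G) auto
  ultimately have "(\<integral>\<omega>. f \<omega> \<partial>M) = 0" by (simp add: LIMSEQ_const_iff)
  moreover have "(\<integral>\<omega>. f \<omega> \<partial>M) = (b - c) * prob (G \<inter> U) + (l - c) * prob (G - U)"
  proof -
    have GU: "G \<inter> U \<in> sets M" "G - U \<in> sets M" using G Um by auto
    then have "integrable M (indicator (G \<inter> U) :: 'a \<Rightarrow> real)" "integrable M (indicator (G - U) :: 'a \<Rightarrow> real)"
      by (auto intro!: integrable_const_bound[where B=1])
    then show ?thesis unfolding f_def using GU by simp
  qed
  moreover have "prob (G - U) = prob G - prob (G \<inter> U)"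
    using G Um finite_measure_Diff'[of G U] by simp
  ultimately show "prob (G \<inter> {\<omega>\<in>space M. ?\<sigma> \<omega> < ?\<tau> \<omega>}) * (b - l) = prob G * (c - l)"
    unfolding U_def[symmetric] by (simp add: algebra_simps)
qed

text \<open>If the level \<open>l\<close> is never visited, then almost surely every
  \<open>b > c\<close> is visited before it. Gambler's ruin gives this probability
  \<open>(c - l) / (b - l)\<close>, which tends to \<open>0\<close> as \<open>b\<close>
  grows.\<close>

lemma hit_below_finite:
  assumes \<rho>: "stopping \<rho>" and fin: "AE \<omega> in M. \<rho> \<omega> < top"
    and start: "\<forall>\<omega> r. 0 \<le> r \<longrightarrow> \<rho> \<omega> = ennreal r \<longrightarrow> B r \<omega> = c" and lc: "l < c"
  shows "AE \<omega> in M. hit \<rho> l \<omega> < top"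
proof -
  define E where "E = {\<omega>\<in>space M. hit \<rho> l \<omega> = top}"
  have Em: "E \<in> sets M"
    unfolding E_def using stopping_measurable[OF stopping_hit[OF \<rho>]] by (intro borel_measurable_eq) auto
  have "prob E \<le> (c - l) / (real (Suc n) + (c - l))" for n
  proof -
    define b where "b = c + real (Suc n)"
    have cb: "c < b" by (simp add: b_def)
    have "space M \<inter> {\<omega>\<in>space M. \<rho> \<omega> \<le> ennreal t} = {\<omega>\<in>space M. \<rho> \<omega> \<le> ennreal t}" for t by auto
    then have sp: "\<forall>t\<ge>0. space M \<inter> {\<omega>\<in>space M. \<rho> \<omega> \<le> ennreal t} \<in> sets (F t)"
      using \<rho> by (simp add: ext_stopping_time_def)
    note g = gambler[OF \<rho> fin start lc cb sets.top sp]
    let ?U = "space M \<inter> {\<omega>\<in>space M. hit \<rho> b \<omega> < hit \<rho> l \<omega>}"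
    have "?U \<in> sets M"
      using stopping_measurable[OF stopping_hit[OF \<rho>]] by (intro sets.Int sets.top borel_measurable_less)
    moreover have "AE \<omega> in M. \<omega> \<in> E \<longrightarrow> \<omega> \<in> ?U"
      using g(1) by eventually_elim (auto simp: E_def min_def split: if_splits)
    ultimately have "prob E \<le> prob ?U" by (intro finite_measure_mono_AE)
    also have "\<dots> = (c - l) / (real (Suc n) + (c - l))"
    proof -
      have "prob ?U * (real (Suc n) + (c - l)) = c - l" using g(2) by (simp add: prob_space b_def algebra_simps)
      moreover have "0 < real (Suc n) + (c - l)" using lc by simp
      ultimately show ?thesis by (simp add: eq_divide_eq)
    qed
    finally show ?thesis .
  qed
  moreover have "(\<lambda>n. (c - l) / (real (Suc n) + (c - l))) \<longlonglongrightarrow> 0" by real_asymp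
  ultimately have "prob E \<le> 0" by (intro LIMSEQ_le_const) auto
  then have "E \<in> null_sets M" using Em by (simp add: emeasure_eq_measure measure_le_0_iff null_setsI)
  then show ?thesis by (rule AE_I') (auto simp: E_def less_top[symmetric])
qed

section \<open>The extremal stopping rule\<close>

primrec level_time :: "real \<Rightarrow> nat \<Rightarrow> 'a \<Rightarrow> ennreal" where
  "level_time q 0 = hit (\<lambda>_. 0) (- 1)"
| "level_time q (Suc k) = hit (level_time q k) (- (q ^ Suc k))"

text \<open>The height is measured in units of the next level \<open>q ^ Suc k\<close>, at which a
  stop after the excursion takes place. This makes the stages exact rescalings of one
  another.\<close>

definition upcross :: "real \<Rightarrow> real \<Rightarrow> nat \<Rightarrow> 'a set" where
  "upcross q s k = {\<omega>\<in>space M. hit (level_time q k) (s * q ^ Suc k) \<omega> < level_time q (Suc k) \<omega>}"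

primrec alive :: "real \<Rightarrow> real \<Rightarrow> nat \<Rightarrow> 'a set" where
  "alive q s 0 = space M"
| "alive q s (Suc k) = alive q s k - upcross q s k"

text \<open>An excursion to \<open>s * q ^ Suc k\<close> does not stop the process on the spot: it
  runs on to the next level \<open>- (q ^ Suc k)\<close>. Meanwhile the maximum, in units of
  \<open>q ^ Suc k\<close>, acquires the tail \<open>(1 + s) / (1 + u)\<close> for
  \<open>u \<ge> s\<close>, which produces the integral in the constant. After \<open>K\<close>
  stages the process is stopped in any case.\<close>

primrec stop_level :: "real \<Rightarrow> real \<Rightarrow> nat \<Rightarrow> 'a \<Rightarrow> nat" where
  "stop_level q s 0 \<omega> = 0"
| "stop_level q s (Suc k) \<omega> = (if \<omega> \<in> alive q s k then Suc k else stop_level q s k \<omega>)"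

definition stop_time :: "real \<Rightarrow> real \<Rightarrow> nat \<Rightarrow> 'a \<Rightarrow> ennreal" where
  "stop_time q s K \<omega> = level_time q (stop_level q s K \<omega>) \<omega>"

lemma stopping_0: "stopping (\<lambda>_. 0)"
  unfolding ext_stopping_time_def
proof (intro allI impI)
  fix t :: real
  have "{\<omega>\<in>space M. 0 \<le> ennreal t} = space (F t)" by simp
  then show "{\<omega>\<in>space M. 0 \<le> ennreal t} \<in> sets (F t)" by (simp only: sets.top)
qed

lemma start_0: "\<forall>\<omega> r. 0 \<le> r \<longrightarrow> 0 = ennreal r \<longrightarrow> B r \<omega> = 0"
proof (intro allI impI)
  fix \<omega> and r :: real assume r: "0 \<le> r" "0 = ennreal r"
  from r(2) have "r \<le> 0" by (simp only: eq_commute[of 0] ennreal_eq_0_iff)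
  then have "r = 0" using r(1) by simp
  then show "B r \<omega> = 0" by (simp add: B_0)
qed

lemma stopping_level_time: "stopping (level_time q k)"
proof (induction k)
  case 0
  show ?case unfolding level_time.simps by (rule stopping_hit[OF stopping_0])
next
  case (Suc k)
  then show ?case unfolding level_time.simps by (rule stopping_hit)
qed

lemma level_time_value: "0 \<le> r \<Longrightarrow> level_time q k \<omega> = ennreal r \<Longrightarrow> B r \<omega> = - (q ^ k)"
proof (cases k)
  case 0
  assume "0 \<le> r" "level_time q k \<omega> = ennreal r"
  then show ?thesis using at_hit(1)[of "\<lambda>_. 0" "- 1" \<omega> r] 0 by simp
next
  case (Suc j)
  assume "0 \<le> r" "level_time q k \<omega> = ennreal r"
  then show ?thesis using at_hit(1)[of "level_time q j" "- (q ^ Suc j)" \<omega> r] Suc by simp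
qed

lemma level_time_start: "\<forall>\<omega> r. 0 \<le> r \<longrightarrow> level_time q k \<omega> = ennreal r \<longrightarrow> B r \<omega> = - (q ^ k)"
  using level_time_value by blast

lemma level_time_finite:
  assumes q: "1 < q"
  shows "AE \<omega> in M. level_time q k \<omega> < top"
proof (induction k)
  case 0
  have "AE \<omega> in M. hit (\<lambda>_. 0) (- 1) \<omega> < top"
    by (rule hit_below_finite[where c=0, OF stopping_0 _ start_0]) simp_all
  then show ?case by simp
next
  case (Suc k)
  have "AE \<omega> in M. hit (level_time q k) (- (q ^ Suc k)) \<omega> < top"
  proof (rule hit_below_finite[OF stopping_level_time Suc level_time_start])
    show "- (q ^ Suc k) < - (q ^ k)" using q by simp
  qed
  then show ?case by simp
qed

lemma level_time_mono: "i \<le> j \<Longrightarrow> level_time q i \<omega> \<le> level_time q j \<omega>"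
proof (rule lift_Suc_mono_le[where f="\<lambda>k. level_time q k \<omega>"])
  show "level_time q k \<omega> \<le> level_time q (Suc k) \<omega>" for k
    unfolding level_time.simps by (rule hit_ge)
qed

lemma upcross_sets: "upcross q s k \<in> sets M"
  unfolding upcross_def
  using stopping_measurable[OF stopping_hit[OF stopping_level_time]] stopping_measurable[OF stopping_level_time]
  by (intro borel_measurable_less)

lemma alive_sets: "alive q s k \<in> sets M"
  by (induction k) (simp_all add: upcross_sets sets.Diff)

text \<open>\<open>alive q s k\<close> is known at \<open>level_time q k\<close>: whether an earlier
  stage had an upcrossing is a comparison of two stopping times, settled when the later one
  occurs.\<close>

lemma alive_prior:
  assumes t: "0 \<le> t"
  shows "alive q s k \<inter> {\<omega>\<in>space M. level_time q k \<omega> \<le> ennreal t} \<in> sets (F t)"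
proof (induction k)
  case 0
  have "alive q s 0 \<inter> {\<omega>\<in>space M. level_time q 0 \<omega> \<le> ennreal t} = {\<omega>\<in>space M. level_time q 0 \<omega> \<le> ennreal t}" by auto
  then show ?case using stopping_level_time[of q 0] t unfolding ext_stopping_time_def by simp
next
  case (Suc k)
  let ?L = "{\<omega>\<in>space M. level_time q (Suc k) \<omega> \<le> ennreal t}"
  have eq: "alive q s (Suc k) \<inter> ?L
    = (alive q s k \<inter> {\<omega>\<in>space M. level_time q k \<omega> \<le> ennreal t}) \<inter> ?L - upcross q s k \<inter> ?L"
    using order_trans[OF level_time_mono[of k "Suc k" q]] by auto
  have L: "?L \<in> sets (F t)"
    using stopping_level_time[of q "Suc k"] t unfolding ext_stopping_time_def by blast
  have U: "upcross q s k \<inter> ?L \<in> sets (F t)"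
    unfolding upcross_def
    by (rule stopping_less_stopping[OF stopping_hit[OF stopping_level_time] stopping_level_time t])
  show ?case unfolding eq by (rule sets.Diff[OF sets.Int[OF Suc L] U])
qed

lemma alive_prior': "\<forall>t\<ge>0. alive q s k \<inter> {\<omega>\<in>space M. level_time q k \<omega> \<le> ennreal t} \<in> sets (F t)"
  using alive_prior by blast

text \<open>Gambler's ruin from \<open>- (q ^ k)\<close> between \<open>- (q ^ Suc k)\<close> and
  \<open>u * q ^ Suc k\<close>; after division by \<open>q ^ Suc k\<close> the stage survives only
  through \<open>alive\<close>. The height \<open>u\<close> is separate from the threshold
  \<open>s\<close> of the survival event, so that the full tail of the maximum within a stage
  becomes available.\<close>

lemma prob_upcross:
  assumes q: "1 < q" and u: "0 < u"
  shows "prob (alive q s k \<inter> upcross q u k) = prob (alive q s k) * ((1 - 1 / q) / (1 + u))"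
proof -
  have qk: "0 < q ^ k" using q by simp
  have b: "- (q ^ k) < u * q ^ Suc k"
  proof -
    have "0 < u * q ^ Suc k" using u q by simp
    then show ?thesis using qk by linarith
  qed
  have l: "- (q ^ Suc k) < - (q ^ k)" using q by simp
  have "prob (alive q s k \<inter> upcross q u k) * (u * q ^ Suc k - - (q ^ Suc k))
    = prob (alive q s k) * (- (q ^ k) - - (q ^ Suc k))"
    unfolding upcross_def
    using gambler(2)[OF stopping_level_time level_time_finite[OF q] level_time_start l b alive_sets alive_prior'] by simp
  also have "- (q ^ k) - - (q ^ Suc k) = q ^ Suc k * (1 - 1 / q)" using q by (simp add: field_simps)
  also have "u * q ^ Suc k - - (q ^ Suc k) = q ^ Suc k * (1 + u)" by (simp add: algebra_simps)
  finally have "q ^ Suc k * (prob (alive q s k \<inter> upcross q u k) * (1 + u))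
    = q ^ Suc k * (prob (alive q s k) * (1 - 1 / q))" by (simp only: mult_ac)
  then have "prob (alive q s k \<inter> upcross q u k) * (1 + u) = prob (alive q s k) * (1 - 1 / q)"
    using q by simp
  then show ?thesis using u by (simp add: field_simps)
qed

lemma prob_alive:
  assumes q: "1 < q" and s: "0 < s"
  shows "prob (alive q s k) = (1 - (1 - 1 / q) / (1 + s)) ^ k"
proof (induction k)
  case 0
  then show ?case by (simp add: prob_space)
next
  case (Suc k)
  have "prob (alive q s (Suc k)) = prob (alive q s k) - prob (alive q s k \<inter> upcross q s k)"
    using finite_measure_Diff'[OF alive_sets upcross_sets] by simp
  then show ?case using Suc prob_upcross[OF q s] by (simp add: algebra_simps)
qed

lemma stop_time_alive: "\<omega> \<in> alive q s k \<Longrightarrow> stop_time q s k \<omega> = level_time q k \<omega>"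
  by (cases k) (auto simp: stop_time_def)

lemma stop_time_Suc: "stop_time q s (Suc k) \<omega> = (if \<omega> \<in> alive q s k then level_time q (Suc k) \<omega> else stop_time q s k \<omega>)"
  by (simp add: stop_time_def)

lemma stop_level_le: "stop_level q s k \<omega> \<le> k"
  by (induction k) auto

lemma stop_time_le: "stop_time q s k \<omega> \<le> level_time q k \<omega>"
  unfolding stop_time_def by (rule level_time_mono[OF stop_level_le])

lemma stopping_stop_time: "stopping (stop_time q s K)"
proof (induction K)
  case 0
  have "stop_time q s 0 = level_time q 0" by (simp add: stop_time_def fun_eq_iff)
  then show ?case by (simp only: stopping_level_time)
next
  case (Suc k)
  have "stopping (\<lambda>\<omega>. if \<omega> \<in> alive q s k then level_time q (Suc k) \<omega> else stop_time q s k \<omega>)"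
  proof (rule stopping_if[OF Suc stopping_level_time])
    show "stop_time q s k \<omega> \<le> level_time q (Suc k) \<omega>" for \<omega>
      by (rule order_trans[OF stop_time_le level_time_mono]) simp
    show "alive q s k \<subseteq> space M" using sets.sets_into_space[OF alive_sets] .
    fix t :: real assume t: "0 \<le> t"
    have "alive q s k \<inter> {\<omega>\<in>space M. stop_time q s k \<omega> \<le> ennreal t}
      = alive q s k \<inter> {\<omega>\<in>space M. level_time q k \<omega> \<le> ennreal t}"
      using stop_time_alive by auto
    then show "alive q s k \<inter> {\<omega>\<in>space M. stop_time q s k \<omega> \<le> ennreal t} \<in> sets (F t)"
      using alive_prior[OF t] by simp
  qed
  moreover have "stop_time q s (Suc k) = (\<lambda>\<omega>. if \<omega> \<in> alive q s k then level_time q (Suc k) \<omega> else stop_time q s k \<omega>)"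
    by (rule ext) (rule stop_time_Suc)
  ultimately show ?case by simp
qed

lemma stop_time_ge:
  assumes "\<omega> \<in> alive q s j" "j < K"
  shows "level_time q (Suc j) \<omega> \<le> stop_time q s K \<omega>"
  using assms(2)
proof (induction K)
  case (Suc K)
  show ?case
  proof (cases "j = K")
    case True
    then show ?thesis using assms(1) by (simp add: stop_time_Suc)
  next
    case False
    then have "level_time q (Suc j) \<omega> \<le> stop_time q s K \<omega>" using Suc by simp
    also have "\<dots> \<le> stop_time q s (Suc K) \<omega>"
      using order_trans[OF stop_time_le level_time_mono[of K "Suc K" q]] by (simp add: stop_time_Suc)
    finally show ?thesis .
  qed
qed simp

lemma before_level_time:
  assumes q: "1 < q" and v: "0 \<le> v" "ennreal v \<le> level_time q k \<omega>"
  shows "- (q ^ k) \<le> B v \<omega>"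
  using v(2)
proof (induction k)
  case 0
  then have "- 1 \<le> B v \<omega>"
    using before_hit(1)[of "\<lambda>_. 0" \<omega> 0 v "- 1"] v(1) B_0[of \<omega>] by simp
  then show ?case by simp
next
  case (Suc k)
  show ?case
  proof (cases "ennreal v \<le> level_time q k \<omega>")
    case True
    then have "- (q ^ k) \<le> B v \<omega>" by (rule Suc.IH)
    moreover have "q ^ k \<le> q ^ Suc k" using q by simp
    ultimately show ?thesis by linarith
  next
    case False
    then have lt: "level_time q k \<omega> < ennreal v" by simp
    then have "level_time q k \<omega> < top" by (rule less_trans) simp
    then obtain r0 where r0: "level_time q k \<omega> = ennreal r0" "0 \<le> r0" by (rule ennreal_real_cases)
    have "r0 \<le> v" using lt r0 by (simp add: ennreal_less_iff)
    moreover have "- (q ^ Suc k) < B r0 \<omega>" using level_time_value[OF r0(2,1)] q by simp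
    ultimately show ?thesis using before_hit(1)[of "level_time q k" \<omega> r0 v, OF r0] Suc.prems by simp
  qed
qed

text \<open>By continuity the higher mark cannot be reached without passing the lower one, since the
  stage starts below both.\<close>

lemma upcross_antimono:
  assumes q: "1 < q" and u: "0 < u" "u \<le> u'"
  shows "upcross q u' k \<subseteq> upcross q u k"
proof
  fix \<omega> assume "\<omega> \<in> upcross q u' k"
  then have \<omega>: "\<omega> \<in> space M" "hit (level_time q k) (u' * q ^ Suc k) \<omega> < level_time q (Suc k) \<omega>"
    by (auto simp: upcross_def)
  have "hit (level_time q k) (u * q ^ Suc k) \<omega> \<le> hit (level_time q k) (u' * q ^ Suc k) \<omega>"
  proof (rule ccontr)
    assume "\<not> ?thesis"
    then have lt: "hit (level_time q k) (u' * q ^ Suc k) \<omega> < hit (level_time q k) (u * q ^ Suc k) \<omega>" by simp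
    have "hit (level_time q k) (u' * q ^ Suc k) \<omega> < top" using lt by (rule less_le_trans) simp
    then obtain r where r: "hit (level_time q k) (u' * q ^ Suc k) \<omega> = ennreal r" "0 \<le> r" by (rule ennreal_real_cases)
    note Br = at_hit[OF r]
    have "level_time q k \<omega> < top" using Br(2) by (rule le_less_trans) simp
    then obtain r0 where r0: "level_time q k \<omega> = ennreal r0" "0 \<le> r0" by (rule ennreal_real_cases)
    have r0r: "r0 \<le> r" using Br(2) r0 r(2) by simp
    have pos: "0 < u * q ^ Suc k" using u q by simp
    have "B r0 \<omega> = - (q ^ k)" by (rule level_time_value[OF r0(2,1)])
    moreover have "0 < q ^ k" using q by simp
    ultimately have "B r0 \<omega> < u * q ^ Suc k" using pos by linarith
    then have "B r \<omega> \<le> u * q ^ Suc k"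
      using before_hit(2)[of "level_time q k" \<omega> r0 r "u * q ^ Suc k", OF r0 r0r] lt r(1) by simp
    moreover have "B r \<omega> \<noteq> u * q ^ Suc k" using before_hit_not[of "level_time q k" \<omega> r0 r, OF r0 r0r] lt r(1) by simp
    moreover have "u * q ^ Suc k \<le> u' * q ^ Suc k" using u q by (intro mult_right_mono) auto
    ultimately show False using Br(1) by simp
  qed
  then show "\<omega> \<in> upcross q u k" using \<omega> by (auto simp: upcross_def)
qed

section \<open>Stopped paths and their maximal process\<close>

lemma stopped_cadlag: "right_cont_left_lims (\<lambda>t. stopped_process B \<eta> t \<omega>)"
  and stopped_jump: "0 \<le> t \<Longrightarrow> jump (\<lambda>t. stopped_process B \<eta> t \<omega>) t = 0"
proof -
  define X where "X t = stopped_process B \<eta> t \<omega>" for t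
  have cont: "continuous_on {0..} X"
  proof (cases "\<eta> \<omega>")
    case (real r)
    have "X t = B (min r t) \<omega>" if "t \<in> {0..}" for t
      using real that by (simp add: X_def stopped_process_def min_def)
    moreover have "continuous_on {0..} (\<lambda>t. B (min r t) \<omega>)"
      by (rule continuous_on_compose2[OF B_continuous]) (use real in \<open>auto intro!: continuous_intros\<close>)
    moreover have "continuous_on {0..} X \<longleftrightarrow> continuous_on {0..} (\<lambda>t. B (min r t) \<omega>)"
      by (rule continuous_on_cong[OF refl]) (rule calculation(1))
    ultimately show ?thesis by blast
  next
    case top
    have "X t = B t \<omega>" if "t \<in> {0..}" for t
      using top that by (simp add: X_def stopped_process_def)
    then have "continuous_on {0..} X \<longleftrightarrow> continuous_on {0..} (\<lambda>t. B t \<omega>)"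
      by (intro continuous_on_cong refl)
    then show ?thesis using B_continuous[of \<omega>] by blast
  qed
  have lim: "(X \<longlongrightarrow> X t) (at t within {0..})" if "0 \<le> t" for t
    using cont that by (simp add: continuous_on_def)
  have right: "(X \<longlongrightarrow> X t) (at_right t)" if "0 \<le> t" for t
    using lim[OF that] by (rule tendsto_within_subset) (use that in auto)
  have left: "(X \<longlongrightarrow> X t) (at_left t)" if "0 < t" for t
  proof -
    have "at t within {0..} = at t" using that by (intro at_within_interior) (simp add: interior_real_atLeast)
    then have "(X \<longlongrightarrow> X t) (at t)" using lim[of t] that by simp
    then show ?thesis by (rule tendsto_within_subset) simp
  qed
  show "right_cont_left_lims (\<lambda>t. stopped_process B \<eta> t \<omega>)"
    unfolding right_cont_left_lims_def X_def[symmetric] using right left by auto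
  show "jump (\<lambda>t. stopped_process B \<eta> t \<omega>) t = 0" if "0 \<le> t"
  proof (cases "t = 0")
    case True
    then show ?thesis by (simp add: jump_def stopped_process_def B_0)
  next
    case False
    then have "Lim (at_left t) X = X t" using left that by (intro tendsto_Lim) auto
    then show ?thesis using False unfolding jump_def X_def by simp
  qed
qed

lemma stopped_admissible:
  assumes "stopping \<eta>"
  shows "admissible_process M F (stopped_process B \<eta>)"
  unfolding admissible_process_def
  using filtered_natural_filtration[OF prob_space_axioms complete B_measurable] stopped_supermartingale[OF assms]
    stopped_cadlag stopped_jump by (auto simp: stopped_process_def B_0)

lemma inf_process_stopped:
  assumes q: "1 < q" and t: "0 \<le> t"
  shows "\<bar>inf_process (stopped_process B (stop_time q s K)) t \<omega>\<bar> \<le> q ^ stop_level q s K \<omega>"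
proof -
  have "- (q ^ stop_level q s K \<omega>) \<le> stopped_process B (stop_time q s K) r \<omega>" if "r \<in> {0..t}" for r
  proof -
    define v where "v = enn2real (min (stop_time q s K \<omega>) (ennreal r))"
    have "min (stop_time q s K \<omega>) (ennreal r) < top" by (rule le_less_trans[OF min.cobounded2]) simp
    then have v: "ennreal v = min (stop_time q s K \<omega>) (ennreal r)" "0 \<le> v" by (simp_all add: v_def)
    have "ennreal v \<le> level_time q (stop_level q s K \<omega>) \<omega>" unfolding v(1) stop_time_def by simp
    then have "- (q ^ stop_level q s K \<omega>) \<le> B v \<omega>" by (rule before_level_time[OF q v(2)])
    then show ?thesis by (simp add: stopped_process_def v_def)
  qed
  then have "- (q ^ stop_level q s K \<omega>) \<le> (INF r\<in>{0..t}. stopped_process B (stop_time q s K) r \<omega>)"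
    using t by (intro cINF_greatest) auto
  moreover have "0 \<le> q ^ stop_level q s K \<omega>" using q by simp
  ultimately show ?thesis unfolding inf_process_def by simp
qed

lemma max_process_stopped_mono:
  assumes "0 \<le> t" "t \<le> t'"
  shows "max_process (stopped_process B \<eta>) t \<omega> \<le> max_process (stopped_process B \<eta>) t' \<omega>"
  unfolding max_process_def
  using assms by (intro cSUP_subset_mono cadlag_bdd(3)[OF stopped_cadlag]) auto

lemma max_process_stopped_const:
  assumes v: "\<eta> \<omega> = ennreal v" "0 \<le> v" "v \<le> N" and N: "N \<le> n"
  shows "max_process (stopped_process B \<eta>) n \<omega> = max_process (stopped_process B \<eta>) N \<omega>"
proof (rule antisym)
  have N0: "0 \<le> N" using v by simp
  show "max_process (stopped_process B \<eta>) n \<omega> \<le> max_process (stopped_process B \<eta>) N \<omega>"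
    unfolding max_process_def[of _ n]
  proof (rule cSUP_least)
    fix r assume r: "r \<in> {0..n}"
    have "stopped_process B \<eta> r \<omega> = stopped_process B \<eta> (min r N) \<omega>"
    proof (cases "r \<le> N")
      case False
      then have "stopped_process B \<eta> r \<omega> = B v \<omega>" "stopped_process B \<eta> N \<omega> = B v \<omega>"
        using v by (auto intro!: stopped_process_at[where \<eta>=\<eta> and \<omega>=\<omega> and B=B, OF v(1,2)])
      then show ?thesis using False by simp
    qed simp
    moreover have "\<bar>stopped_process B \<eta> (min r N) \<omega>\<bar> \<le> max_process (stopped_process B \<eta>) N \<omega>"
      using r N0 by (intro process_bounds(3) stopped_cadlag) auto
    ultimately show "\<bar>stopped_process B \<eta> r \<omega>\<bar> \<le> max_process (stopped_process B \<eta>) N \<omega>" by simp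
  qed (use N N0 in auto)
  show "max_process (stopped_process B \<eta>) N \<omega> \<le> max_process (stopped_process B \<eta>) n \<omega>"
    using N0 N by (rule max_process_stopped_mono)
qed

text \<open>The supremum is taken in \<open>ennreal\<close> over integer horizons, so it exists on
  every path and is measurable. \<open>enn2real\<close> sends \<open>top\<close> to
  \<open>0\<close>, but where \<open>\<eta>\<close> is finite the sequence of maxima becomes
  constant and the value is the true maximum.\<close>

definition final_max :: "('a \<Rightarrow> ennreal) \<Rightarrow> 'a \<Rightarrow> real" where
  "final_max \<eta> \<omega> = enn2real (SUP n. ennreal (max_process (stopped_process B \<eta>) (real n) \<omega>))"

lemma max_process_stopped_measurable:
  assumes "stopping \<eta>" "0 \<le> t"
  shows "max_process (stopped_process B \<eta>) t \<in> borel_measurable M"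
proof (rule max_inf_process_measurable(1)[OF _ stopped_cadlag assms(2)])
  show "stopped_process B \<eta> r \<in> borel_measurable M" if "0 \<le> r" for r
    by (rule F_measurable[OF stopped_process_measurable[OF assms(1) that]])
qed

lemma final_max_measurable:
  assumes "stopping \<eta>"
  shows "final_max \<eta> \<in> borel_measurable M"
proof -
  have [measurable]: "max_process (stopped_process B \<eta>) (real n) \<in> borel_measurable M" for n
    by (rule max_process_stopped_measurable[OF assms]) simp
  show ?thesis unfolding final_max_def[abs_def] by measurable
qed

lemma final_max_eq:
  assumes v: "\<eta> \<omega> = ennreal v" "0 \<le> v" "v \<le> real N"
  shows "final_max \<eta> \<omega> = max_process (stopped_process B \<eta>) (real N) \<omega>"
proof -
  let ?m = "\<lambda>n. max_process (stopped_process B \<eta>) (real n) \<omega>"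
  have le: "?m n \<le> ?m N" for n
  proof (cases "n \<le> N")
    case True
    then show ?thesis by (intro max_process_stopped_mono) auto
  next
    case False
    then show ?thesis
      using max_process_stopped_const[where \<eta>=\<eta> and \<omega>=\<omega>, OF v, of "real n"] by simp
  qed
  have "(SUP n. ennreal (?m n)) = ennreal (?m N)"
    by (rule antisym) (auto intro!: SUP_least SUP_upper ennreal_leI le)
  moreover have "0 \<le> ?m N" by (rule process_bounds(4)[of _ _ 0, OF stopped_cadlag]) simp
  ultimately show ?thesis by (simp add: final_max_def)
qed

lemma final_max_ge:
  assumes fin: "\<eta> \<omega> < top" and r: "0 \<le> r" "ennreal r \<le> \<eta> \<omega>"
  shows "\<bar>B r \<omega>\<bar> \<le> final_max \<eta> \<omega>"
proof -
  obtain v where v: "\<eta> \<omega> = ennreal v" "0 \<le> v" using fin by (rule ennreal_real_cases)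
  define N where "N = nat \<lceil>v\<rceil>"
  have vN: "v \<le> real N" unfolding N_def by linarith
  have rv: "r \<le> v" using r v by simp
  have "B r \<omega> = stopped_process B \<eta> r \<omega>"
    by (rule stopped_process_before[where \<eta>=\<eta> and \<omega>=\<omega> and B=B, OF r(2,1), symmetric])
  then have "\<bar>B r \<omega>\<bar> \<le> max_process (stopped_process B \<eta>) (real N) \<omega>"
    using process_bounds(3)[of "stopped_process B \<eta>" \<omega> r "real N", OF stopped_cadlag] r rv vN by simp
  then show ?thesis using final_max_eq[where \<eta>=\<eta> and \<omega>=\<omega>, OF v vN] by simp
qed

text \<open>\<open>process_norm\<close> looks at fixed horizons, whereas the law of the maximum is
  known at the random time \<open>\<eta>\<close>; monotone convergence links the two.\<close>

lemma final_max_moment_le: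
  assumes \<eta>: "stopping \<eta>" and fin: "AE \<omega> in M. \<eta> \<omega> < top" and p: "0 < p"
  shows "(\<integral>\<^sup>+\<omega>. ennreal (final_max \<eta> \<omega> powr p) \<partial>M)
    \<le> (SUP n. \<integral>\<^sup>+\<omega>. ennreal (\<bar>max_process (stopped_process B \<eta>) (real n) \<omega>\<bar> powr p) \<partial>M)"
proof -
  let ?m = "\<lambda>n \<omega>. max_process (stopped_process B \<eta>) (real n) \<omega>"
  have [measurable]: "?m n \<in> borel_measurable M" for n
    using max_process_stopped_measurable[OF \<eta>, of "real n"] by simp
  have m0: "0 \<le> ?m n \<omega>" for n \<omega> by (rule process_bounds(4)[of _ _ 0, OF stopped_cadlag]) simp
  have "(\<integral>\<^sup>+\<omega>. ennreal (final_max \<eta> \<omega> powr p) \<partial>M) \<le> (\<integral>\<^sup>+\<omega>. (SUP n. ennreal (\<bar>?m n \<omega>\<bar> powr p)) \<partial>M)"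
  proof (rule nn_integral_mono_AE)
    show "AE \<omega> in M. ennreal (final_max \<eta> \<omega> powr p) \<le> (SUP n. ennreal (\<bar>?m n \<omega>\<bar> powr p))"
      using fin
    proof eventually_elim
      case (elim \<omega>)
      obtain v where v: "\<eta> \<omega> = ennreal v" "0 \<le> v" using elim by (rule ennreal_real_cases)
      have "v \<le> real (nat \<lceil>v\<rceil>)" by linarith
      from final_max_eq[where \<eta>=\<eta> and \<omega>=\<omega>, OF v this]
      have "ennreal (final_max \<eta> \<omega> powr p) = ennreal (\<bar>?m (nat \<lceil>v\<rceil>) \<omega>\<bar> powr p)" using m0 by simp
      also have "\<dots> \<le> (SUP n. ennreal (\<bar>?m n \<omega>\<bar> powr p))" by (rule SUP_upper) simp
      finally show ?case .
    qed
  qed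
  also have "\<dots> = (SUP n. \<integral>\<^sup>+\<omega>. ennreal (\<bar>?m n \<omega>\<bar> powr p) \<partial>M)"
  proof (rule nn_integral_monotone_convergence_SUP)
    show "incseq (\<lambda>n \<omega>. ennreal (\<bar>?m n \<omega>\<bar> powr p))"
    proof (intro incseq_SucI le_funI ennreal_leI)
      fix n \<omega>
      have "?m n \<omega> \<le> ?m (Suc n) \<omega>" by (intro max_process_stopped_mono) auto
      then show "\<bar>?m n \<omega>\<bar> powr p \<le> \<bar>?m (Suc n) \<omega>\<bar> powr p"
        using m0 p by (intro powr_mono2) auto
    qed
  qed measurable
  finally show ?thesis .
qed

section \<open>Moments of infimum and maximum under the stopping rule\<close>

lemma alive_partition:
  "\<omega> \<in> space M \<Longrightarrow> (\<Sum>j<K. indicator (alive q s j \<inter> upcross q s j) \<omega>) + indicator (alive q s K) \<omega> = (1::ennreal)"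
proof (induction K)
  case (Suc K)
  have "indicator (alive q s K \<inter> upcross q s K) \<omega> + indicator (alive q s (Suc K)) \<omega> = (indicator (alive q s K) \<omega> :: ennreal)"
    by (auto simp: indicator_def)
  then show ?case using Suc by (simp add: add.assoc del: alive.simps)
qed simp

lemma stop_level_partition:
  assumes "\<omega> \<in> space M"
  shows "ennreal ((q ^ stop_level q s K \<omega>) powr p)
    = (\<Sum>j<K. ennreal ((q ^ Suc j) powr p) * indicator (alive q s j \<inter> upcross q s j) \<omega>)
      + ennreal ((q ^ K) powr p) * indicator (alive q s K) \<omega>"
proof (induction K)
  case 0
  then show ?case using assms by simp
next
  case (Suc K)
  show ?case
  proof (cases "\<omega> \<in> alive q s K")
    case True
    have "indicator (alive q s j \<inter> upcross q s j) \<omega> = (0::ennreal)" if "j < K" for j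
      using alive_partition[where K=K and q=q and s=s, OF assms] True that by (auto simp: sum_eq_0_iff)
    then have "(\<Sum>j<K. ennreal ((q ^ Suc j) powr p) * indicator (alive q s j \<inter> upcross q s j) \<omega>) = 0" by simp
    then show ?thesis using True by (cases "\<omega> \<in> upcross q s K") auto
  next
    case False
    then show ?thesis using Suc by simp
  qed
qed

text \<open>The stopping level is \<open>Suc j\<close> if the first upcrossing occurs in stage
  \<open>j\<close>, which has probability \<open>(1 - h) ^ j * h\<close>, and \<open>K\<close> if
  all \<open>K\<close> stages pass without one. The last term is the cost of truncation.\<close>

lemma inf_process_moment_le:
  fixes q s p t :: real
  assumes q: "1 < q" and s: "0 < s" and p: "0 < p" and t: "0 \<le> t"
  defines "h \<equiv> (1 - 1 / q) / (1 + s)"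
  shows "(\<integral>\<^sup>+\<omega>. ennreal (\<bar>inf_process (stopped_process B (stop_time q s K)) t \<omega>\<bar> powr p) \<partial>M)
    \<le> ennreal ((\<Sum>j<K. (1 - h) ^ j * h * (q ^ Suc j) powr p) + (1 - h) ^ K * (q ^ K) powr p)"
proof -
  note [measurable] = alive_sets upcross_sets
  have "0 < 1 / q" using q by (simp only: zero_less_divide_1_iff)
  then have "1 - 1 / q \<le> 1 * (1 + s)" using s by argo
  then have "h \<le> 1" unfolding h_def using s by (subst pos_divide_le_eq) auto
  moreover have "0 \<le> h" unfolding h_def using q s by (intro divide_nonneg_nonneg) auto
  ultimately have h1: "0 \<le> h" "h \<le> 1" by auto
  have P: "prob (alive q s j) = (1 - h) ^ j" for j using prob_alive[OF q s] by (simp add: h_def)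
  have PU: "prob (alive q s j \<inter> upcross q s j) = (1 - h) ^ j * h" for j
    using prob_upcross[OF q s, of s j] P[of j] by (simp add: h_def)
  have "(\<integral>\<^sup>+\<omega>. ennreal (\<bar>inf_process (stopped_process B (stop_time q s K)) t \<omega>\<bar> powr p) \<partial>M)
    \<le> (\<integral>\<^sup>+\<omega>. ennreal ((q ^ stop_level q s K \<omega>) powr p) \<partial>M)"
    using inf_process_stopped[OF q t] p by (intro nn_integral_mono ennreal_leI powr_mono2) auto
  also have "\<dots> = (\<integral>\<^sup>+\<omega>. (\<Sum>j<K. ennreal ((q ^ Suc j) powr p) * indicator (alive q s j \<inter> upcross q s j) \<omega>)
      + ennreal ((q ^ K) powr p) * indicator (alive q s K) \<omega> \<partial>M)"
    by (intro nn_integral_cong stop_level_partition)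
  also have "\<dots> = (\<Sum>j<K. ennreal ((q ^ Suc j) powr p) * emeasure M (alive q s j \<inter> upcross q s j))
      + ennreal ((q ^ K) powr p) * emeasure M (alive q s K)"
    by (subst nn_integral_add, measurable, subst nn_integral_sum, measurable)
       (simp add: nn_integral_cmult_indicator del: power_Suc)
  also have "\<dots> = (\<Sum>j<K. ennreal ((1 - h) ^ j * h * (q ^ Suc j) powr p)) + ennreal ((1 - h) ^ K * (q ^ K) powr p)"
    unfolding emeasure_eq_measure P PU using h1
    by (simp add: ennreal_mult'[symmetric] ennreal_mult''[symmetric] mult_ac del: power_Suc)
  also have "\<dots> = ennreal ((\<Sum>j<K. (1 - h) ^ j * h * (q ^ Suc j) powr p) + (1 - h) ^ K * (q ^ K) powr p)"
    using h1 by (simp add: sum_nonneg del: power_Suc)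
  finally show ?thesis .
qed

text \<open>Given a first upcrossing in stage \<open>j\<close>, the maximum is at least
  \<open>k * Q\<close> with \<open>Q = q ^ Suc j\<close> and \<open>k = opt_ratio p\<close>. The
  probability of exceeding higher marks is bounded from below by gambler's ruin, and the layer-cake
  formula from \<open>k * Q\<close> upwards reproduces the factor of the upper bound.\<close>

lemma final_max_moment_piece:
  assumes q: "1 < q" and p: "0 < p" "p < 1" and j: "j < K"
  defines "s \<equiv> 1 / p - 1" and "h \<equiv> p * (1 - 1 / q)"
  shows "ennreal (moment_const p * ((1 - h) ^ j * h * (q ^ Suc j) powr p))
    \<le> (\<integral>\<^sup>+\<omega>. indicator (alive q s j \<inter> upcross q s j) \<omega> * ennreal (final_max (stop_time q s K) \<omega> powr p) \<partial>M)"
proof -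
  interpret P: pair_sigma_finite M lborel by unfold_locales
  note [measurable] = alive_sets upcross_sets
  define k where "k = opt_ratio p"
  define Q where "Q = q ^ Suc j"
  define A where "A = alive q s j \<inter> upcross q s j"
  define w where "w = final_max (stop_time q s K)"
  have s0: "0 < s" using p by (simp add: s_def field_simps)
  have k: "1 \<le> k" "s \<le> k" "k = 1 \<or> k = s" by (auto simp: k_def opt_ratio_def s_def)
  have Q: "0 < Q" using q by (simp add: Q_def)
  have sp: "1 / (1 + s) = p" using p by (simp add: s_def)
  have x: "0 \<le> 1 - 1 / q" using q by simp
  have h_eq: "(1 - 1 / q) / (1 + s) = h" using sp by (simp add: h_def divide_inverse)
  have Pj: "prob (alive q s j) = (1 - h) ^ j" using prob_alive[OF q s0] h_eq by simp
  have PA: "prob A = (1 - h) ^ j * h" unfolding A_def prob_upcross[OF q s0] Pj h_eq ..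
  have h1: "0 \<le> (1 - h) ^ j" using Pj measure_nonneg[of M "alive q s j"] by simp
  have h0: "0 \<le> h" using x p by (simp add: h_def)
  have [measurable]: "w \<in> borel_measurable M"
    unfolding w_def by (rule final_max_measurable[OF stopping_stop_time])
  have [measurable]: "A \<in> sets M" unfolding A_def by measurable
  have fin: "AE \<omega> in M. level_time q K \<omega> < top" by (rule level_time_finite[OF q])
  have w_u: "u * Q \<le> w \<omega>" if "level_time q K \<omega> < top" "\<omega> \<in> alive q s j" "\<omega> \<in> upcross q u j" for \<omega> u
  proof -
    have st: "level_time q (Suc j) \<omega> \<le> stop_time q s K \<omega>" using that(2) j by (rule stop_time_ge)
    have finst: "stop_time q s K \<omega> < top" using stop_time_le that(1) by (rule le_less_trans)
    have lt: "hit (level_time q j) (u * Q) \<omega> < level_time q (Suc j) \<omega>" using that(3) by (simp add: upcross_def Q_def)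
    have "hit (level_time q j) (u * Q) \<omega> < top" using lt by (rule less_le_trans) simp
    then obtain r where r: "hit (level_time q j) (u * Q) \<omega> = ennreal r" "0 \<le> r" by (rule ennreal_real_cases)
    have "ennreal r \<le> stop_time q s K \<omega>" using lt st unfolding r(1) by simp
    from final_max_ge[where \<eta>="stop_time q s K" and \<omega>=\<omega>, OF finst r(2) this]
    show ?thesis using at_hit(1)[OF r] by (simp add: w_def)
  qed
  have w_Q: "Q \<le> w \<omega>" if "level_time q K \<omega> < top" "\<omega> \<in> alive q s j" for \<omega>
  proof -
    have st: "level_time q (Suc j) \<omega> \<le> stop_time q s K \<omega>" using that(2) j by (rule stop_time_ge)
    have finst: "stop_time q s K \<omega> < top" using stop_time_le that(1) by (rule le_less_trans)
    have "level_time q (Suc j) \<omega> < top" using st finst by (rule le_less_trans)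
    then obtain r where r: "level_time q (Suc j) \<omega> = ennreal r" "0 \<le> r" by (rule ennreal_real_cases)
    have "ennreal r \<le> stop_time q s K \<omega>" using st unfolding r(1) .
    from final_max_ge[where \<eta>="stop_time q s K" and \<omega>=\<omega>, OF finst r(2) this]
    show ?thesis using level_time_value[OF r(2,1)] Q by (simp add: w_def Q_def)
  qed
  \<comment> \<open>Two sources of a large maximum on \<open>A\<close>: the upcrossing gives
    \<open>s * Q\<close>, and the next level, where \<open>\<bar>B\<bar> = Q\<close>, gives
    \<open>Q\<close>. The larger one is \<open>k * Q\<close>, which mirrors the restriction
    \<open>k \<ge> 1\<close> of the upper bound.\<close>
  have w_k: "k * Q \<le> w \<omega>" if "level_time q K \<omega> < top" "\<omega> \<in> A" for \<omega>
    using k(3) w_u[OF that(1), of s] w_Q[OF that(1)] that(2) by (auto simp: A_def)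
  define y where "y = k * Q"
  have y0: "0 < y" using k Q by (simp add: y_def)
  \<comment> \<open>\<open>a / (1 + u)\<close> is the probability of surviving to stage
    \<open>j\<close> and rising to \<open>u * Q\<close> there. For \<open>u = s\<close> it equals
    \<open>p * a\<close>, by the choice of \<open>s\<close>. Hence the boundary term of the layer
    cake and its integral carry the same factor \<open>p * a * Q powr p\<close>, and together they
    give \<open>moment_const p\<close>.\<close>
  define a where "a = (1 - h) ^ j * (1 - 1 / q)"
  have a0: "0 \<le> a" using h1 x by (simp add: a_def)
  define I where "I \<omega> s' = (if y \<le> s' \<and> s' \<le> w \<omega> then 1 else 0 :: ennreal)" for \<omega> s'
  have "(\<integral>\<^sup>+\<omega>. indicator A \<omega> * ennreal (w \<omega> powr p) \<partial>M)
    = (\<integral>\<^sup>+\<omega>. indicator A \<omega> * ennreal (y powr p)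
        + (\<integral>\<^sup>+ s'. indicator A \<omega> * (ennreal (p * s' powr (p - 1)) * I \<omega> s') \<partial>lborel) \<partial>M)"
  proof (rule nn_integral_cong_AE)
    show "AE \<omega> in M. indicator A \<omega> * ennreal (w \<omega> powr p) = indicator A \<omega> * ennreal (y powr p)
        + (\<integral>\<^sup>+ s'. indicator A \<omega> * (ennreal (p * s' powr (p - 1)) * I \<omega> s') \<partial>lborel)"
      using fin
    proof eventually_elim
      case (elim \<omega>)
      show ?case
      proof (cases "\<omega> \<in> A")
        case True
        have "y \<le> w \<omega>" unfolding y_def by (rule w_k[OF elim True])
        from nn_integral_powr_layer_closed[OF p(1) less_imp_le[OF y0] this]
        show ?thesis using True by (simp add: I_def)
      qed simp
    qed
  qed
  also have "\<dots> = (\<integral>\<^sup>+\<omega>. indicator A \<omega> * ennreal (y powr p) \<partial>M)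
      + (\<integral>\<^sup>+\<omega>. (\<integral>\<^sup>+ s'. indicator A \<omega> * (ennreal (p * s' powr (p - 1)) * I \<omega> s') \<partial>lborel) \<partial>M)"
    unfolding I_def by (rule nn_integral_add) measurable
  also have "(\<integral>\<^sup>+\<omega>. (\<integral>\<^sup>+ s'. indicator A \<omega> * (ennreal (p * s' powr (p - 1)) * I \<omega> s') \<partial>lborel) \<partial>M)
      = (\<integral>\<^sup>+ s'. (\<integral>\<^sup>+\<omega>. indicator A \<omega> * (ennreal (p * s' powr (p - 1)) * I \<omega> s') \<partial>M) \<partial>lborel)"
    unfolding I_def by (rule P.Fubini'[symmetric]) measurable
  finally have split: "(\<integral>\<^sup>+\<omega>. indicator A \<omega> * ennreal (w \<omega> powr p) \<partial>M)
    = (\<integral>\<^sup>+\<omega>. indicator A \<omega> * ennreal (y powr p) \<partial>M)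
      + (\<integral>\<^sup>+ s'. (\<integral>\<^sup>+\<omega>. indicator A \<omega> * (ennreal (p * s' powr (p - 1)) * I \<omega> s') \<partial>M) \<partial>lborel)" .
  have first: "(\<integral>\<^sup>+\<omega>. indicator A \<omega> * ennreal (y powr p) \<partial>M) = ennreal (p * a * Q powr p * k powr p)"
  proof -
    have "(\<integral>\<^sup>+\<omega>. indicator A \<omega> * ennreal (y powr p) \<partial>M) = emeasure M A * ennreal (y powr p)"
      by (subst nn_integral_multc) auto
    also have "\<dots> = ennreal ((1 - h) ^ j * h * (y powr p))"
      unfolding emeasure_eq_measure PA using h1 h0 by (simp add: ennreal_mult)
    also have "(1 - h) ^ j * h * (y powr p) = p * a * Q powr p * k powr p"
      by (simp add: y_def powr_mult a_def h_def mult_ac)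
    finally show ?thesis .
  qed
  define g where "g s' = ennreal (p * s' powr (p - 1)) * ennreal (a / (1 + s' / Q)) * indicator {y..} s'" for s'
  have gm: "g \<in> borel_measurable borel" unfolding g_def[abs_def] by measurable
  have second: "(\<integral>\<^sup>+ s'. g s' \<partial>lborel) = ennreal (p * a * Q powr p * tail_integral p k)"
  proof -
    have "(\<integral>\<^sup>+ s'. g s' \<partial>lborel) = ennreal \<bar>Q\<bar> * (\<integral>\<^sup>+ u. g (0 + Q * u) \<partial>lborel)"
      using Q gm by (intro nn_integral_real_affine) auto
    also have "\<dots> = (\<integral>\<^sup>+ u. ennreal Q * g (Q * u) \<partial>lborel)"
      using Q gm by (subst nn_integral_cmult) auto
    also have "\<dots> = (\<integral>\<^sup>+ u. ennreal (p * a * Q powr p) * (ennreal (u powr (p - 1) / (u + 1)) * indicator {k..} u) \<partial>lborel)"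
    proof (rule nn_integral_cong)
      fix u :: real
      show "ennreal Q * g (Q * u) = ennreal (p * a * Q powr p) * (ennreal (u powr (p - 1) / (u + 1)) * indicator {k..} u)"
      proof (cases "k \<le> u")
        case True
        have u: "0 < u" using True k by simp
        have yu: "y \<le> Q * u" using True Q by (simp add: y_def mult.commute[of k])
        have "ennreal Q * g (Q * u) = ennreal (Q * (p * (Q * u) powr (p - 1) * (a / (1 + u))))"
          unfolding g_def using yu Q p a0 u by (simp add: ennreal_mult[symmetric])
        also have "Q * (p * (Q * u) powr (p - 1) * (a / (1 + u))) = p * a * (Q * Q powr (p - 1)) * (u powr (p - 1) / (u + 1))"
          by (simp add: powr_mult mult_ac add.commute)
        also have "Q * Q powr (p - 1) = Q powr p" using Q by (simp add: powr_mult_base)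
        finally show ?thesis using True u p a0 by (simp add: ennreal_mult[symmetric])
      next
        case False
        then have "\<not> y \<le> Q * u" using Q by (simp add: y_def mult.commute[of k])
        then show ?thesis using False by (simp add: g_def)
      qed
    qed
    also have "\<dots> = ennreal (p * a * Q powr p) * ennreal (tail_integral p k)"
      using p k by (subst nn_integral_cmult) (auto simp: tail_integral(1))
    also have "\<dots> = ennreal (p * a * Q powr p * tail_integral p k)"
      using p a0 tail_integral(2)[of p k] k by (simp add: ennreal_mult)
    finally show ?thesis .
  qed
  have "(\<integral>\<^sup>+ s'. g s' \<partial>lborel) \<le> (\<integral>\<^sup>+ s'. (\<integral>\<^sup>+\<omega>. indicator A \<omega> * (ennreal (p * s' powr (p - 1)) * I \<omega> s') \<partial>M) \<partial>lborel)"
  proof (rule nn_integral_mono)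
    fix s' :: real
    show "g s' \<le> (\<integral>\<^sup>+\<omega>. indicator A \<omega> * (ennreal (p * s' powr (p - 1)) * I \<omega> s') \<partial>M)"
    proof (cases "y \<le> s'")
      case False
      then show ?thesis by (simp add: g_def)
    next
      case True
      \<comment> \<open>Above \<open>y = k * Q\<close> the relative height \<open>u\<close> is at
        least \<open>k \<ge> s\<close>, so rising to \<open>u * Q\<close> includes the upcrossing
        that defines \<open>A\<close>.\<close>
      define u where "u = s' / Q"
      have ku: "k \<le> u" using True Q by (simp add: u_def y_def pos_le_divide_eq)
      have u: "0 < u" "s \<le> u" using ku k by auto
      have uQ: "u * Q = s'" using Q by (simp add: u_def)
      have "ennreal (a / (1 + s' / Q)) = emeasure M (alive q s j \<inter> upcross q u j)"
        unfolding emeasure_eq_measure prob_upcross[OF q u(1)] Pj by (simp add: a_def u_def)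
      also have "\<dots> = (\<integral>\<^sup>+\<omega>. indicator (alive q s j \<inter> upcross q u j) \<omega> \<partial>M)" by simp
      also have "\<dots> \<le> (\<integral>\<^sup>+\<omega>. indicator A \<omega> * I \<omega> s' \<partial>M)"
      proof (rule nn_integral_mono_AE)
        show "AE \<omega> in M. indicator (alive q s j \<inter> upcross q u j) \<omega> \<le> indicator A \<omega> * I \<omega> s'"
          using fin
        proof eventually_elim
          case (elim \<omega>)
          show ?case
          proof (cases "\<omega> \<in> alive q s j \<inter> upcross q u j")
            case in_u: True
            then have "\<omega> \<in> A" using upcross_antimono[OF q s0 u(2), of j] by (auto simp: A_def)
            moreover have "s' \<le> w \<omega>" using w_u[OF elim, of u] in_u uQ by auto
            ultimately show ?thesis using True by (simp add: I_def indicator_def)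
          qed simp
        qed
      qed
      finally have le: "ennreal (a / (1 + s' / Q)) \<le> (\<integral>\<^sup>+\<omega>. indicator A \<omega> * I \<omega> s' \<partial>M)" .
      have "g s' = ennreal (p * s' powr (p - 1)) * ennreal (a / (1 + s' / Q))" using True by (simp add: g_def)
      also have "\<dots> \<le> ennreal (p * s' powr (p - 1)) * (\<integral>\<^sup>+\<omega>. indicator A \<omega> * I \<omega> s' \<partial>M)"
        by (intro mult_left_mono le) simp
      also have "\<dots> = (\<integral>\<^sup>+\<omega>. ennreal (p * s' powr (p - 1)) * (indicator A \<omega> * I \<omega> s') \<partial>M)"
        unfolding I_def by (rule nn_integral_cmult[symmetric]) measurable
      also have "\<dots> = (\<integral>\<^sup>+\<omega>. indicator A \<omega> * (ennreal (p * s' powr (p - 1)) * I \<omega> s') \<partial>M)"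
        by (simp only: mult.left_commute)
      finally show ?thesis .
    qed
  qed
  then have "ennreal (p * a * Q powr p * k powr p) + ennreal (p * a * Q powr p * tail_integral p k)
    \<le> (\<integral>\<^sup>+\<omega>. indicator A \<omega> * ennreal (w \<omega> powr p) \<partial>M)"
    unfolding split first second by (intro add_left_mono)
  moreover have "ennreal (p * a * Q powr p * k powr p) + ennreal (p * a * Q powr p * tail_integral p k)
    = ennreal (p * a * Q powr p * k powr p + p * a * Q powr p * tail_integral p k)"
    using p a0 tail_integral(2)[of p k] k by (intro ennreal_plus[symmetric]) auto
  moreover have "p * a * Q powr p * k powr p + p * a * Q powr p * tail_integral p k
    = moment_const p * ((1 - h) ^ j * h * Q powr p)"
  proof -
    have "p * (X * v) * Q powr p * k powr p + p * (X * v) * Q powr p * tail_integral p k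
      = (k powr p + tail_integral p k) * (X * (p * v) * Q powr p)" for X v
      by (simp add: algebra_simps)
    then show ?thesis by (simp only: moment_const_def k_def[symmetric] a_def h_def)
  qed
  ultimately show ?thesis by (simp only: A_def w_def Q_def)
qed

text \<open>In \<open>p\<close>-th moments the maximum reaches at least \<open>C * S\<close> and the
  infimum at most \<open>S + R\<close>, where the truncation error \<open>R\<close> is at most
  \<open>\<epsilon> * S\<close>. The ratio is thus at least \<open>C / (1 + \<epsilon>)\<close>,
  which exceeds \<open>a\<close>, the \<open>p\<close>-th power of the proposed constant.\<close>

lemma stopped_ratio:
  assumes p: "0 < p" "p < 1" and c: "c < ennreal (best_const p)"
  shows "\<exists>\<eta>. stopping \<eta> \<and> \<not> process_norm M p (max_process (stopped_process B \<eta>))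
    \<le> c * process_norm M p (inf_process (stopped_process B \<eta>))"
proof -
  define C where "C = moment_const p"
  have C1: "1 \<le> C" using moment_const_ge_1[OF p] by (simp add: C_def)
  have "c < top" using c by (rule less_le_trans) simp
  then obtain c0 where c0: "c = ennreal c0" "0 \<le> c0" by (rule ennreal_real_cases)
  define a where "a = c0 powr p"
  have a0: "0 \<le> a" by (simp add: a_def)
  have aC: "a < C"
  proof -
    have "c0 < C powr (1 / p)" using c c0 by (simp add: best_const_eq[OF p] C_def ennreal_less_iff)
    then have "c0 powr p < (C powr (1 / p)) powr p" using c0 p by (intro powr_less_mono2) auto
    then show ?thesis using C1 p by (simp add: a_def powr_powr)
  qed
  \<comment> \<open>Chosen so that \<open>a * \<epsilon> < C - a\<close>; the denominator
    \<open>a + 1\<close> is positive even for \<open>a = 0\<close>.\<close>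
  define \<epsilon> where "\<epsilon> = (C - a) / (a + 1)"
  have \<epsilon>: "0 < \<epsilon>" using aC a0 by (simp add: \<epsilon>_def)
  have "a * \<epsilon> < (a + 1) * \<epsilon>" using \<epsilon> by simp
  also have "(a + 1) * \<epsilon> = C - a" using a0 by (simp add: \<epsilon>_def)
  finally have a\<epsilon>: "a * (1 + \<epsilon>) < C" by (simp add: algebra_simps)
  obtain q K where q: "1 < q" "0 < K" and small: "(1 - p * (1 - 1 / q)) ^ K * (q ^ K) powr p
      \<le> \<epsilon> * (\<Sum>j<K. (1 - p * (1 - 1 / q)) ^ j * (p * (1 - 1 / q)) * (q ^ Suc j) powr p)"
    using geometric_remainder_small[OF p \<epsilon>] by blast
  define h where "h = p * (1 - 1 / q)"
  define s where "s = 1 / p - 1"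
  have s0: "0 < s" using p by (simp add: s_def field_simps)
  have h_eq: "(1 - 1 / q) / (1 + s) = h" using p by (simp add: s_def h_def divide_inverse mult.commute)
  have x: "0 < 1 - 1 / q" "1 - 1 / q < 1" using q by auto
  have h: "0 < h" "h < 1"
    unfolding h_def using p x mult_strict_mono[of p 1 "1 - 1 / q" 1] by auto
  define S where "S = (\<Sum>j<K. (1 - h) ^ j * h * (q ^ Suc j) powr p)"
  define R where "R = (1 - h) ^ K * (q ^ K) powr p"
  have S0: "0 < S"
  proof -
    have "0 < (1 - h) ^ j * h * (q ^ Suc j) powr p" for j using h q by simp
    then show ?thesis unfolding S_def using q(2) by (intro sum_pos) auto
  qed
  have RS: "R \<le> \<epsilon> * S" using small by (simp only: R_def S_def h_def)
  have R0: "0 \<le> R" using h q by (simp add: R_def)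
  define \<eta> where "\<eta> = stop_time q s K"
  have \<eta>: "stopping \<eta>" unfolding \<eta>_def by (rule stopping_stop_time)
  have fin: "AE \<omega> in M. \<eta> \<omega> < top"
    using level_time_finite[OF q(1), of K]
  proof eventually_elim
    case (elim \<omega>)
    then show ?case unfolding \<eta>_def by (rule le_less_trans[OF stop_time_le])
  qed
  let ?X = "stopped_process B \<eta>"
  have inf_le: "process_norm M p (inf_process ?X) \<le> ennreal ((S + R) powr (1 / p))"
    unfolding process_norm_def
  proof (rule SUP_least)
    fix t :: real assume "t \<in> {0..}"
    then have t: "0 \<le> t" by simp
    have "(\<integral>\<^sup>+\<omega>. ennreal (\<bar>inf_process ?X t \<omega>\<bar> powr p) \<partial>M) \<le> ennreal (S + R)"
      using inf_process_moment_le[OF q(1) s0 p(1) t, of K] unfolding h_eq \<eta>_def S_def R_def .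
    then have "ennreal_powr (\<integral>\<^sup>+\<omega>. ennreal (\<bar>inf_process ?X t \<omega>\<bar> powr p) \<partial>M) (1 / p) \<le> ennreal_powr (ennreal (S + R)) (1 / p)"
      using p by (intro ennreal_powr_mono) auto
    also have "\<dots> = ennreal ((S + R) powr (1 / p))" using S0 R0 by (simp add: ennreal_powr_def del: ennreal_plus)
    finally show "ennreal_powr (\<integral>\<^sup>+\<omega>. ennreal (\<bar>inf_process ?X t \<omega>\<bar> powr p) \<partial>M) (1 / p) \<le> ennreal ((S + R) powr (1 / p))" .
  qed
  have max_ge: "ennreal (C * S) \<le> (SUP n. \<integral>\<^sup>+\<omega>. ennreal (\<bar>max_process ?X (real n) \<omega>\<bar> powr p) \<partial>M)"
  proof -
    note [measurable] = alive_sets upcross_sets final_max_measurable[OF \<eta>]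
    have "ennreal (C * S) = (\<Sum>j<K. ennreal (C * ((1 - h) ^ j * h * (q ^ Suc j) powr p)))"
    proof (subst sum_ennreal)
      show "0 \<le> C * ((1 - h) ^ j * h * (q ^ Suc j) powr p)" for j using C1 h by simp
      show "ennreal (C * S) = ennreal (\<Sum>j<K. C * ((1 - h) ^ j * h * (q ^ Suc j) powr p))"
        unfolding S_def sum_distrib_left ..
    qed
    also have "\<dots> \<le> (\<Sum>j<K. \<integral>\<^sup>+\<omega>. indicator (alive q s j \<inter> upcross q s j) \<omega> * ennreal (final_max \<eta> \<omega> powr p) \<partial>M)"
      unfolding C_def h_def s_def \<eta>_def
      by (intro sum_mono final_max_moment_piece[OF q(1) p]) simp
    also have "\<dots> = (\<integral>\<^sup>+\<omega>. (\<Sum>j<K. indicator (alive q s j \<inter> upcross q s j) \<omega> * ennreal (final_max \<eta> \<omega> powr p)) \<partial>M)"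
      by (rule nn_integral_sum[symmetric]) measurable
    \<comment> \<open>The pieces are disjoint events. Paths surviving all \<open>K\<close> stages
      are dropped from the lower bound for the maximum, although they count in \<open>R\<close> for
      the infimum.\<close>
    also have "\<dots> \<le> (\<integral>\<^sup>+\<omega>. ennreal (final_max \<eta> \<omega> powr p) \<partial>M)"
    proof (rule nn_integral_mono)
      fix \<omega> assume \<omega>: "\<omega> \<in> space M"
      have "(\<Sum>j<K. indicator (alive q s j \<inter> upcross q s j) \<omega> * ennreal (final_max \<eta> \<omega> powr p))
        = (\<Sum>j<K. indicator (alive q s j \<inter> upcross q s j) \<omega>) * ennreal (final_max \<eta> \<omega> powr p)"
        by (rule sum_distrib_right[symmetric])
      also have "\<dots> \<le> ((\<Sum>j<K. indicator (alive q s j \<inter> upcross q s j) \<omega>) + indicator (alive q s K) \<omega>) * ennreal (final_max \<eta> \<omega> powr p)"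
        by (intro mult_right_mono) auto
      finally show "(\<Sum>j<K. indicator (alive q s j \<inter> upcross q s j) \<omega> * ennreal (final_max \<eta> \<omega> powr p))
        \<le> ennreal (final_max \<eta> \<omega> powr p)"
        unfolding alive_partition[OF \<omega>] by simp
    qed
    also have "\<dots> \<le> (SUP n. \<integral>\<^sup>+\<omega>. ennreal (\<bar>max_process ?X (real n) \<omega>\<bar> powr p) \<partial>M)"
      by (rule final_max_moment_le[OF \<eta> fin p(1)])
    finally show ?thesis .
  qed
  have "\<not> process_norm M p (max_process ?X) \<le> c * process_norm M p (inf_process ?X)"
  proof
    assume le: "process_norm M p (max_process ?X) \<le> c * process_norm M p (inf_process ?X)"
    also have "\<dots> \<le> c * ennreal ((S + R) powr (1 / p))" by (intro mult_left_mono inf_le) simp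
    also have "\<dots> = ennreal (c0 * (S + R) powr (1 / p))" using c0 by (simp add: ennreal_mult)
    finally have le': "process_norm M p (max_process ?X) \<le> ennreal (c0 * (S + R) powr (1 / p))" .
    have y: "0 \<le> c0 * (S + R) powr (1 / p)" using c0 by simp
    have yp: "(c0 * (S + R) powr (1 / p)) powr p = a * (S + R)"
      using p S0 R0 by (simp add: powr_mult powr_powr a_def)
    have "(\<integral>\<^sup>+\<omega>. ennreal (\<bar>max_process ?X (real n) \<omega>\<bar> powr p) \<partial>M) \<le> ennreal (a * (S + R))" for n
    proof -
      have "ennreal_powr (\<integral>\<^sup>+\<omega>. ennreal (\<bar>max_process ?X (real n) \<omega>\<bar> powr p) \<partial>M) (1 / p) \<le> process_norm M p (max_process ?X)"
        unfolding process_norm_def by (rule SUP_upper) simp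
      then have "ennreal_powr (\<integral>\<^sup>+\<omega>. ennreal (\<bar>max_process ?X (real n) \<omega>\<bar> powr p) \<partial>M) (1 / p) \<le> ennreal (c0 * (S + R) powr (1 / p))"
        using le' by (rule order_trans)
      from ennreal_powr_le_imp[OF this y p(1)] show ?thesis unfolding yp .
    qed
    then have "(SUP n. \<integral>\<^sup>+\<omega>. ennreal (\<bar>max_process ?X (real n) \<omega>\<bar> powr p) \<partial>M) \<le> ennreal (a * (S + R))"
      by (intro SUP_least)
    with max_ge have "ennreal (C * S) \<le> ennreal (a * (S + R))" by (rule order_trans)
    then have "C * S \<le> a * (S + R)" using a0 S0 R0 by simp
    also have "\<dots> \<le> a * (S + \<epsilon> * S)" using a0 RS by (intro mult_left_mono add_left_mono) auto
    also have "\<dots> = (a * (1 + \<epsilon>)) * S" by (simp add: algebra_simps)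
    also have "\<dots> < C * S" using a\<epsilon> S0 by (intro mult_strict_right_mono)
    finally show False by simp
  qed
  then show ?thesis using \<eta> by blast
qed

end

lemma brownian_bm: "brownian bm_space bm"
proof -
  interpret prob_space bm_space by (rule prob_space_bm_space)
  show ?thesis
    by unfold_locales
      (use complete_measure_bm_space measurable_bm bm_0 continuous_bm bm_increment_distributed bm_indep in \<open>auto simp: complete_measure_def\<close>)
qed

theorem theorem1p5:
  fixes p :: real
  assumes "0 < p" and "p < 1"
  shows "(\<forall>(M :: 'a measure) F X. admissible_process M F X \<longrightarrow>
            process_norm M p (max_process X)
              \<le> ennreal (best_const p) * process_norm M p (inf_process X)) \<and>
         (\<forall>c < ennreal (best_const p).
            \<exists>(M :: (nat \<Rightarrow> real) measure) F X. admissible_process M F X \<and>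
              \<not> process_norm M p (max_process X) \<le> c * process_norm M p (inf_process X)) \<and>
         (\<forall>c < ennreal (best_const p).
            \<exists>(M :: (nat \<Rightarrow> real) measure) B \<eta>.
              brownian_motion M B \<and>
              ext_stopping_time M (natural_filtration M B) \<eta> \<and>
              admissible_process M (natural_filtration M B) (stopped_process B \<eta>) \<and>
              \<not> process_norm M p (max_process (stopped_process B \<eta>))
                  \<le> c * process_norm M p (inf_process (stopped_process B \<eta>)))"
proof -
  \<comment> \<open>Stopped Brownian motion settles the last claim and, being admissible, also the
    sharpness among all admissible processes.\<close>
  have stopped: "\<exists>(M :: (nat \<Rightarrow> real) measure) B \<eta>. brownian_motion M B \<and>
      ext_stopping_time M (natural_filtration M B) \<eta> \<and>
      admissible_process M (natural_filtration M B) (stopped_process B \<eta>) \<and>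
      \<not> process_norm M p (max_process (stopped_process B \<eta>))
          \<le> c * process_norm M p (inf_process (stopped_process B \<eta>))"
    if c: "c < ennreal (best_const p)" for c
  proof -
    interpret brownian bm_space bm by (rule brownian_bm)
    obtain \<eta> where \<eta>: "stopping \<eta>" "\<not> process_norm bm_space p (max_process (stopped_process bm \<eta>))
        \<le> c * process_norm bm_space p (inf_process (stopped_process bm \<eta>))"
      using stopped_ratio[OF assms c] by blast
    show ?thesis
      using brownian_motion_bm stopped_admissible[OF \<eta>(1)] \<eta>
      by (intro exI[of _ bm_space] exI[of _ bm] exI[of _ \<eta>] conjI)
  qed
  show ?thesis
  proof (intro conjI allI impI)
    fix M :: "'a measure" and F X
    assume "admissible_process M F X"
    then show "process_norm M p (max_process X) \<le> ennreal (best_const p) * process_norm M p (inf_process X)"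
      using assms by (rule process_norm_max_le)
  next
    fix c assume "c < ennreal (best_const p)"
    from stopped[OF this] show "\<exists>(M :: (nat \<Rightarrow> real) measure) F X. admissible_process M F X \<and>
        \<not> process_norm M p (max_process X) \<le> c * process_norm M p (inf_process X)"
      by blast
  qed (rule stopped)
qed

end
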